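(* Let $\beta>0$, $J,h\in\mathbb R$, let $\mu_\infty^M$ be the multiplicative Ising measure on $\Omega=\{-1,1\}^{\mathbb N}$ with parameters $\beta,J,h$, and let $f:\Omega\to\mathbb R$ be a first-layer function. Set $X_N(f)=\frac1N\sum_{i=1}^N T_if$. (a) Under $\mu^M_\infty$, the random variables $X_N(f)$ satisfy the large deviation principle (with speed $N$) with rate function $$I_f(x)=\sup_{t\in\mathbb R}\big(tx-\mathcal P^M(tf|\mu_\infty^M)\big).$$ (b) Moreover, they satisfy the central limit theorem: $$\sqrt N\,\big(X_N(f)-\mathbb E_{\mu_\infty^M}(X_N(f))\big)\to\mathcal N(0,\varsigma^2)$$ in distribution as $N\to\infty$, where $$\varsigma^2=\frac{d^2}{dt^2}\mathcal P^M(tf|\mu^M_\infty)\Big|_{t=0},$$ and, when $h=0$, also $$\varsigma^2=\lim_{N\to\infty}\frac1N\sum_{i,j=1}^N\Big(\mathbb E_{\mu_\infty^M}(T_if\,T_jf)-\big(\mathbb E_{\mu_\infty^M}(f)\big)^2\Big).$$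
   Context: $\mathbb N=\{1,2,\ldots\}$, $\mathbb N_0=\mathbb N\cup\{0\}$, $\Omega=\{-1,1\}^{\mathbb N}$, $\Omega_0=\{-1,1\}^{\mathbb N_0}$ (product topologies). Multiplicative shift: $(T_i\sigma)_j=\sigma_{ij}$, and $T_if(\sigma)=f(T_i\sigma)$. For odd $r\in\mathbb N$ put $\tau^r_i=\sigma_{r2^i}$, $i\in\mathbb N_0$, so $\tau^r\in\Omega_0$ (layer $r$). A continuous function $f:\Omega\to\mathbb R$ is a first-layer function if there is a continuous $f^*:\Omega_0\to\mathbb R$ with $f(\sigma)=f^*(\tau^1)$. The multiplicative Ising measure $\mu^M_\infty$ is the unique Gibbs measure on $\Omega$ (weights $e^{-\text{energy}}$) for the potential $U(\{i\},\sigma)=-\beta h\sigma_i$, $U(\{i,2i\},\sigma)=-\beta J\sigma_i\sigma_{2i}$, $U(A,\sigma)=0$ otherwise; equivalently, it is the law of $\sigma$ under which the layers $\tau^r$ ($r$ odd) are independent and each distributed as $\mu^{\mathrm{Ising}}_\infty$, the weak limit as $N\to\infty$ of the probability measures on $\{-1,1\}^{\{0,\ldots,N\}}$ with weights proportional to $\exp\big(\beta(\sum_{i=0}^{N-1}J\tau_i\tau_{i+1}+\sum_{i=0}^Nh\tau_i\pm\tau_N)\big)$ (the limit does not depend on the sign). The pressure of a first-layer function $f$ is the limit $$\mathcal P^M(f|\mu^M_\infty)=\lim_{N\to\infty}\frac1N\log\mathbb E_{\mu_\infty^M}\Big(e^{\sum_{i=1}^NT_if}\Big).$$ $\mathcal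 N(0,\varsigma^2)$ is the centered normal law with variance $\varsigma^2$ (the Dirac mass at $0$ if $\varsigma^2=0$). *)

theory Defs
  imports "HOL-Probability.Probability"
begin

text \<open>
  Spins are the reals \<open>-1\<close> and \<open>1\<close>. A configuration on an index set \<open>I\<close> is an element of
  \<open>PiE I (\<lambda>_. {-1, 1})\<close>, hence \<^const>\<open>undefined\<close> outside \<open>I\<close>. The spaces
  \<open>\<Omega> = {-1,1}\<^sup>\<nat>\<close> (with \<open>\<nat> = {1, 2, ...}\<close>) and \<open>\<Omega>\<^sub>0\<close> are the cases \<open>I = {1..}\<close> and
  \<open>I = UNIV\<close>. For these countable \<open>I\<close> the product sigma-algebra is the Borel sigma-algebra
  of the product topology.
\<close>

definition configs :: "nat set \<Rightarrow> (nat \<Rightarrow> real) set" where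
  "configs I = PiE I (\<lambda>_. {-1, 1})"

definition config_topology :: "nat set \<Rightarrow> (nat \<Rightarrow> real) topology" where
  "config_topology I = product_topology (\<lambda>_. discrete_topology {-1, 1}) I"

definition config_algebra :: "nat set \<Rightarrow> (nat \<Rightarrow> real) measure" where
  "config_algebra I = PiM I (\<lambda>_. count_space {-1, 1})"

definition mult_shift :: "nat \<Rightarrow> (nat \<Rightarrow> real) \<Rightarrow> nat \<Rightarrow> real" where
  "mult_shift i \<sigma> = (\<lambda>j\<in>{1..}. \<sigma> (i * j))"

definition layer :: "nat \<Rightarrow> (nat \<Rightarrow> real) \<Rightarrow> nat \<Rightarrow> real" where
  "layer r \<sigma> = (\<lambda>i. \<sigma> (r * 2 ^ i))"

definition first_layer_function :: "((nat \<Rightarrow> real) \<Rightarrow> real) \<Rightarrow> bool" where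
  "first_layer_function f \<longleftrightarrow>
     continuous_map (config_topology {1..}) euclideanreal f \<and>
     (\<exists>f0. continuous_map (config_topology UNIV) euclideanreal f0 \<and>
           (\<forall>\<sigma>\<in>configs {1..}. f \<sigma> = f0 (layer 1 \<sigma>)))"

section \<open>Gibbs measures\<close>

text \<open>
  The sum ranges over the finite sets of sites that meet \<open>\<Lambda>\<close>, including those that are not
  contained in \<open>\<Lambda>\<close> (interaction with the boundary condition). It is meaningful for potentials
  such as the finite-range one below, for which only finitely many terms are nonzero.
\<close>

definition hamiltonian ::
    "(nat set \<Rightarrow> (nat \<Rightarrow> real) \<Rightarrow> real) \<Rightarrow> nat set \<Rightarrow> (nat \<Rightarrow> real) \<Rightarrow> real" where
  "hamiltonian U \<Lambda> \<sigma> =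
     (\<Sum>\<^sub>\<infinity>A\<in>{A. finite A \<and> A \<subseteq> {1..} \<and> A \<inter> \<Lambda> \<noteq> {}}. U A \<sigma>)"

definition partition_function ::
    "(nat set \<Rightarrow> (nat \<Rightarrow> real) \<Rightarrow> real) \<Rightarrow> nat set \<Rightarrow> (nat \<Rightarrow> real) \<Rightarrow> real" where
  "partition_function U \<Lambda> \<eta> =
     (\<Sum>\<omega>\<in>configs \<Lambda>. exp (- hamiltonian U \<Lambda> (override_on \<eta> \<omega> \<Lambda>)))"

text \<open>
  The probability of the event \<open>B\<close> under the Gibbs distribution in the finite volume \<open>\<Lambda>\<close>
  with boundary condition \<open>\<eta>\<close>.
\<close>

definition gibbs_kernel ::
    "(nat set \<Rightarrow> (nat \<Rightarrow> real) \<Rightarrow> real) \<Rightarrow> nat set \<Rightarrow> (nat \<Rightarrow> real) set \<Rightarrow> (nat \<Rightarrow> real) \<Rightarrow> real"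
    where
  "gibbs_kernel U \<Lambda> B \<eta> =
     (\<Sum>\<omega>\<in>configs \<Lambda>. exp (- hamiltonian U \<Lambda> (override_on \<eta> \<omega> \<Lambda>)) *
                      indicator B (override_on \<eta> \<omega> \<Lambda>)) / partition_function U \<Lambda> \<eta>"

text \<open>Gibbs measures on \<open>\<Omega>\<close> are characterised by the Dobrushin--Lanford--Ruelle equations.\<close>

definition gibbs_measure ::
    "(nat set \<Rightarrow> (nat \<Rightarrow> real) \<Rightarrow> real) \<Rightarrow> (nat \<Rightarrow> real) measure \<Rightarrow> bool" where
  "gibbs_measure U \<mu> \<longleftrightarrow>
     prob_space \<mu> \<and> sets \<mu> = sets (config_algebra {1..}) \<and>
     (\<forall>\<Lambda>. finite \<Lambda> \<and> \<Lambda> \<subseteq> {1..} \<longrightarrow>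
        (\<forall>B\<in>sets \<mu>. measure \<mu> B = (LINT \<eta>|\<mu>. gibbs_kernel U \<Lambda> B \<eta>)))"

text \<open>\<^term>\<open>Min A\<close> recovers \<open>i\<close> both from \<open>A = {i}\<close> and from \<open>A = {i, 2 * i}\<close>.\<close>

definition mult_ising_potential ::
    "real \<Rightarrow> real \<Rightarrow> real \<Rightarrow> nat set \<Rightarrow> (nat \<Rightarrow> real) \<Rightarrow> real" where
  "mult_ising_potential \<beta> J h A \<sigma> =
     (if \<exists>i\<ge>1. A = {i} then - \<beta> * h * \<sigma> (Min A)
      else if \<exists>i\<ge>1. A = {i, 2 * i} then - \<beta> * J * \<sigma> (Min A) * \<sigma> (2 * Min A)
      else 0)"

text \<open>This potential has exactly one Gibbs measure.\<close>

definition mult_ising_measure ::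
    "real \<Rightarrow> real \<Rightarrow> real \<Rightarrow> (nat \<Rightarrow> real) measure \<Rightarrow> bool" where
  "mult_ising_measure \<beta> J h \<mu> \<longleftrightarrow> gibbs_measure (mult_ising_potential \<beta> J h) \<mu>"

section \<open>Multiplicative ergodic averages and pressure\<close>

definition mult_average :: "((nat \<Rightarrow> real) \<Rightarrow> real) \<Rightarrow> nat \<Rightarrow> (nat \<Rightarrow> real) \<Rightarrow> real" where
  "mult_average f N \<sigma> = (\<Sum>i=1..N. f (mult_shift i \<sigma>)) / real N"

definition finite_pressure ::
    "(nat \<Rightarrow> real) measure \<Rightarrow> ((nat \<Rightarrow> real) \<Rightarrow> real) \<Rightarrow> nat \<Rightarrow> real" where
  "finite_pressure \<mu> f N =
     ln (LINT \<sigma>|\<mu>. exp (\<Sum>i=1..N. f (mult_shift i \<sigma>))) / real N"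

definition pressure :: "(nat \<Rightarrow> real) measure \<Rightarrow> ((nat \<Rightarrow> real) \<Rightarrow> real) \<Rightarrow> real" where
  "pressure \<mu> f = lim (finite_pressure \<mu> f)"

section \<open>Large deviations and normal laws\<close>

definition ext_ln :: "real \<Rightarrow> ereal" where
  "ext_ln p = (if p \<le> 0 then -\<infinity> else ereal (ln p))"

definition rate_function :: "('a::topological_space \<Rightarrow> ereal) \<Rightarrow> bool" where
  "rate_function I \<longleftrightarrow> (\<forall>x. 0 \<le> I x) \<and> (\<forall>c. closed {x. I x \<le> c})"

definition large_deviation_principle ::
    "(nat \<Rightarrow> 'a::topological_space measure) \<Rightarrow> (nat \<Rightarrow> real) \<Rightarrow> ('a \<Rightarrow> ereal) \<Rightarrow> bool" where
  "large_deviation_principle P a I \<longleftrightarrow>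
     rate_function I \<and>
     (\<forall>F. closed F \<longrightarrow>
        limsup (\<lambda>n. ereal (1 / a n) * ext_ln (measure (P n) F)) \<le> - (INF x\<in>F. I x)) \<and>
     (\<forall>G. open G \<longrightarrow>
        - (INF x\<in>G. I x) \<le> liminf (\<lambda>n. ereal (1 / a n) * ext_ln (measure (P n) G)))"

definition centered_normal :: "real \<Rightarrow> real measure" where
  "centered_normal v =
     (if v = 0 then return borel 0 else density lborel (normal_density 0 (sqrt v)))"

end

theory Submission
  imports Defs
begin

text \<open>
  The sum \<open>f(T\<^sub>1\<sigma>) + ... + f(T\<^sub>N\<sigma>)\<close> splits over the odd \<open>r \<le> N\<close>: the indices \<open>i = r * 2\<^sup>k\<close> contribute
  an ergodic sum of \<open>f\<^sup>*\<close> along layer \<open>r\<close>, whose length is \<open>n\<close> for asymptotically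
  \<open>2\<^sup>-\<^sup>n\<^sup>-\<^sup>1 N\<close> values of \<open>r\<close>. Under the Gibbs measure the layers are independent and identically
  distributed: the DLR equation for \<open>{r, 2r, ..., 2\<^sup>n\<^sup>-\<^sup>1r}\<close> describes an Ising chain that depends on the rest
  only through one boundary spin, and the \<open>2 \<times> 2\<close> transfer matrix forgets that spin as \<open>n\<close> grows.
  Hence the pressure is \<open>P(t) = \<Sum>\<^sub>n 2\<^sup>-\<^sup>n\<^sup>-\<^sup>1 \<phi>\<^sub>n(t)\<close>, with \<open>\<phi>\<^sub>n\<close> the cumulant generating function of
  an ergodic sum of length \<open>n\<close>. Since \<open>\<phi>\<^sub>n'\<close> and \<open>\<phi>\<^sub>n''\<close> grow polynomially in \<open>n\<close>, \<open>P\<close> is twice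
  differentiable; the large deviation principle is then the one-dimensional Gaertner--Ellis theorem, and
  the central limit theorem follows from third-order bounds on the characteristic functions of the layers.
  For \<open>h = 0\<close> the law of a layer is shift invariant, so the double sum is the variance of the total.
\<close>

section \<open>The Gaertner--Ellis theorem for bounded real variables\<close>

text \<open>Only the DLR equations are given, so the law of a layer has to be read off from finite
  volumes. The device is to test the DLR equation on an event about layer r intersected with an
  event that layer r cannot influence. The same chain expectation appears whatever the odd r and the
  second event are, and this one identity yields both equidistribution and independence. The weight
  \<open>2^(-n-1)\<close> arises because the layers of length n belong to the odd r in (N/2^n,
  N/2^(n-1)], half of an interval of length N/2^n. Such weights beat every polynomial, so the crude
  bounds K n and 2 (K n)^2 on the derivatives of phi_n suffice, and no asymptotics of long chains
  enter the pressure. Convergence of the pressures at each fixed t does not resolve fluctuations of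
  order 1/sqrt N; this is why the central limit theorem goes through characteristic functions. In
  the large deviation lower bound the obstacle is that a point need not be a slope of P, so points
  are replaced by nearby slopes of no larger cost.\<close>

lemma ext_ln_scaled_le_iff:
  assumes "n > 0"
  shows "ereal (1 / n) * ext_ln p \<le> ereal y \<longleftrightarrow> p \<le> exp (n * y)"
proof (cases "p \<le> 0")
  case True
  then have "p \<le> exp (n * y)"
    using exp_gt_zero[of "n * y"] by linarith
  then show ?thesis using True assms by (simp add: ext_ln_def)
next
  case False
  then have "ln p / n \<le> y \<longleftrightarrow> ln p \<le> n * y"
    using assms by (simp add: field_simps)
  also have "\<dots> \<longleftrightarrow> p \<le> exp (n * y)"
    using False by (metis exp_gt_zero exp_le_cancel_iff exp_ln not_le)
  finally show ?thesis using False by (simp add: ext_ln_def)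
qed

text \<open>With \<open>ext_ln_scaled_le_iff\<close> this turns large deviation bounds into
  inequalities between probabilities and exponentials. For \<open>p \<le> 0\<close> both sides are
  false here and both are true there, so null events never form a separate case later.\<close>

lemma ext_ln_scaled_ge_iff:
  assumes "n > 0"
  shows "ereal y \<le> ereal (1 / n) * ext_ln p \<longleftrightarrow> exp (n * y) \<le> p"
proof (cases "p \<le> 0")
  case True
  then have "\<not> exp (n * y) \<le> p"
    using exp_gt_zero[of "n * y"] by linarith
  then show ?thesis using True assms by (simp add: ext_ln_def)
next
  case False
  then have "y \<le> ln p / n \<longleftrightarrow> n * y \<le> ln p"
    using assms by (simp add: field_simps)
  also have "\<dots> \<longleftrightarrow> exp (n * y) \<le> p"
    using False by (metis exp_gt_zero exp_le_cancel_iff exp_ln not_le)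
  finally show ?thesis using False by (simp add: ext_ln_def)
qed

text \<open>The term t = 0 gives nonnegativity. A sublevel set is an intersection over t of closed
  sets, whatever the regularity of \<open>P\<close>.\<close>

lemma rate_function_Legendre:
  fixes P :: "real \<Rightarrow> real"
  assumes "P 0 = 0"
  shows "rate_function (\<lambda>x. SUP t. ereal (t * x - P t))"
  unfolding rate_function_def
proof (intro conjI allI)
  fix x :: real
  have "ereal (0 * x - P 0) \<le> (SUP t. ereal (t * x - P t))"
    by (rule SUP_upper) simp
  then show "0 \<le> (SUP t. ereal (t * x - P t))"
    using assms by (simp add: zero_ereal_def)
next
  fix c :: ereal
  have "{x. (SUP t. ereal (t * x - P t)) \<le> c} = (\<Inter>t. {x. ereal (t * x - P t) \<le> c})"
    by (auto simp: SUP_le_iff)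
  also have "closed \<dots>"
    by (intro closed_INT ballI closed_Collect_le continuous_intros)
  finally show "closed {x. (SUP t. ereal (t * x - P t)) \<le> c}" .
qed

text \<open>Minimising \<open>P t - t * x + \<delta> * t\<^sup>2\<close>, which is bounded below as soon as the
  Legendre transform is finite at \<open>x\<close>, replaces \<open>x\<close> by a slope of \<open>P\<close>.\<close>

lemma Legendre_approx_by_slopes:
  fixes P :: "real \<Rightarrow> real"
  assumes diff: "\<And>t. P differentiable (at t)" and P0: "P 0 = 0"
    and c: "\<And>t. t * x - P t \<le> c" and e: "e > 0"
  obtains t y where "(P has_real_derivative y) (at t)" "\<bar>y - x\<bar> < e" "t * y - P t \<le> c"
proof -
  have c0: "c \<ge> 0" using c[of 0] P0 by simp
  \<comment> \<open>Chosen for the final estimate: at the minimiser,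
    \<open>(y - x)^2 = 4 * d * (d * t^2)\<close> is at most
    \<open>4 * d * c = e^2 * c / (c + 1)\<close>, which is below \<open>e^2\<close>.\<close>
  define d where "d = e\<^sup>2 / (4 * (c + 1))"
  have d: "d > 0" using e c0 by (simp add: d_def)
  define g where "g t = P t - t * x + d * t\<^sup>2" for t
  \<comment> \<open>Beyond \<open>R\<close> the penalty exceeds \<open>c\<close>, while
    \<open>P s - s * x\<close> is at least \<open>- c\<close>. So \<open>g\<close> is positive
    there, \<open>g 0 = 0\<close>, and a minimum over \<open>{-R..R}\<close> is global.\<close>
  define R where "R = sqrt (c / d) + 1"
  have R: "R > 0" "d * R\<^sup>2 > c"
  proof -
    have s: "sqrt (c / d) \<ge> 0" using c0 d by simp
    then show "R > 0" unfolding R_def by linarith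
    have "(sqrt (c / d))\<^sup>2 < R\<^sup>2" using s by (intro power_strict_mono) (auto simp: R_def)
    then have "c / d < R\<^sup>2" using c0 d by simp
    then show "d * R\<^sup>2 > c" using d by (simp add: field_simps)
  qed
  have contP: "continuous_on A P" for A
    using diff by (meson continuous_at_imp_continuous_on differentiable_imp_continuous_within)
  have "continuous_on {-R..R} g"
    unfolding g_def by (intro continuous_intros contP)
  moreover have "{-R..R} \<noteq> {}" using R by simp
  ultimately obtain t where t: "t \<in> {-R..R}" and min: "\<And>s. s \<in> {-R..R} \<Longrightarrow> g t \<le> g s"
    using continuous_attains_inf[of "{-R..R}" g] by auto
  have gt0: "g t \<le> 0" using min[of 0] R P0 by (simp add: g_def)
  have far: "g s > 0" if "\<bar>s\<bar> \<ge> R" for s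
  proof -
    have "R\<^sup>2 \<le> s\<^sup>2" using that R(1) by (simp add: abs_le_square_iff[symmetric])
    then have "d * R\<^sup>2 \<le> d * s\<^sup>2" using d by simp
    then show ?thesis using R(2) c[of s] by (simp add: g_def)
  qed
  have min': "g t \<le> g s" for s
  proof (cases "\<bar>s\<bar> \<ge> R")
    case True
    then show ?thesis using far[of s] gt0 by linarith
  next
    case False
    then have "s \<in> {-R..R}" unfolding atLeastAtMost_iff by linarith
    then show ?thesis by (rule min)
  qed
  obtain y where y: "(P has_real_derivative y) (at t)"
    using diff[of t] by (auto simp: real_differentiable_def)
  have "(g has_real_derivative (y - x + 2 * d * t)) (at t)"
    unfolding g_def by (auto intro!: derivative_eq_intros y)
  then have y_eq: "y - x + 2 * d * t = 0"
    using min' by (intro DERIV_local_min[of g _ t 1]) auto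
  have dt: "d * t\<^sup>2 \<le> c" using gt0 c[of t] by (simp add: g_def)
  have "(y - x)\<^sup>2 = 4 * d * (d * t\<^sup>2)"
  proof -
    have "y - x = - (2 * d * t)" using y_eq by simp
    then show ?thesis by (simp add: power2_eq_square)
  qed
  also have "\<dots> \<le> 4 * d * c" using dt d by (intro mult_left_mono) auto
  also have "\<dots> = e\<^sup>2 * (c / (c + 1))" using c0 by (simp add: d_def divide_simps)
  also have "\<dots> < e\<^sup>2"
    using c0 e by (simp add: field_simps)
  finally have "\<bar>y - x\<bar>\<^sup>2 < e\<^sup>2" by simp
  then have "\<bar>y - x\<bar> < e" using e by (simp add: power2_less_imp_less)
  moreover have "t * y - P t \<le> c"
  proof -
    have "t * y = t * x - 2 * (d * t\<^sup>2)"
    proof -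
      have y: "y = x - 2 * d * t" using y_eq by simp
      show ?thesis unfolding y by (simp add: power2_eq_square algebra_simps)
    qed
    moreover have "d * t\<^sup>2 \<ge> 0" using d by simp
    ultimately show ?thesis using c[of t] by simp
  qed
  ultimately show thesis using that y by blast
qed

section \<open>Exponential tilting and the two large deviation bounds\<close>

locale bounded_gaertner_ellis = prob_space +
  fixes X :: "nat \<Rightarrow> 'a \<Rightarrow> real" and P :: "real \<Rightarrow> real" and K :: real
  assumes rv [measurable]: "\<And>n. random_variable borel (X n)"
    and bounded: "\<And>n \<omega>. \<omega> \<in> space M \<Longrightarrow> \<bar>X n \<omega>\<bar> \<le> K"
    and pressure_limit:
      "\<And>t. (\<lambda>n. ln (expectation (\<lambda>\<omega>. exp (t * (real n * X n \<omega>)))) / real n) \<longlonglongrightarrow> P t"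
begin

definition Z :: "nat \<Rightarrow> real \<Rightarrow> real" where
  "Z n t = expectation (\<lambda>\<omega>. exp (t * (real n * X n \<omega>)))"

lemma exp_bounded: "\<omega> \<in> space M \<Longrightarrow> exp (t * (real n * X n \<omega>)) \<le> exp (\<bar>t\<bar> * (real n * K))"
proof -
  assume w: "\<omega> \<in> space M"
  have "t * (real n * X n \<omega>) \<le> \<bar>t * (real n * X n \<omega>)\<bar>" by simp
  also have "\<dots> \<le> \<bar>t\<bar> * (real n * K)"
    using bounded[OF w, of n] by (simp add: abs_mult mult_left_mono)
  finally show ?thesis by simp
qed

lemma integrable_exp [simp]: "integrable M (\<lambda>\<omega>. exp (t * (real n * X n \<omega>)))"
  by (rule integrable_const_bound[where B = "exp (\<bar>t\<bar> * (real n * K))"])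
     (use exp_bounded in auto)

lemma Z_pos: "Z n t > 0"
proof -
  have "0 < exp (- (\<bar>t\<bar> * (real n * K)))" by simp
  also have "\<dots> = expectation (\<lambda>\<omega>. exp (- (\<bar>t\<bar> * (real n * K))))"
    by (simp add: prob_space)
  also have "\<dots> \<le> Z n t"
    unfolding Z_def
  proof (rule integral_mono)
    fix \<omega> assume "\<omega> \<in> space M"
    from exp_bounded[OF this, of "-t" n]
    show "exp (- (\<bar>t\<bar> * (real n * K))) \<le> exp (t * (real n * X n \<omega>))" by simp
  qed auto
  finally show ?thesis .
qed

lemma P_0: "P 0 = 0"
  using pressure_limit[of 0] by (simp add: prob_space LIMSEQ_const_iff)

lemma Z_le: "d > 0 \<Longrightarrow> \<forall>\<^sub>F n in sequentially. Z n t \<le> exp (real n * (P t + d))"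
proof -
  assume "d > 0"
  then have "\<forall>\<^sub>F n in sequentially. ln (Z n t) / real n < P t + d"
    using order_tendstoD(2)[OF pressure_limit[of t]] by (simp add: Z_def)
  then show ?thesis using eventually_gt_at_top[of 0]
  proof eventually_elim
    case (elim n)
    then have "ln (Z n t) \<le> real n * (P t + d)" by (simp add: field_simps)
    then show ?case using Z_pos[of n t] by (metis exp_le_cancel_iff exp_ln)
  qed
qed

lemma Z_ge: "d > 0 \<Longrightarrow> \<forall>\<^sub>F n in sequentially. exp (real n * (P t - d)) \<le> Z n t"
proof -
  assume "d > 0"
  then have "\<forall>\<^sub>F n in sequentially. P t - d < ln (Z n t) / real n"
    using order_tendstoD(1)[OF pressure_limit[of t]] by (simp add: Z_def)
  then show ?thesis using eventually_gt_at_top[of 0]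
  proof eventually_elim
    case (elim n)
    then have "real n * (P t - d) \<le> ln (Z n t)" by (simp add: field_simps)
    then show ?case using Z_pos[of n t] by (metis exp_le_cancel_iff exp_ln)
  qed
qed

text \<open>One exponential Markov inequality serves two purposes: t = 0 gives ordinary tail bounds,
  and general t gives tails under the tilted law, whose unnormalised density is
  \<open>exp (t * (real n * X n \<omega>))\<close>.\<close>

lemma Chernoff:
  assumes A [measurable]: "A \<in> events"
    and le: "\<And>\<omega>. \<omega> \<in> A \<Longrightarrow> t * X n \<omega> + y \<le> s * X n \<omega>"
  shows "expectation (\<lambda>\<omega>. exp (t * (real n * X n \<omega>)) * indicator A \<omega>) \<le> exp (- real n * y) * Z n s"
proof -
  have "expectation (\<lambda>\<omega>. exp (t * (real n * X n \<omega>)) * indicator A \<omega>)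
      \<le> expectation (\<lambda>\<omega>. exp (- real n * y) * exp (s * (real n * X n \<omega>)))"
  proof (rule integral_mono)
    show "integrable M (\<lambda>\<omega>. exp (t * (real n * X n \<omega>)) * indicator A \<omega>)"
      by (rule integrable_real_mult_indicator) auto
    fix \<omega> assume "\<omega> \<in> space M"
    show "exp (t * (real n * X n \<omega>)) * indicator A \<omega> \<le> exp (- real n * y) * exp (s * (real n * X n \<omega>))"
    proof (cases "\<omega> \<in> A")
      case True
      then have "real n * (t * X n \<omega> + y) \<le> real n * (s * X n \<omega>)"
        by (intro mult_left_mono le) auto
      then show ?thesis using True
        by (simp add: exp_add[symmetric] algebra_simps)
    qed simp
  qed auto
  then show ?thesis by (simp add: Z_def)
qed

lemma prob_Chernoff:
  assumes "A \<in> events" and "\<And>\<omega>. \<omega> \<in> A \<Longrightarrow> y \<le> s * X n \<omega>"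
  shows "prob A \<le> exp (- real n * y) * Z n s"
proof -
  have "A \<inter> space M = A" using sets.sets_into_space[OF assms(1)] by blast
  then show ?thesis using Chernoff[of A 0 n y s] assms by simp
qed

text \<open>If \<open>c\<close> is below the infimum of the rate, each point of \<open>F\<close>
  lies in an open set \<open>U t\<close> where \<open>t * y - P t\<close> exceeds \<open>c\<close>.
  The uniform bound on \<open>X\<close> replaces \<open>F\<close> by a compact set, so finitely many
  t suffice. Each contributes a Chernoff bound, and their number is absorbed into
  \<open>exp (real n * d)\<close>.\<close>

lemma upper_bound:
  assumes "closed F"
  shows "limsup (\<lambda>n. ereal (1 / real n) * ext_ln (measure (distr M borel (X n)) F))
    \<le> - (INF x\<in>F. SUP t. ereal (t * x - P t))" (is "?L \<le> - ?I")
proof -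
  have main: "?L \<le> ereal (- c + 2 * d)" if c: "ereal c < ?I" and d: "d > 0" for c d
  proof -
    define U where "U t = {y::real. c < t * y - P t}" for t
    have openU: "open (U t)" for t
      unfolding U_def by (intro open_Collect_less continuous_intros)
    have cover: "F \<inter> {-K..K} \<subseteq> (\<Union>t\<in>UNIV. U t)"
    proof
      fix x assume "x \<in> F \<inter> {-K..K}"
      then have "?I \<le> (SUP t. ereal (t * x - P t))" by (intro INF_lower) auto
      with c have "ereal c < (SUP t. ereal (t * x - P t))" by (rule less_le_trans)
      then show "x \<in> (\<Union>t\<in>UNIV. U t)" by (auto simp: less_SUP_iff U_def)
    qed
    have "compact (F \<inter> {-K..K})"
      using assms by (intro closed_Int_compact) auto
    then obtain T where T: "finite T" "F \<inter> {-K..K} \<subseteq> (\<Union>t\<in>T. U t)"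
      using compactE_image[OF _ _ cover] openU by metis
    have "\<forall>\<^sub>F n in sequentially. \<forall>t\<in>T. Z n t \<le> exp (real n * (P t + d))"
      using Z_le[OF d] T(1) by (simp add: eventually_ball_finite)
    moreover have "\<forall>\<^sub>F n in sequentially. real (card T) \<le> exp (real n * d)"
    proof -
      have "filterlim (\<lambda>n. exp (real n * d)) at_top sequentially"
        by (rule filterlim_compose[OF exp_at_top], rule filterlim_at_top_mult_tendsto_pos[OF tendsto_const d])
           (rule filterlim_real_sequentially)
      then show ?thesis by (simp add: filterlim_at_top)
    qed
    ultimately have "\<forall>\<^sub>F n in sequentially.
        ereal (1 / real n) * ext_ln (measure (distr M borel (X n)) F) \<le> ereal (- c + 2 * d)"
      using eventually_gt_at_top[of 0]
    proof eventually_elim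
      case (elim n)
      have [measurable]: "F \<in> sets borel" "U t \<in> sets borel" for t
        using assms openU by auto
      have "measure (distr M borel (X n)) F = prob {\<omega>\<in>space M. X n \<omega> \<in> F}"
        by (simp add: measure_distr vimage_def Int_def conj_commute)
      also have "\<dots> \<le> prob (\<Union>t\<in>T. {\<omega>\<in>space M. X n \<omega> \<in> U t})"
      proof (rule finite_measure_mono)
        show "{\<omega>\<in>space M. X n \<omega> \<in> F} \<subseteq> (\<Union>t\<in>T. {\<omega>\<in>space M. X n \<omega> \<in> U t})"
        proof
          fix \<omega> assume w: "\<omega> \<in> {\<omega>\<in>space M. X n \<omega> \<in> F}"
          then have "X n \<omega> \<in> F \<inter> {-K..K}" using bounded[of \<omega> n] by auto
          then show "\<omega> \<in> (\<Union>t\<in>T. {\<omega>\<in>space M. X n \<omega> \<in> U t})" using T(2) w by blast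
        qed
      qed (use T(1) in auto)
      also have "\<dots> \<le> (\<Sum>t\<in>T. prob {\<omega>\<in>space M. X n \<omega> \<in> U t})"
        using T(1) by (intro finite_measure_subadditive_finite) auto
      also have "\<dots> \<le> (\<Sum>t\<in>T. exp (real n * (d - c)))"
      proof (rule sum_mono)
        fix t assume t: "t \<in> T"
        have "prob {\<omega>\<in>space M. X n \<omega> \<in> U t} \<le> exp (- real n * (c + P t)) * Z n t"
          by (rule prob_Chernoff) (auto simp: U_def)
        also have "\<dots> \<le> exp (- real n * (c + P t)) * exp (real n * (P t + d))"
          using elim t by (intro mult_left_mono) auto
        also have "\<dots> = exp (real n * (d - c))"
          by (simp add: exp_add[symmetric] algebra_simps)
        finally show "prob {\<omega>\<in>space M. X n \<omega> \<in> U t} \<le> exp (real n * (d - c))" .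
      qed
      also have "\<dots> \<le> exp (real n * d) * exp (real n * (d - c))"
        using elim by (simp add: mult_right_mono)
      also have "\<dots> = exp (real n * (- c + 2 * d))"
        by (simp add: exp_add[symmetric] algebra_simps)
      finally show ?case
        using elim by (subst ext_ln_scaled_le_iff) auto
    qed
    then show ?thesis by (rule Limsup_bounded)
  qed
  \<comment> \<open>\<open>?I\<close> may be infinite, so \<open>main\<close> is applied at real
    levels between b and \<open>?I\<close>. The slack \<open>d = (c' - b') / 2\<close> makes
    \<open>- c' + 2 * d\<close> equal to \<open>- b'\<close>.\<close>
  have "?I \<le> - ?L"
  proof (rule dense_le)
    fix b assume b: "b < ?I"
    then obtain c where c: "b < c" "c < ?I" using dense by blast
    show "b \<le> - ?L"
    proof (cases b)
      case (real b')
      then obtain c' where c': "c = ereal c'" using c by (cases c) auto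
      have "?L \<le> ereal (- c' + 2 * ((c' - b') / 2))"
        by (rule main) (use c c' real in auto)
      also have "- c' + 2 * ((c' - b') / 2) = - b'" by (simp add: field_simps)
      finally have "?L \<le> - b" using real by simp
      then show ?thesis using ereal_minus_le_minus[of "- b" ?L] by simp
    qed (use b in auto)
  qed
  then show ?thesis using ereal_minus_le_minus[of "- ?L" ?I] by simp
qed

text \<open>Under the tilted law \<open>X\<^sub>n\<close> concentrates at \<open>y = P' t\<close>: each tail is
  exponentially small because \<open>P (t + s) - P t - s * y\<close> is \<open>o(s)\<close>.\<close>

lemma tilted_tail:
  assumes y: "(P has_real_derivative y) (at t)" and e: "e > 0" and \<sigma>: "\<sigma> = 1 \<or> \<sigma> = -1"
  shows "\<forall>\<^sub>F n in sequentially.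
    expectation (\<lambda>\<omega>. exp (t * (real n * X n \<omega>)) * indicator {\<omega>\<in>space M. \<sigma> * (X n \<omega> - y) \<ge> e} \<omega>)
      \<le> Z n t / 4"
proof -
  have lim: "((\<lambda>h. (P (t + h) - P t) / h) \<longlongrightarrow> y) (at 0)"
    using y by (simp add: DERIV_def)
  then have "\<forall>\<^sub>F h in at 0. \<bar>(P (t + h) - P t) / h - y\<bar> < e / 2"
    using e by (auto dest!: tendstoD[of _ _ _ "e / 2"] simp: dist_real_def)
  then obtain r where r: "r > 0" and
    *: "\<And>h. h \<noteq> 0 \<Longrightarrow> \<bar>h\<bar> < r \<Longrightarrow> \<bar>(P (t + h) - P t) / h - y\<bar> < e / 2"
    by (auto simp: eventually_at dist_real_def)
  \<comment> \<open>The extra tilt points in the direction of the tail that is being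
    estimated.\<close>
  define h where "h = \<sigma> * (r / 2)"
  have h: "h \<noteq> 0" "\<bar>h\<bar> = r / 2" "\<bar>h\<bar> < r" using r \<sigma> by (auto simp: h_def)
  have Ph: "P (t + h) - P t < h * y + \<bar>h\<bar> * (e / 2)"
  proof -
    have "(P (t + h) - P t) - h * y = h * ((P (t + h) - P t) / h - y)"
      using h by (simp add: field_simps)
    also have "\<dots> \<le> \<bar>h\<bar> * \<bar>(P (t + h) - P t) / h - y\<bar>"
      by (metis abs_ge_self abs_mult)
    also have "\<dots> < \<bar>h\<bar> * (e / 2)"
      using *[OF h(1,3)] h(1) by (intro mult_strict_left_mono) auto
    finally show ?thesis by simp
  qed
  \<comment> \<open>The tail gains \<open>\<bar>h\<bar> * e\<close> and the derivative estimate
    costs half of it, which leaves \<open>4 * q\<close>. One q pays for the upper estimate of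
    \<open>Z n (t + h)\<close>, one for the lower estimate of \<open>Z n t\<close>, one for the
    factor 1/4.\<close>
  define q where "q = \<bar>h\<bar> * e / 8"
  have q: "q > 0" using h e by (simp add: q_def)
  have "filterlim (\<lambda>n. exp (real n * q)) at_top sequentially"
    by (rule filterlim_compose[OF exp_at_top], rule filterlim_at_top_mult_tendsto_pos[OF tendsto_const q])
       (rule filterlim_real_sequentially)
  then have "\<forall>\<^sub>F n in sequentially. 4 \<le> exp (real n * q)"
    by (simp add: filterlim_at_top)
  with Z_le[OF q, of "t + h"] Z_ge[OF q, of t] show ?thesis
  proof eventually_elim
    case (elim n)
    have "expectation (\<lambda>\<omega>. exp (t * (real n * X n \<omega>)) * indicator {\<omega>\<in>space M. \<sigma> * (X n \<omega> - y) \<ge> e} \<omega>)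
        \<le> exp (- real n * (h * y + \<bar>h\<bar> * e)) * Z n (t + h)"
    proof (rule Chernoff)
      fix \<omega> assume "\<omega> \<in> {\<omega>\<in>space M. \<sigma> * (X n \<omega> - y) \<ge> e}"
      then have "(r / 2) * e \<le> (r / 2) * (\<sigma> * (X n \<omega> - y))"
        using r by (intro mult_left_mono) auto
      also have "\<dots> = h * (X n \<omega> - y)" by (simp add: h_def)
      finally show "t * X n \<omega> + (h * y + \<bar>h\<bar> * e) \<le> (t + h) * X n \<omega>"
        unfolding h(2) by (simp add: algebra_simps)
    qed auto
    also have "\<dots> \<le> exp (- real n * (h * y + \<bar>h\<bar> * e)) * exp (real n * (P (t + h) + q))"
      using elim by (intro mult_left_mono) auto
    also have "\<dots> = exp (real n * (P (t + h) + q - (h * y + \<bar>h\<bar> * e)))"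
      by (simp add: exp_add[symmetric] algebra_simps)
    also have "\<dots> \<le> exp (real n * (P t - q - q))"
    proof -
      have "P (t + h) + q - (h * y + \<bar>h\<bar> * e) \<le> P t - q - q"
        using Ph q unfolding q_def by linarith
      then show ?thesis by (simp add: mult_left_mono)
    qed
    also have "\<dots> = exp (real n * (P t - q)) / exp (real n * q)"
      by (simp add: exp_diff[symmetric] algebra_simps)
    also have "\<dots> \<le> Z n t / 4"
      using elim Z_pos[of n t] by (intro frac_le) auto
    finally show ?case .
  qed
qed

text \<open>Change of measure: by \<open>tilted_tail\<close> the two tails carry at most half of the
  tilted mass, so the event near \<open>y\<close> carries at least \<open>Z n t / 2\<close>. There
  the tilting density is at most \<open>exp (real n * (t * y + \<bar>t\<bar> * e))\<close>, and
  dividing by it returns to the original law. Half of \<open>d\<close> pays for \<open>Z_ge\<close>,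
  half for the factor 2.\<close>

lemma prob_near_slope:
  assumes y: "(P has_real_derivative y) (at t)" and e: "e > 0" and d: "d > 0"
  shows "\<forall>\<^sub>F n in sequentially.
    exp (real n * (P t - t * y - \<bar>t\<bar> * e - d)) \<le> prob {\<omega>\<in>space M. \<bar>X n \<omega> - y\<bar> < e}"
proof -
  have d2: "d / 2 > 0" using d by simp
  have "filterlim (\<lambda>n. exp (real n * (d / 2))) at_top sequentially"
    by (rule filterlim_compose[OF exp_at_top], rule filterlim_at_top_mult_tendsto_pos[OF tendsto_const d2])
       (rule filterlim_real_sequentially)
  then have "\<forall>\<^sub>F n in sequentially. 2 \<le> exp (real n * (d / 2))"
    by (simp add: filterlim_at_top)
  moreover have "\<forall>\<^sub>F n in sequentially.
    expectation (\<lambda>\<omega>. exp (t * (real n * X n \<omega>)) * indicator {\<omega>\<in>space M. 1 * (X n \<omega> - y) \<ge> e} \<omega>) \<le> Z n t / 4"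
    by (rule tilted_tail[OF y e]) simp
  moreover have "\<forall>\<^sub>F n in sequentially.
    expectation (\<lambda>\<omega>. exp (t * (real n * X n \<omega>)) * indicator {\<omega>\<in>space M. (-1) * (X n \<omega> - y) \<ge> e} \<omega>) \<le> Z n t / 4"
    by (rule tilted_tail[OF y e]) simp
  ultimately show ?thesis using Z_ge[OF d2, of t]
  proof eventually_elim
    case (elim n)
    define w where "w \<omega> = exp (t * (real n * X n \<omega>))" for \<omega>
    define A where "A = {\<omega>\<in>space M. \<bar>X n \<omega> - y\<bar> < e}"
    define B where "B = {\<omega>\<in>space M. 1 * (X n \<omega> - y) \<ge> e}"
    define C where "C = {\<omega>\<in>space M. (-1) * (X n \<omega> - y) \<ge> e}"
    have [measurable]: "A \<in> events" "B \<in> events" "C \<in> events"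
      by (auto simp: A_def B_def C_def)
    have iw: "integrable M w" unfolding w_def by simp
    have int: "integrable M (\<lambda>\<omega>. w \<omega> * indicator D \<omega>)" if "D \<in> events" for D
      using that iw by (rule integrable_real_mult_indicator)
    have "Z n t = expectation w" by (simp add: Z_def w_def[abs_def])
    also have "\<dots> \<le> expectation (\<lambda>\<omega>. w \<omega> * indicator A \<omega> + w \<omega> * indicator B \<omega> + w \<omega> * indicator C \<omega>)"
    proof (rule integral_mono)
      fix \<omega> assume "\<omega> \<in> space M"
      then show "w \<omega> \<le> w \<omega> * indicator A \<omega> + w \<omega> * indicator B \<omega> + w \<omega> * indicator C \<omega>"
        by (auto simp: A_def B_def C_def indicator_def w_def abs_less_iff)
    qed (auto intro!: iw int Bochner_Integration.integrable_add)
    also have "\<dots> = expectation (\<lambda>\<omega>. w \<omega> * indicator A \<omega>) + expectation (\<lambda>\<omega>. w \<omega> * indicator B \<omega>)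
        + expectation (\<lambda>\<omega>. w \<omega> * indicator C \<omega>)"
      by (simp add: int)
    also have "\<dots> \<le> expectation (\<lambda>\<omega>. w \<omega> * indicator A \<omega>) + Z n t / 4 + Z n t / 4"
      using elim(2,3) unfolding w_def B_def C_def by (intro add_mono) auto
    finally have 1: "Z n t / 2 \<le> expectation (\<lambda>\<omega>. w \<omega> * indicator A \<omega>)" by simp
    have "expectation (\<lambda>\<omega>. w \<omega> * indicator A \<omega>)
        \<le> expectation (\<lambda>\<omega>. exp (real n * (t * y + \<bar>t\<bar> * e)) * indicator A \<omega>)"
    proof (rule integral_mono)
      fix \<omega> assume "\<omega> \<in> space M"
      have "t * X n \<omega> \<le> t * y + \<bar>t\<bar> * e" if "\<omega> \<in> A"
      proof -
        have "t * X n \<omega> - t * y \<le> \<bar>t * (X n \<omega> - y)\<bar>" by (simp add: right_diff_distrib)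
        also have "\<dots> \<le> \<bar>t\<bar> * e"
          using that by (simp add: abs_mult A_def mult_left_mono)
        finally show ?thesis by simp
      qed
      from mult_left_mono[OF this, of "real n"]
      show "w \<omega> * indicator A \<omega> \<le> exp (real n * (t * y + \<bar>t\<bar> * e)) * indicator A \<omega>"
        by (auto simp: w_def indicator_def mult.left_commute)
    qed (auto intro!: int integrable_const_bound[of _ 1])
    also have "\<dots> = exp (real n * (t * y + \<bar>t\<bar> * e)) * prob A" by simp
    finally have "exp (real n * (P t - d / 2)) / 2 \<le> exp (real n * (t * y + \<bar>t\<bar> * e)) * prob A"
      using 1 elim(4) by linarith
    moreover have "exp (real n * (P t - d)) \<le> exp (real n * (P t - d / 2)) / 2"
    proof -
      have "exp (real n * (P t - d)) * 2 \<le> exp (real n * (P t - d)) * exp (real n * (d / 2))"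
        using elim(1) by (intro mult_left_mono) auto
      also have "\<dots> = exp (real n * (P t - d / 2))"
        by (simp add: exp_add[symmetric] algebra_simps)
      finally show ?thesis by simp
    qed
    ultimately have "exp (real n * (P t - d)) \<le> exp (real n * (t * y + \<bar>t\<bar> * e)) * prob A"
      by linarith
    then have "exp (real n * (P t - d)) / exp (real n * (t * y + \<bar>t\<bar> * e)) \<le> prob A"
      by (simp add: field_simps)
    then show ?case
      by (simp add: exp_diff[symmetric] algebra_simps A_def)
  qed
qed

text \<open>It is enough to test real upper bounds \<open>c\<close> of the rate at \<open>x\<close>,
  which covers an infinite rate as well. Since \<open>G\<close> is open it contains a neighbourhood
  of a slope \<open>y\<close> close to \<open>x\<close>, and
  \<open>Legendre_approx_by_slopes\<close> keeps the cost at \<open>y\<close> below the same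
  \<open>c\<close>.\<close>

lemma lower_bound:
  assumes "open G" and diff: "\<And>t. P differentiable (at t)"
  shows "- (INF x\<in>G. SUP t. ereal (t * x - P t))
    \<le> liminf (\<lambda>n. ereal (1 / real n) * ext_ln (measure (distr M borel (X n)) G))" (is "- ?I \<le> ?L")
proof -
  have "- ?L \<le> (SUP t. ereal (t * x - P t))" if x: "x \<in> G" for x
  proof (rule ereal_le_real)
    fix c assume "(SUP t. ereal (t * x - P t)) \<le> ereal c"
    then have c: "t * x - P t \<le> c" for t by (simp add: SUP_le_iff)
    have "ereal (- c - d) \<le> ?L" if d: "d > 0" for d
    proof -
      obtain r where r: "r > 0" "ball x r \<subseteq> G"
        using \<open>open G\<close> x by (meson openE)
      obtain t y where ty: "(P has_real_derivative y) (at t)" "\<bar>y - x\<bar> < r / 2" "t * y - P t \<le> c"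
        using Legendre_approx_by_slopes[OF diff P_0 c half_gt_zero[OF r(1)]] by metis
      \<comment> \<open>The first entry keeps the interval around \<open>y\<close> inside the ball
        in \<open>G\<close>, the second makes \<open>\<bar>t\<bar> * e\<close> at most
        \<open>d / 2\<close>. The summand 1 guards against t = 0.\<close>
      define e where "e = min (r / 2) (d / (2 * (\<bar>t\<bar> + 1)))"
      have e: "e > 0" using r d by (auto simp: e_def)
      have te: "\<bar>t\<bar> * e \<le> d / 2"
      proof -
        have "\<bar>t\<bar> * e \<le> (\<bar>t\<bar> + 1) * (d / (2 * (\<bar>t\<bar> + 1)))"
          using e by (intro mult_mono) (auto simp: e_def)
        also have "\<dots> = d / 2" by (simp add: field_simps)
        finally show ?thesis .
      qed
      have "d / 2 > 0" using d by simp
      from prob_near_slope[OF ty(1) e this]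
      have "\<forall>\<^sub>F n in sequentially.
          ereal (- c - d) \<le> ereal (1 / real n) * ext_ln (measure (distr M borel (X n)) G)"
        using eventually_gt_at_top[of 0]
      proof eventually_elim
        case (elim n)
        have [measurable]: "G \<in> sets borel" using \<open>open G\<close> by simp
        have "exp (real n * (- c - d)) \<le> exp (real n * (P t - t * y - \<bar>t\<bar> * e - d / 2))"
          using ty(3) te by (simp add: mult_left_mono)
        also have "\<dots> \<le> prob {\<omega>\<in>space M. \<bar>X n \<omega> - y\<bar> < e}" by (rule elim)
        also have "\<dots> \<le> prob {\<omega>\<in>space M. X n \<omega> \<in> G}"
        proof (rule finite_measure_mono)
          show "{\<omega>\<in>space M. \<bar>X n \<omega> - y\<bar> < e} \<subseteq> {\<omega>\<in>space M. X n \<omega> \<in> G}"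
          proof safe
            fix \<omega> assume "\<bar>X n \<omega> - y\<bar> < e"
            moreover have "e \<le> r / 2" unfolding e_def by linarith
            ultimately have "\<bar>x - X n \<omega>\<bar> < r" using ty(2) by linarith
            then have "X n \<omega> \<in> ball x r" by (simp add: dist_real_def)
            then show "X n \<omega> \<in> G" using r by blast
          qed
        qed simp
        also have "\<dots> = measure (distr M borel (X n)) G"
          by (simp add: measure_distr vimage_def Int_def conj_commute)
        finally show ?case using elim by (subst ext_ln_scaled_ge_iff) auto
      qed
      then show ?thesis by (rule Liminf_bounded)
    qed
    then have "- ?L \<le> ereal c + ereal d" if "d > 0" for d
      using that by (simp add: ereal_uminus_le_reorder)
    then show "- ?L \<le> ereal c"
      by (rule ereal_le_epsilon2)
  qed
  then have "- ?L \<le> (INF x\<in>G. SUP t. ereal (t * x - P t))" by (rule INF_greatest)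
  then show ?thesis using ereal_minus_le_minus[of ?I "- ?L"] by simp
qed

theorem gaertner_ellis:
  assumes "\<And>t. P differentiable (at t)"
  shows "large_deviation_principle (\<lambda>n. distr M borel (X n)) real (\<lambda>x. SUP t. ereal (t * x - P t))"
  unfolding large_deviation_principle_def
  using rate_function_Legendre[of P, OF P_0] upper_bound lower_bound assms by blast

end

section \<open>Lengths of layers\<close>

text \<open>Since the powers increase, the least exponent that overshoots \<open>N\<close> is the
  number of indices up to \<open>N\<close> on layer \<open>r\<close>. For \<open>r = 0\<close> no
  exponent overshoots, hence the positivity assumptions below.\<close>

definition layer_length :: "nat \<Rightarrow> nat \<Rightarrow> nat" where
  "layer_length N r = (LEAST k. N < r * 2 ^ k)"

lemma less_layer_length_iff:
  assumes "r > 0"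
  shows "k < layer_length N r \<longleftrightarrow> r * 2 ^ k \<le> N"
proof
  assume "k < layer_length N r"
  then show "r * 2 ^ k \<le> N"
    unfolding layer_length_def using not_less_Least not_le by blast
next
  assume le: "r * 2 ^ k \<le> N"
  have "N < 2 ^ N" by (rule less_exp)
  also have "\<dots> \<le> r * 2 ^ N" using assms by simp
  finally have *: "N < r * 2 ^ layer_length N r"
    unfolding layer_length_def by (rule LeastI)
  show "k < layer_length N r"
  proof (rule ccontr)
    assume "\<not> k < layer_length N r"
    then have "r * 2 ^ layer_length N r \<le> r * 2 ^ k" by (intro mult_left_mono power_increasing) auto
    with le * show False by simp
  qed
qed

lemma layer_length_le: "r > 0 \<Longrightarrow> layer_length N r \<le> N"
  unfolding layer_length_def
proof (rule Least_le)
  assume "r > 0"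
  have "N < 2 ^ N" by (rule less_exp)
  also have "\<dots> \<le> r * 2 ^ N" using \<open>r > 0\<close> by simp
  finally show "N < r * 2 ^ N" .
qed

lemma odd_times_power_of_2_inj:
  fixes r s :: nat
  assumes "odd r" "odd s" "r * 2 ^ k = s * 2 ^ l"
  shows "r = s \<and> k = l"
proof -
  have *: "m = n" if a: "odd a" and eq: "a * 2 ^ m = b * 2 ^ n" and le: "m \<le> n" for a b m n :: nat
  proof (rule ccontr)
    assume "m \<noteq> n"
    then obtain d where d: "n = m + Suc d" using le less_iff_Suc_add[of m n] by auto
    then have "a * 2 ^ m = (b * 2 ^ Suc d) * 2 ^ m" using eq by (simp only: power_add ac_simps)
    then have "a = b * 2 ^ Suc d" by simp
    then show False using a by simp
  qed
  have "k = l" using *[of r k s l] *[of s l r k] assms by (metis nat_le_linear)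
  then show ?thesis using assms by simp
qed

lemma odd_times_power_of_2_exists:
  fixes n :: nat
  assumes "n > 0"
  obtains r k where "odd r" "n = r * 2 ^ k"
proof -
  have "\<exists>r k. odd r \<and> n = r * 2 ^ k"
    using assms
  proof (induction n rule: less_induct)
    case (less n)
    show ?case
    proof (cases "odd n")
      case False
      then obtain m where m: "n = 2 * m" by blast
      then obtain r k where "odd r" "m = r * 2 ^ k" using less.IH[of m] less.prems by auto
      then have "odd r \<and> n = r * 2 ^ Suc k" using m by simp
      then show ?thesis by blast
    qed (metis mult.right_neutral power_0)
  qed
  then show thesis using that by blast
qed

lemma sum_layers:
  fixes F :: "nat \<Rightarrow> 'a::comm_monoid_add"
  shows "(\<Sum>i=1..N. F i) = (\<Sum>r | odd r \<and> r \<le> N. \<Sum>k<layer_length N r. F (r * 2 ^ k))"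
proof -
  have "bij_betw (\<lambda>(r, k). r * 2 ^ k) (SIGMA r:{r. odd r \<and> r \<le> N}. {..<layer_length N r}) {1..N}"
    unfolding bij_betw_def
  proof
    show "inj_on (\<lambda>(r, k). r * 2 ^ k) (SIGMA r:{r. odd r \<and> r \<le> N}. {..<layer_length N r})"
      by (auto intro!: inj_onI dest: odd_times_power_of_2_inj)
    show "(\<lambda>(r, k). r * 2 ^ k) ` (SIGMA r:{r. odd r \<and> r \<le> N}. {..<layer_length N r}) = {1..N}"
    proof (intro equalityI subsetI)
      fix i assume "i \<in> (\<lambda>(r, k). r * 2 ^ k) ` (SIGMA r:{r. odd r \<and> r \<le> N}. {..<layer_length N r})"
      then obtain r k where "i = r * 2 ^ k" "odd r" "k < layer_length N r" by auto
      then show "i \<in> {1..N}" using less_layer_length_iff[of r k N] odd_pos[of r] by simp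
    next
      fix i assume i: "i \<in> {1..N}"
      then obtain r k where rk: "odd r" "i = r * 2 ^ k" using odd_times_power_of_2_exists[of i] by auto
      then have "k < layer_length N r" using i less_layer_length_iff[of r k N] odd_pos[of r] by simp
      moreover have "r \<le> r * 2 ^ k" by simp
      then have "r \<le> N" using rk i by (metis atLeastAtMost_iff order_trans)
      ultimately show "i \<in> (\<lambda>(r, k). r * 2 ^ k) ` (SIGMA r:{r. odd r \<and> r \<le> N}. {..<layer_length N r})"
        using rk i by (intro image_eqI[of _ _ "(r, k)"]) auto
    qed
  qed
  from sum.reindex_bij_betw[OF this, of F] show ?thesis
    by (simp add: sum.Sigma split_def)
qed

lemma card_odd_atMost: "card {r::nat. odd r \<and> r \<le> n} = (n + 1) div 2"
proof (induction n)
  case 0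
  have "{r::nat. odd r \<and> r \<le> 0} = {}" by (auto dest: odd_pos)
  then show ?case by simp
next
  case (Suc n)
  have fin: "finite {r::nat. odd r \<and> r \<le> n}" by simp
  have "{r. odd r \<and> r \<le> Suc n} =
      (if even n then insert (Suc n) {r. odd r \<and> r \<le> n} else {r. odd r \<and> r \<le> n})"
    by (auto simp: le_Suc_eq)
  then have "card {r. odd r \<and> r \<le> Suc n} = (n + 1) div 2 + (if even n then 1 else 0)"
    using Suc.IH fin by (simp add: card_insert_if)
  also have "\<dots> = (Suc n + 1) div 2" by (cases "even n") (simp, presburger)+
  finally show ?case .
qed

text \<open>The odd r of layer length above j are exactly the odd r up to
  \<open>N div 2 ^ j\<close>; the sets for j = k and j = \<open>Suc k\<close> are nested and are
  subtracted. Real numbers avoid truncated subtraction.\<close>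

lemma card_layer_length:
  "real (card {r. odd r \<and> r \<le> N \<and> layer_length N r = Suc k}) =
     real ((N div 2 ^ k + 1) div 2) - real ((N div 2 ^ Suc k + 1) div 2)"
proof -
  define D where "D j = {r. odd r \<and> r \<le> N div 2 ^ j}" for j
  have D: "r \<in> D j \<longleftrightarrow> odd r \<and> j < layer_length N r" for r j
    using less_layer_length_iff[of r j N] odd_pos[of r]
    by (auto simp: D_def less_eq_div_iff_mult_less_eq)
  have "r \<le> N" if "odd r" "0 < layer_length N r" for r
    using that less_layer_length_iff[of r 0 N] odd_pos[of r] by simp
  then have eq: "{r. odd r \<and> r \<le> N \<and> layer_length N r = Suc k} = D k - D (Suc k)"
    by (auto simp: D)
  have "D (Suc k) \<subseteq> D k" by (auto simp: D)
  moreover have fin: "finite (D j)" for j by (simp add: D_def)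
  ultimately have "real (card (D k - D (Suc k))) = real (card (D k)) - real (card (D (Suc k)))"
    by (simp add: card_Diff_subset card_mono of_nat_diff)
  then show ?thesis by (simp only: eq D_def card_odd_atMost)
qed

text \<open>Despite the two roundings, each count in \<open>card_layer_length\<close> differs from
  N/2^(j+1) by at most 1. The densities 1/2^(k+1) and 1/2^(k+2) then differ by the limit.\<close>

lemma tendsto_card_layer_length:
  "(\<lambda>N. real (card {r. odd r \<and> r \<le> N \<and> layer_length N r = Suc k}) / real N)
     \<longlonglongrightarrow> 1 / 2 ^ (k + 2)"
proof -
  have *: "(\<lambda>N. real ((N div 2 ^ j + 1) div 2) / real N) \<longlonglongrightarrow> 1 / 2 ^ (j + 1)" for j
  proof -
    have b: "norm (real ((N div 2 ^ j + 1) div 2) / real N - 1 / 2 ^ (j + 1)) \<le> 1 / real N"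
      if "N > 0" for N
    proof -
      define x where "x = N div 2 ^ j"
      have x: "real x \<le> real N / 2 ^ j" "real N / 2 ^ j < real x + 1"
      proof -
        show "real x \<le> real N / 2 ^ j"
          unfolding x_def by (metis of_nat_div_le_of_nat of_nat_numeral of_nat_power)
        have "N < (x + 1) * 2 ^ j"
          by (simp add: x_def dividend_less_div_times)
        then have "real N < real ((x + 1) * 2 ^ j)" by (simp only: of_nat_less_iff)
        then have "real N < (real x + 1) * 2 ^ j" by (simp add: algebra_simps)
        then show "real N / 2 ^ j < real x + 1"
          by (simp add: field_simps)
      qed
      have y: "real x / 2 \<le> real ((x + 1) div 2)" "real ((x + 1) div 2) \<le> (real x + 1) / 2"
      proof -
        have *: "real a / 2 \<le> real b \<and> real b \<le> (real a + 1) / 2" if "a \<le> 2 * b" "2 * b \<le> a + 1" for a b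
        proof -
          have "real a \<le> real (2 * b)" "real (2 * b) \<le> real (a + 1)"
            using that by (simp_all only: of_nat_le_iff)
          then show ?thesis by simp
        qed
        have "x \<le> 2 * ((x + 1) div 2)" "2 * ((x + 1) div 2) \<le> x + 1" by presburger+
        from *[OF this] show "real x / 2 \<le> real ((x + 1) div 2)" "real ((x + 1) div 2) \<le> (real x + 1) / 2"
          by blast+
      qed
      have "\<bar>real ((x + 1) div 2) - (real N / 2 ^ j) / 2\<bar> \<le> 1"
      proof -
        have "\<bar>q - m / 2\<bar> \<le> 1" if "p \<le> m" "m < p + 1" "p / 2 \<le> q" "q \<le> (p + 1) / 2" for p q m :: real
          using that unfolding abs_le_iff by (simp add: field_simps)
        from this[OF x y] show ?thesis .
      qed
      moreover have "real ((x + 1) div 2) / real N - 1 / 2 ^ (j + 1) =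
          (real ((x + 1) div 2) - (real N / 2 ^ j) / 2) / real N"
        using that by (simp add: field_simps)
      ultimately show ?thesis
        using that by (simp add: x_def divide_right_mono)
    qed
    have "(\<lambda>N. real ((N div 2 ^ j + 1) div 2) / real N - 1 / 2 ^ (j + 1)) \<longlonglongrightarrow> 0"
      by (rule Lim_null_comparison[OF eventually_mono[OF eventually_gt_at_top[of 0] b] lim_1_over_n])
    then show ?thesis by (simp add: LIM_zero_iff)
  qed
  have "(\<lambda>N. real ((N div 2 ^ k + 1) div 2) / real N - real ((N div 2 ^ Suc k + 1) div 2) / real N)
      \<longlonglongrightarrow> 1 / 2 ^ (k + 1) - 1 / 2 ^ (Suc k + 1)"
    by (intro tendsto_diff *)
  then show ?thesis
    by (simp add: card_layer_length diff_divide_distrib)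
qed

text \<open>Cruder than the limiting density but uniform in \<open>N\<close>: this is the dominating
  sequence when the limit is taken inside the series.\<close>

lemma card_layer_length_le:
  "real (card {r. odd r \<and> r \<le> N \<and> layer_length N r = Suc k}) / real N \<le> 1 / 2 ^ k"
proof (cases "N = 0")
  case False
  have "real (card {r. odd r \<and> r \<le> N \<and> layer_length N r = Suc k}) \<le> real ((N div 2 ^ k + 1) div 2)"
    by (simp add: card_layer_length)
  also have "\<dots> \<le> real (N div 2 ^ k)" by simp
  also have "\<dots> \<le> real N / 2 ^ k"
    by (metis of_nat_div_le_of_nat of_nat_numeral of_nat_power)
  finally show ?thesis using False by (simp add: field_simps)
qed simp

text \<open>Grouping the layers by length turns the average into a series over lengths weighted by
  frequencies; Tannery's theorem, dominated convergence for series, passes to the limit. Layers with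
  \<open>r \<le> N\<close> have length at least 1, so \<open>c\<close> is evaluated at successors
  only.\<close>

lemma layer_average_tendsto:
  fixes c b :: "nat \<Rightarrow> real"
  assumes b: "\<And>k. \<bar>c (Suc k)\<bar> \<le> b k" and sb: "summable (\<lambda>k. b k / 2 ^ k)"
  shows "(\<lambda>N. (\<Sum>r | odd r \<and> r \<le> N. c (layer_length N r)) / real N)
    \<longlonglongrightarrow> (\<Sum>k. c (Suc k) / 2 ^ (k + 2))"
proof -
  define w where "w N k = real (card {r. odd r \<and> r \<le> N \<and> layer_length N r = Suc k}) / real N" for N k
  have eq: "(\<Sum>r | odd r \<and> r \<le> N. c (layer_length N r)) / real N = (\<Sum>k. c (Suc k) * w N k)" for N
  proof -
    have *: "layer_length N r \<in> Suc ` {..<N}" if "odd r" "r \<le> N" for r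
    proof -
      have "0 < layer_length N r" "layer_length N r \<le> N"
        using that less_layer_length_iff[of r 0 N] layer_length_le[of r N] odd_pos[of r] by auto
      then show ?thesis by (intro image_eqI[of _ _ "layer_length N r - 1"]) auto
    qed
    have "(\<Sum>r | odd r \<and> r \<le> N. c (layer_length N r)) =
        (\<Sum>n\<in>Suc ` {..<N}. \<Sum>r | r \<in> {r. odd r \<and> r \<le> N} \<and> layer_length N r = n. c (layer_length N r))"
      using * by (intro sum.group[symmetric]) auto
    also have "\<dots> = (\<Sum>k<N. \<Sum>r | r \<in> {r. odd r \<and> r \<le> N} \<and> layer_length N r = Suc k. c (layer_length N r))"
      by (simp add: sum.reindex)
    also have "\<dots> = (\<Sum>k<N. c (Suc k) * real (card {r. odd r \<and> r \<le> N \<and> layer_length N r = Suc k}))"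
      by (intro sum.cong refl) (simp add: conj_assoc mult.commute)
    finally have "(\<Sum>r | odd r \<and> r \<le> N. c (layer_length N r)) / real N = (\<Sum>k<N. c (Suc k) * w N k)"
      by (simp add: w_def sum_divide_distrib)
    \<comment> \<open>No layer is longer than \<open>N\<close>, so the remaining frequencies
      vanish.\<close>
    also have "\<dots> = (\<Sum>k. c (Suc k) * w N k)"
    proof (rule suminf_finite[symmetric])
      fix k assume "k \<notin> {..<N}"
      then have "{r. odd r \<and> r \<le> N \<and> layer_length N r = Suc k} = {}" using * by force
      then show "c (Suc k) * w N k = 0" by (simp add: w_def)
    qed simp
    finally show ?thesis .
  qed
  have "(\<lambda>N. \<Sum>k. c (Suc k) * w N k) \<longlonglongrightarrow> (\<Sum>k. c (Suc k) * (1 / 2 ^ (k + 2)))"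
  proof (rule tannerys_theorem[THEN conjunct2, THEN conjunct2])
    show "(\<lambda>N. c (Suc k) * w N k) \<longlonglongrightarrow> c (Suc k) * (1 / 2 ^ (k + 2))" for k
      unfolding w_def by (intro tendsto_mult tendsto_const tendsto_card_layer_length)
    have "norm (c (Suc k) * w N k) \<le> b k / 2 ^ k" for k N
    proof -
      have "norm (c (Suc k) * w N k) = \<bar>c (Suc k)\<bar> * w N k" by (simp add: abs_mult w_def)
      also have "\<dots> \<le> b k * (1 / 2 ^ k)"
        using b[of k] card_layer_length_le[of N k] by (intro mult_mono) (auto simp: w_def)
      finally show ?thesis by simp
    qed
    then show "\<forall>\<^sub>F (k, N) in sequentially \<times>\<^sub>F sequentially. norm (c (Suc k) * w N k) \<le> b k / 2 ^ k"
      by (intro always_eventually) auto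
  qed (use sb in auto)
  then show ?thesis by (simp add: eq)
qed

text \<open>The ratio of consecutive powers tends to 1, so it is eventually below 3/2, and halving
  leaves a ratio of at most 3/4.\<close>

lemma summable_power_over_power_of_2: "summable (\<lambda>k. C * real (Suc k) ^ p / 2 ^ k)"
proof -
  have "(\<lambda>k. (1 + inverse (real (Suc k))) ^ p) \<longlonglongrightarrow> (1 + 0) ^ p"
    by (intro tendsto_power tendsto_add tendsto_const LIMSEQ_inverse_real_of_nat)
  then have "\<forall>\<^sub>F k in sequentially. (1 + inverse (real (Suc k))) ^ p < 3 / 2"
    by (rule order_tendstoD) simp
  then obtain N where N: "\<And>k. k \<ge> N \<Longrightarrow> (1 + inverse (real (Suc k))) ^ p < 3 / 2"
    by (auto simp: eventually_sequentially)
  have "summable (\<lambda>k. real (Suc k) ^ p / 2 ^ k)"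
  proof (rule summable_ratio_test[of "3 / 4" N])
    fix k assume "N \<le> k"
    have "real (Suc (Suc k)) = (1 + inverse (real (Suc k))) * real (Suc k)"
      by (simp add: field_simps)
    then have "real (Suc (Suc k)) ^ p = (1 + inverse (real (Suc k))) ^ p * real (Suc k) ^ p"
      by (simp only: power_mult_distrib)
    also have "\<dots> \<le> 3 / 2 * real (Suc k) ^ p"
      using N[OF \<open>N \<le> k\<close>] by (intro mult_right_mono) auto
    finally have "real (Suc (Suc k)) ^ p / 2 ^ Suc k \<le> (3 / 2 * real (Suc k) ^ p) / 2 ^ Suc k"
      by (rule divide_right_mono) simp
    then show "norm (real (Suc (Suc k)) ^ p / 2 ^ Suc k) \<le> 3 / 4 * norm (real (Suc k) ^ p / 2 ^ k)"
      by (simp add: norm_divide norm_power)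
  qed simp
  from summable_mult[OF this, of C] show ?thesis by simp
qed

section \<open>Cumulant generating functions of bounded variables\<close>

lemma abs_exp_minus_one_le: "\<bar>exp x - 1\<bar> \<le> \<bar>x\<bar> * exp \<bar>x\<bar>" for x :: real
proof (cases "x \<ge> 0")
  case True
  have "(1 - x) * exp x \<le> exp (- x) * exp x"
    using exp_ge_add_one_self[of "- x"] by (intro mult_right_mono) auto
  then have "exp x - 1 \<le> x * exp x" by (simp add: exp_minus algebra_simps)
  then show ?thesis using True by simp
next
  case False
  have "1 - exp x \<le> \<bar>x\<bar> * 1" using False exp_ge_add_one_self[of x] by linarith
  also have "\<dots> \<le> \<bar>x\<bar> * exp \<bar>x\<bar>" by (intro mult_left_mono) auto
  finally show ?thesis using False by simp
qed

lemma exp_minus_linear_bounds: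
  fixes x :: real
  shows "0 \<le> exp x - 1 - x" and "exp x - 1 - x \<le> x * (exp x - 1)"
proof -
  show "0 \<le> exp x - 1 - x" using exp_ge_add_one_self[of x] by linarith
  have "(1 - x) * exp x \<le> exp (- x) * exp x"
    using exp_ge_add_one_self[of "- x"] by (intro mult_right_mono) auto
  then show "exp x - 1 - x \<le> x * (exp x - 1)" by (simp add: exp_minus algebra_simps)
qed

lemma abs_exp_minus_linear_le: "\<bar>exp x - 1 - x\<bar> \<le> x\<^sup>2 * exp \<bar>x\<bar>" for x :: real
proof -
  have "\<bar>exp x - 1 - x\<bar> \<le> x * (exp x - 1)" using exp_minus_linear_bounds[of x] by simp
  also have "\<dots> \<le> \<bar>x\<bar> * \<bar>exp x - 1\<bar>" by (metis abs_ge_self abs_mult)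
  also have "\<dots> \<le> \<bar>x\<bar> * (\<bar>x\<bar> * exp \<bar>x\<bar>)" by (intro mult_left_mono abs_exp_minus_one_le) auto
  finally show ?thesis by (simp add: power2_eq_square)
qed

locale bounded_variable = prob_space +
  fixes S :: "'a \<Rightarrow> real" and K :: real
  assumes rv [measurable]: "random_variable borel S"
    and bounded: "\<And>\<omega>. \<omega> \<in> space M \<Longrightarrow> \<bar>S \<omega>\<bar> \<le> K"
begin

lemma K_nonneg: "K \<ge> 0"
  using not_empty bounded by fastforce

lemma exp_bounded: "\<omega> \<in> space M \<Longrightarrow> exp (t * S \<omega>) \<le> exp (\<bar>t\<bar> * K)"
proof -
  assume w: "\<omega> \<in> space M"
  have "t * S \<omega> \<le> \<bar>t * S \<omega>\<bar>" by simp
  also have "\<dots> \<le> \<bar>t\<bar> * K"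
    using bounded[OF w] by (simp add: abs_mult mult_left_mono)
  finally show ?thesis by simp
qed

lemma integrable_times_exp:
  assumes [measurable]: "random_variable borel g" and "\<And>\<omega>. \<omega> \<in> space M \<Longrightarrow> \<bar>g \<omega>\<bar> \<le> L"
  shows "integrable M (\<lambda>\<omega>. g \<omega> * exp (t * S \<omega>))"
proof (rule integrable_const_bound[where B = "L * exp (\<bar>t\<bar> * K)"])
  show "AE \<omega> in M. norm (g \<omega> * exp (t * S \<omega>)) \<le> L * exp (\<bar>t\<bar> * K)"
  proof (rule AE_I2)
    fix \<omega> assume w: "\<omega> \<in> space M"
    then have "L \<ge> 0" using assms(2)[OF w] by linarith
    then show "norm (g \<omega> * exp (t * S \<omega>)) \<le> L * exp (\<bar>t\<bar> * K)"
      using assms(2)[OF w] exp_bounded[OF w, of t]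
      unfolding real_norm_def abs_mult by (intro mult_mono) auto
  qed
qed simp

text \<open>Differentiation under the integral through an explicit quadratic remainder for
  increments of size at most 1. The bounded factor \<open>g\<close> makes the lemma iterable:
  \<open>g = 1\<close> gives the first derivative of the moment generating function,
  \<open>g = S\<close> the second.\<close>

lemma DERIV_expectation_times_exp:
  assumes [measurable]: "random_variable borel g" and g: "\<And>\<omega>. \<omega> \<in> space M \<Longrightarrow> \<bar>g \<omega>\<bar> \<le> L"
  shows "((\<lambda>t. expectation (\<lambda>\<omega>. g \<omega> * exp (t * S \<omega>))) has_real_derivative
    expectation (\<lambda>\<omega>. (g \<omega> * S \<omega>) * exp (t * S \<omega>))) (at t)"
proof -
  define F where "F t = expectation (\<lambda>\<omega>. g \<omega> * exp (t * S \<omega>))" for t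
  define F' where "F' = expectation (\<lambda>\<omega>. (g \<omega> * S \<omega>) * exp (t * S \<omega>))"
  \<comment> \<open>A bound for \<open>g \<omega> * exp (t * S \<omega>)\<close> times the bound
    \<open>K\<^sup>2 * exp K\<close> for the Taylor remainder divided by
    \<open>h\<^sup>2\<close>.\<close>
  define C where "C = L * exp (\<bar>t\<bar> * K) * (K\<^sup>2 * exp K)"
  obtain \<omega>0 where "\<omega>0 \<in> space M" using not_empty by blast
  then have L: "L \<ge> 0" using g[of \<omega>0] by linarith
  have gS: "\<bar>g \<omega> * S \<omega>\<bar> \<le> L * K" if "\<omega> \<in> space M" for \<omega>
    using g[OF that] bounded[OF that] L by (auto simp: abs_mult intro!: mult_mono)
  have int: "integrable M (\<lambda>\<omega>. g \<omega> * exp (s * S \<omega>))" for s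
    by (rule integrable_times_exp[OF _ g]) auto
  have int': "integrable M (\<lambda>\<omega>. (g \<omega> * S \<omega>) * exp (s * S \<omega>))" for s
    by (rule integrable_times_exp[OF _ gS]) auto
  have key: "\<bar>F (t + h) - F t - h * F'\<bar> \<le> C * h\<^sup>2" if h: "\<bar>h\<bar> \<le> 1" for h
  proof -
    have "F (t + h) - F t - h * F' =
        expectation (\<lambda>\<omega>. g \<omega> * exp ((t + h) * S \<omega>) - g \<omega> * exp (t * S \<omega>)
          - h * ((g \<omega> * S \<omega>) * exp (t * S \<omega>)))"
      unfolding F_def F'_def by (simp add: int int')
    also have "\<dots> = expectation (\<lambda>\<omega>. g \<omega> * exp (t * S \<omega>) * (exp (h * S \<omega>) - 1 - h * S \<omega>))"
      by (intro Bochner_Integration.integral_cong refl) (simp add: exp_add algebra_simps)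
    also have "\<bar>\<dots>\<bar> \<le> expectation (\<lambda>\<omega>. \<bar>g \<omega> * exp (t * S \<omega>) * (exp (h * S \<omega>) - 1 - h * S \<omega>)\<bar>)"
      by (rule integral_abs_bound)
    also have "\<dots> \<le> expectation (\<lambda>\<omega>. C * h\<^sup>2)"
    proof (rule integral_mono')
      fix \<omega> assume w: "\<omega> \<in> space M"
      have hS: "\<bar>h * S \<omega>\<bar> \<le> \<bar>h\<bar> * K" "\<bar>h * S \<omega>\<bar> \<le> K"
        using h bounded[OF w] K_nonneg mult_mono[of "\<bar>h\<bar>" 1 "\<bar>S \<omega>\<bar>" K]
        by (auto simp: abs_mult intro!: mult_left_mono)
      have "\<bar>exp (h * S \<omega>) - 1 - h * S \<omega>\<bar> \<le> (h * S \<omega>)\<^sup>2 * exp \<bar>h * S \<omega>\<bar>"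
        by (rule abs_exp_minus_linear_le)
      also have "\<dots> \<le> (\<bar>h\<bar> * K)\<^sup>2 * exp K"
        using hS K_nonneg by (intro mult_mono) (auto simp: abs_le_square_iff[symmetric] abs_mult)
      finally have *: "\<bar>exp (h * S \<omega>) - 1 - h * S \<omega>\<bar> \<le> h\<^sup>2 * (K\<^sup>2 * exp K)"
        by (simp add: power_mult_distrib)
      have "\<bar>g \<omega> * exp (t * S \<omega>) * (exp (h * S \<omega>) - 1 - h * S \<omega>)\<bar>
          \<le> L * exp (\<bar>t\<bar> * K) * (h\<^sup>2 * (K\<^sup>2 * exp K))"
        unfolding abs_mult using w g exp_bounded L * by (intro mult_mono) auto
      then show "\<bar>g \<omega> * exp (t * S \<omega>) * (exp (h * S \<omega>) - 1 - h * S \<omega>)\<bar> \<le> C * h\<^sup>2"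
        by (simp add: C_def mult_ac)
    qed (use L in \<open>auto simp: C_def\<close>)
    also have "\<dots> = C * h\<^sup>2" by (simp add: prob_space)
    finally show ?thesis .
  qed
  have "((\<lambda>h. (F (t + h) - F t) / h - F') \<longlongrightarrow> 0) (at 0)"
  proof (rule Lim_null_comparison)
    show "((\<lambda>h. C * \<bar>h\<bar>) \<longlongrightarrow> 0) (at 0)"
      by (rule tendsto_eq_intros refl | simp)+
    have "norm ((F (t + h) - F t) / h - F') \<le> C * \<bar>h\<bar>" if "h \<noteq> 0" "\<bar>h\<bar> < 1" for h
    proof -
      have "(F (t + h) - F t) / h - F' = (F (t + h) - F t - h * F') / h"
        using that by (simp add: field_simps)
      then have "norm ((F (t + h) - F t) / h - F') \<le> C * h\<^sup>2 / \<bar>h\<bar>"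
        using key[of h] that by (simp add: divide_right_mono)
      also have "\<dots> = C * \<bar>h\<bar>" using that by (simp add: power2_eq_square abs_if)
      finally show ?thesis .
    qed
    then show "\<forall>\<^sub>F h in at 0. norm ((F (t + h) - F t) / h - F') \<le> C * \<bar>h\<bar>"
      unfolding eventually_at by (intro exI[of _ 1]) (auto simp: dist_real_def)
  qed
  then have "(F has_real_derivative F') (at t)"
    by (simp add: DERIV_def LIM_zero_iff)
  then show ?thesis by (simp add: F_def[abs_def] F'_def)
qed

definition mgf :: "real \<Rightarrow> real" where
  "mgf t = expectation (\<lambda>\<omega>. exp (t * S \<omega>))"

definition cgf :: "real \<Rightarrow> real" where
  "cgf t = ln (mgf t)"

definition tilted_mean :: "real \<Rightarrow> real" where
  "tilted_mean t = expectation (\<lambda>\<omega>. S \<omega> * exp (t * S \<omega>)) / mgf t"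

definition tilted_variance :: "real \<Rightarrow> real" where
  "tilted_variance t = expectation (\<lambda>\<omega>. (S \<omega>)\<^sup>2 * exp (t * S \<omega>)) / mgf t - (tilted_mean t)\<^sup>2"

lemma S2_bounded: "\<omega> \<in> space M \<Longrightarrow> \<bar>(S \<omega>)\<^sup>2\<bar> \<le> K\<^sup>2"
  using bounded[of \<omega>] by (simp add: abs_le_square_iff[symmetric])

lemma integrable_exp: "integrable M (\<lambda>\<omega>. exp (t * S \<omega>))"
  using integrable_times_exp[of "\<lambda>_. 1" 1 t] by simp

lemma mgf_ge: "mgf t \<ge> exp (- (\<bar>t\<bar> * K))"
proof -
  have "exp (- (\<bar>t\<bar> * K)) = expectation (\<lambda>\<omega>. exp (- (\<bar>t\<bar> * K)))"
    by (simp add: prob_space)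
  also have "\<dots> \<le> mgf t"
    unfolding mgf_def
  proof (rule integral_mono)
    fix \<omega> assume "\<omega> \<in> space M"
    from exp_bounded[OF this, of "-t"]
    show "exp (- (\<bar>t\<bar> * K)) \<le> exp (t * S \<omega>)" by simp
  qed (auto simp: integrable_exp)
  finally show ?thesis .
qed

lemma mgf_le: "mgf t \<le> exp (\<bar>t\<bar> * K)"
proof -
  have "mgf t \<le> expectation (\<lambda>\<omega>. exp (\<bar>t\<bar> * K))"
    unfolding mgf_def by (rule integral_mono) (use exp_bounded in \<open>auto simp: integrable_exp\<close>)
  then show ?thesis by (simp add: prob_space)
qed

lemma mgf_pos: "mgf t > 0"
  using mgf_ge[of t] by (meson exp_gt_zero less_le_trans)

lemma abs_cgf_le: "\<bar>cgf t\<bar> \<le> \<bar>t\<bar> * K"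
proof -
  have "- (\<bar>t\<bar> * K) \<le> cgf t" "cgf t \<le> \<bar>t\<bar> * K"
    using mgf_ge[of t] mgf_le[of t] mgf_pos[of t] unfolding cgf_def
    by (metis exp_le_cancel_iff exp_ln)+
  then show ?thesis by (simp add: abs_le_iff)
qed

lemma DERIV_mgf: "(mgf has_real_derivative expectation (\<lambda>\<omega>. S \<omega> * exp (t * S \<omega>))) (at t)"
  using DERIV_expectation_times_exp[of "\<lambda>_. 1" 1 t] by (simp add: mgf_def[abs_def])

lemma DERIV_cgf: "(cgf has_real_derivative tilted_mean t) (at t)"
  unfolding cgf_def[abs_def] tilted_mean_def
  using mgf_pos[of t] by (auto intro!: derivative_eq_intros DERIV_mgf simp: field_simps)

lemma DERIV_tilted_mean: "(tilted_mean has_real_derivative tilted_variance t) (at t)"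
proof -
  have "((\<lambda>t. expectation (\<lambda>\<omega>. S \<omega> * exp (t * S \<omega>))) has_real_derivative
      expectation (\<lambda>\<omega>. (S \<omega>)\<^sup>2 * exp (t * S \<omega>))) (at t)"
    using DERIV_expectation_times_exp[of S K t] bounded by (simp add: power2_eq_square)
  from DERIV_divide[OF this DERIV_mgf] show ?thesis
    using mgf_pos[of t]
    by (simp add: tilted_mean_def[abs_def] tilted_variance_def power2_eq_square field_simps)
qed

text \<open>The quotient is the mean of \<open>g\<close> under the tilted probability law, so the
  bound on \<open>g\<close> survives for every t. This uniformity in t later permits termwise
  differentiation on the whole line.\<close>

lemma abs_expectation_times_exp_le:
  assumes [measurable]: "random_variable borel g" and g: "\<And>\<omega>. \<omega> \<in> space M \<Longrightarrow> \<bar>g \<omega>\<bar> \<le> L"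
  shows "\<bar>expectation (\<lambda>\<omega>. g \<omega> * exp (t * S \<omega>)) / mgf t\<bar> \<le> L"
proof -
  have "\<bar>expectation (\<lambda>\<omega>. g \<omega> * exp (t * S \<omega>))\<bar> \<le> expectation (\<lambda>\<omega>. \<bar>g \<omega> * exp (t * S \<omega>)\<bar>)"
    by (rule integral_abs_bound)
  also have "\<dots> \<le> expectation (\<lambda>\<omega>. L * exp (t * S \<omega>))"
  proof (rule integral_mono)
    show "integrable M (\<lambda>\<omega>. \<bar>g \<omega> * exp (t * S \<omega>)\<bar>)"
      by (intro integrable_abs integrable_times_exp[OF _ g]) auto
  qed (auto simp: abs_mult g intro!: mult_right_mono integrable_exp)
  also have "\<dots> = L * mgf t" by (simp add: mgf_def)
  finally show ?thesis using mgf_pos[of t] by (simp add: field_simps)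
qed

lemma abs_tilted_mean_le: "\<bar>tilted_mean t\<bar> \<le> K"
  unfolding tilted_mean_def by (rule abs_expectation_times_exp_le) (auto simp: bounded)

lemma abs_tilted_variance_le: "\<bar>tilted_variance t\<bar> \<le> 2 * K\<^sup>2"
proof -
  have "\<bar>expectation (\<lambda>\<omega>. (S \<omega>)\<^sup>2 * exp (t * S \<omega>)) / mgf t\<bar> \<le> K\<^sup>2"
    by (rule abs_expectation_times_exp_le) (use S2_bounded in auto)
  moreover have "\<bar>(tilted_mean t)\<^sup>2\<bar> \<le> K\<^sup>2"
    using abs_tilted_mean_le[of t] by (simp add: abs_le_square_iff[symmetric])
  ultimately show ?thesis unfolding tilted_variance_def by linarith
qed

lemma integrable_S [simp]: "integrable M S" and integrable_S2 [simp]: "integrable M (\<lambda>\<omega>. (S \<omega>)\<^sup>2)"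
  using integrable_times_exp[of S K 0] integrable_times_exp[of "\<lambda>\<omega>. (S \<omega>)\<^sup>2" "K\<^sup>2" 0]
    bounded S2_bounded by auto

lemma mgf_0: "mgf 0 = 1" by (simp add: mgf_def prob_space)

lemma cgf_0: "cgf 0 = 0" by (simp add: cgf_def mgf_0)

lemma tilted_mean_0: "tilted_mean 0 = expectation S"
  by (simp add: tilted_mean_def mgf_0)

lemma tilted_variance_0: "tilted_variance 0 = variance S"
  by (simp add: tilted_variance_def mgf_0 tilted_mean_0 variance_eq)

end

section \<open>Sums over independent layers\<close>

text \<open>Writing the law as the image of a standard normal under scaling by \<open>sqrt v\<close>
  includes the Dirac mass at \<open>v = 0\<close>, so a vanishing variance is no special case of the
  central limit theorem.\<close>

lemma char_centered_normal:
  assumes "v \<ge> 0"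
  shows "char (centered_normal v) s = complex_of_real (exp (- (s\<^sup>2 * v / 2)))"
    and "real_distribution (centered_normal v)"
proof -
  interpret N: prob_space std_normal_distribution
    using real_dist_normal_dist by (simp add: real_distribution_def)
  have "centered_normal v = distr std_normal_distribution borel (\<lambda>x. sqrt v * x)"
  proof (cases "v = 0")
    case True
    have "distr std_normal_distribution borel (\<lambda>x. 0::real) = return borel 0"
      by (rule N.distr_const) simp
    with True show ?thesis by (simp add: centered_normal_def)
  next
    case False
    then have pos: "sqrt v > 0" using assms by simp
    have "distributed std_normal_distribution lborel (\<lambda>x. (sqrt v * x - 0) / sqrt v) std_normal_density"
      using pos by (auto simp: distributed_def intro!: distr_id2)
    then have "distributed std_normal_distribution lborel (\<lambda>x. sqrt v * x) (normal_density 0 (sqrt v))"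
      using N.normal_standard_normal_convert[OF pos, of "\<lambda>x. sqrt v * x" 0] by simp
    then have "distr std_normal_distribution lborel (\<lambda>x. sqrt v * x) = density lborel (normal_density 0 (sqrt v))"
      by (rule distributed_distr_eq_density)
    moreover have "distr std_normal_distribution lborel (\<lambda>x. sqrt v * x) =
        distr std_normal_distribution borel (\<lambda>x. sqrt v * x)"
      by (rule distr_cong) auto
    ultimately show ?thesis using False by (simp add: centered_normal_def)
  qed
  moreover have "char (distr std_normal_distribution borel (\<lambda>x. sqrt v * x)) s =
      char std_normal_distribution (s * sqrt v)"
    unfolding char_def by (subst integral_distr) (auto simp: mult_ac)
  ultimately show "char (centered_normal v) s = complex_of_real (exp (- (s\<^sup>2 * v / 2)))"
    using assms by (simp add: char_std_normal_distribution power_mult_distrib)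
  show "real_distribution (centered_normal v)"
    unfolding \<open>centered_normal v = _\<close> by simp
qed

text \<open>Characteristic functions have modulus at most 1, so two products differ by at most the
  sum of the differences of their factors. Each factor and its Gaussian counterpart are compared
  with \<open>1 - s\<^sup>2 * V / 2\<close>: the third moment gives the cubic error, and the
  expansion of the exponential gives the quartic one. The error is explicit because the summands for
  one N have different laws.\<close>

lemma (in prob_space) indep_vars_char_product_approx:
  fixes X :: "'i \<Rightarrow> 'a \<Rightarrow> real"
  assumes I: "finite I" and indep: "indep_vars (\<lambda>_. borel) X I"
    and bounded: "\<And>i \<omega>. i \<in> I \<Longrightarrow> \<omega> \<in> space M \<Longrightarrow> \<bar>X i \<omega>\<bar> \<le> B i"
    and mean: "\<And>i. i \<in> I \<Longrightarrow> expectation (X i) = 0"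
  shows "cmod (char (distr M borel (\<lambda>\<omega>. \<Sum>i\<in>I. X i \<omega>)) s
      - complex_of_real (exp (- (s\<^sup>2 * (\<Sum>i\<in>I. variance (X i)) / 2))))
    \<le> (\<Sum>i\<in>I. \<bar>s\<bar> ^ 3 * B i ^ 3 + s ^ 4 * B i ^ 4)"
proof -
  have rv [measurable]: "random_variable borel (X i)" if "i \<in> I" for i
    using indep that by (auto simp: indep_vars_def)
  define z where "z i = char (distr M borel (X i)) s" for i
  define w where "w i = complex_of_real (exp (- (s\<^sup>2 * variance (X i) / 2)))" for i
  have char: "char (distr M borel (\<lambda>\<omega>. \<Sum>i\<in>I. X i \<omega>)) s = (\<Prod>i\<in>I. z i)"
    unfolding z_def by (rule char_distr_sum[OF indep])
  have gauss: "complex_of_real (exp (- (s\<^sup>2 * (\<Sum>i\<in>I. variance (X i)) / 2))) = (\<Prod>i\<in>I. w i)"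
    using I by (simp add: w_def exp_sum[symmetric] sum_negf sum_distrib_left sum_divide_distrib flip: of_real_prod)
  have diff: "cmod ((\<Prod>i\<in>I. z i) - (\<Prod>i\<in>I. w i)) \<le> (\<Sum>i\<in>I. cmod (z i - w i))"
  proof (rule norm_prod_diff)
    fix i assume i: "i \<in> I"
    show "cmod (z i) \<le> 1"
      unfolding z_def by (rule real_distribution.cmod_char_le_1) (use rv[OF i] in simp)
    show "cmod (w i) \<le> 1"
      by (simp add: w_def)
  qed
  have each: "cmod (z i - w i) \<le> \<bar>s\<bar> ^ 3 * B i ^ 3 + s ^ 4 * B i ^ 4" if i: "i \<in> I" for i
  proof -
    interpret Xi: bounded_variable M "X i" "B i"
      by unfold_locales (use i rv bounded in auto)
    define V where "V = variance (X i)"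
    define u where "u = s\<^sup>2 * V / 2"
    have V: "V = expectation (\<lambda>\<omega>. (X i \<omega>)\<^sup>2)" using mean[OF i] by (simp add: V_def)
    have V0: "V \<ge> 0" unfolding V by simp
    have VB: "V \<le> (B i)\<^sup>2"
    proof -
      have "V \<le> expectation (\<lambda>\<omega>. (B i)\<^sup>2)"
        unfolding V using Xi.S2_bounded by (intro integral_mono) auto
      then show ?thesis by (simp add: prob_space)
    qed
    have "cmod (z i - (1 - s\<^sup>2 * V / 2)) \<le>
        (s\<^sup>2 / 6) * expectation (\<lambda>\<omega>. min (6 * (X i \<omega>)\<^sup>2) (\<bar>s\<bar> * \<bar>X i \<omega>\<bar> ^ 3))"
      unfolding z_def
      by (rule char_approx3') (use i mean V_def in auto)
    also have "\<dots> \<le> (s\<^sup>2 / 6) * (\<bar>s\<bar> * B i ^ 3)"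
    proof (rule mult_left_mono)
      have "expectation (\<lambda>\<omega>. min (6 * (X i \<omega>)\<^sup>2) (\<bar>s\<bar> * \<bar>X i \<omega>\<bar> ^ 3)) \<le> expectation (\<lambda>\<omega>. \<bar>s\<bar> * B i ^ 3)"
      proof (rule integral_mono')
        fix \<omega> assume w: "\<omega> \<in> space M"
        have "\<bar>s\<bar> * \<bar>X i \<omega>\<bar> ^ 3 \<le> \<bar>s\<bar> * B i ^ 3"
          using Xi.bounded[OF w] by (intro mult_left_mono power_mono) auto
        then show "min (6 * (X i \<omega>)\<^sup>2) (\<bar>s\<bar> * \<bar>X i \<omega>\<bar> ^ 3) \<le> \<bar>s\<bar> * B i ^ 3" by simp
      qed (use Xi.K_nonneg in auto)
      then show "expectation (\<lambda>\<omega>. min (6 * (X i \<omega>)\<^sup>2) (\<bar>s\<bar> * \<bar>X i \<omega>\<bar> ^ 3)) \<le> \<bar>s\<bar> * B i ^ 3"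
        by (simp add: prob_space)
    qed simp
    also have "\<dots> \<le> \<bar>s\<bar> ^ 3 * B i ^ 3"
    proof -
      have "(s\<^sup>2 / 6) * (\<bar>s\<bar> * B i ^ 3) = (\<bar>s\<bar> ^ 3 * B i ^ 3) / 6"
        unfolding power2_abs[of s, symmetric] by (simp add: power2_eq_square power3_eq_cube)
      moreover have "0 \<le> \<bar>s\<bar> ^ 3 * B i ^ 3" using Xi.K_nonneg by simp
      ultimately show ?thesis by linarith
    qed
    finally have 1: "cmod (z i - (1 - s\<^sup>2 * V / 2)) \<le> \<bar>s\<bar> ^ 3 * B i ^ 3" .
    have "cmod ((1 - s\<^sup>2 * V / 2) - w i) = cmod (complex_of_real (1 - u - exp (- u)))"
      by (simp add: w_def u_def V_def)
    also have "\<dots> = \<bar>exp (- u) - 1 - (- u)\<bar>" unfolding norm_of_real by simp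
    also have "\<dots> \<le> (- u) * (exp (- u) - 1)"
      using exp_minus_linear_bounds[of "- u"] by simp
    also have "\<dots> = u * (1 - exp (- u))" by (simp add: algebra_simps)
    also have "\<dots> \<le> u * u"
      using V0 exp_ge_add_one_self[of "- u"] by (intro mult_left_mono) (auto simp: u_def)
    also have "\<dots> = s ^ 4 * (V * V) / 4"
      by (simp add: u_def power2_eq_square power4_eq_xxxx)
    also have "\<dots> \<le> s ^ 4 * (V * V)"
      using V0 by simp
    also have "\<dots> \<le> s ^ 4 * ((B i)\<^sup>2 * (B i)\<^sup>2)"
      using V0 VB by (intro mult_left_mono mult_mono) auto
    also have "\<dots> = s ^ 4 * B i ^ 4" by (simp add: power2_eq_square power4_eq_xxxx)
    finally have "cmod ((1 - s\<^sup>2 * V / 2) - w i) \<le> s ^ 4 * B i ^ 4" .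
    with 1 show ?thesis
      using norm_triangle_ineq[of "z i - (1 - s\<^sup>2 * V / 2)" "(1 - s\<^sup>2 * V / 2) - w i"] by simp
  qed
  show ?thesis unfolding char gauss by (rule order_trans[OF diff sum_mono[OF each]])
qed

text \<open>What the limit theorems use of the Gibbs measure: \<open>Y r n\<close> stands for the
  ergodic sum of length n along layer r. Laws are compared between layers at equal length only, and
  independence concerns the lengths that actually occur at a given N.\<close>

locale iid_layers = prob_space +
  fixes Y :: "nat \<Rightarrow> nat \<Rightarrow> 'a \<Rightarrow> real" and K :: real
  assumes rv [measurable]: "\<And>r n. odd r \<Longrightarrow> random_variable borel (Y r n)"
    and bounded: "\<And>r n \<omega>. odd r \<Longrightarrow> \<omega> \<in> space M \<Longrightarrow> \<bar>Y r n \<omega>\<bar> \<le> K * real n"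
    and indep: "\<And>N. indep_vars (\<lambda>_. borel) (\<lambda>r. Y r (layer_length N r)) {r. odd r \<and> r \<le> N}"
    and ident: "\<And>r n. odd r \<Longrightarrow> distr M borel (Y r n) = distr M borel (Y 1 n)"
begin

definition total :: "nat \<Rightarrow> 'a \<Rightarrow> real" where
  "total N \<omega> = (\<Sum>r | odd r \<and> r \<le> N. Y r (layer_length N r) \<omega>)"

abbreviation "\<phi> n \<equiv> bounded_variable.cgf M (Y 1 n)"
abbreviation "\<phi>' n \<equiv> bounded_variable.tilted_mean M (Y 1 n)"
abbreviation "\<phi>'' n \<equiv> bounded_variable.tilted_variance M (Y 1 n)"

definition P :: "real \<Rightarrow> real" where "P t = (\<Sum>k. \<phi> (Suc k) t / 2 ^ (k + 2))"
definition P' :: "real \<Rightarrow> real" where "P' t = (\<Sum>k. \<phi>' (Suc k) t / 2 ^ (k + 2))"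
definition P'' :: "real \<Rightarrow> real" where "P'' t = (\<Sum>k. \<phi>'' (Suc k) t / 2 ^ (k + 2))"

lemma bounded_variable_Y: "odd r \<Longrightarrow> bounded_variable M (Y r n) (K * real n)"
  by unfold_locales (use rv bounded in auto)

lemmas Y1 = bounded_variable_Y[OF odd_one]

lemma K_nonneg: "K \<ge> 0"
  using bounded_variable.K_nonneg[OF Y1, of 1] by simp

lemma finite_layers: "finite {r::nat. odd r \<and> r \<le> N}"
  by simp

lemma rv_total [measurable]: "random_variable borel (total N)"
  unfolding total_def by (intro borel_measurable_sum rv) auto

lemma bounded_variable_total:
  "bounded_variable M (total N) (\<Sum>r | odd r \<and> r \<le> N. K * real (layer_length N r))"
proof unfold_locales
  fix \<omega> assume "\<omega> \<in> space M"
  then have "(\<Sum>r | odd r \<and> r \<le> N. \<bar>Y r (layer_length N r) \<omega>\<bar>)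
      \<le> (\<Sum>r | odd r \<and> r \<le> N. K * real (layer_length N r))"
    by (intro sum_mono bounded) auto
  then show "\<bar>total N \<omega>\<bar> \<le> (\<Sum>r | odd r \<and> r \<le> N. K * real (layer_length N r))"
    unfolding total_def by (rule order_trans[OF sum_abs])
qed (rule rv_total)

lemma expectation_Y_eq:
  fixes g :: "real \<Rightarrow> real"
  assumes "odd r" and [measurable]: "g \<in> borel_measurable borel"
  shows "expectation (\<lambda>\<omega>. g (Y r n \<omega>)) = expectation (\<lambda>\<omega>. g (Y 1 n \<omega>))"
proof -
  have "expectation (\<lambda>\<omega>. g (Y r n \<omega>)) = (\<integral>x. g x \<partial>distr M borel (Y r n))"
    using rv[OF assms(1)] by (simp add: integral_distr)
  also have "\<dots> = (\<integral>x. g x \<partial>distr M borel (Y 1 n))" by (simp only: ident[OF assms(1)])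
  also have "\<dots> = expectation (\<lambda>\<omega>. g (Y 1 n \<omega>))"
    using rv[of 1] by (simp add: integral_distr)
  finally show ?thesis .
qed

lemma cgf_total:
  "bounded_variable.cgf M (total N) t = (\<Sum>r | odd r \<and> r \<le> N. \<phi> (layer_length N r) t)"
proof -
  have "bounded_variable.mgf M (total N) t =
      expectation (\<lambda>\<omega>. \<Prod>r | odd r \<and> r \<le> N. exp (t * Y r (layer_length N r) \<omega>))"
    unfolding bounded_variable.mgf_def[OF bounded_variable_total] total_def
    by (simp add: sum_distrib_left exp_sum finite_layers)
  also have "\<dots> = (\<Prod>r | odd r \<and> r \<le> N. expectation (\<lambda>\<omega>. exp (t * Y r (layer_length N r) \<omega>)))"
    by (rule indep_vars_lebesgue_integral)
       (use finite_layers indep_vars_compose2[OF indep, of N "\<lambda>_ x. exp (t * x)"]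
          bounded_variable.integrable_exp[OF bounded_variable_Y] in auto)
  also have "\<dots> = (\<Prod>r | odd r \<and> r \<le> N. bounded_variable.mgf M (Y 1 (layer_length N r)) t)"
    unfolding bounded_variable.mgf_def[OF Y1]
    by (intro prod.cong refl expectation_Y_eq[where g = "\<lambda>x. exp (t * x)"]) auto
  finally have eq: "bounded_variable.mgf M (total N) t =
      (\<Prod>r | odd r \<and> r \<le> N. bounded_variable.mgf M (Y 1 (layer_length N r)) t)" .
  have "bounded_variable.mgf M (Y 1 n) t \<noteq> 0" for n
    using bounded_variable.mgf_pos[OF Y1, of n t] by simp
  then show ?thesis
    unfolding bounded_variable.cgf_def[OF bounded_variable_total] bounded_variable.cgf_def[OF Y1] eq
    by (intro ln_prod finite_layers)
qed

lemma summable_K: "summable (\<lambda>k. c * (K * real (Suc k)) ^ p / 2 ^ k)"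
  using summable_power_over_power_of_2[of "c * K ^ p" p] by (simp only: power_mult_distrib mult.assoc)

lemma pressure_tendsto: "(\<lambda>N. bounded_variable.cgf M (total N) t / real N) \<longlonglongrightarrow> P t"
  unfolding cgf_total P_def
proof (rule layer_average_tendsto)
  show "\<bar>\<phi> (Suc k) t\<bar> \<le> \<bar>t\<bar> * (K * real (Suc k)) ^ 1" for k
    using bounded_variable.abs_cgf_le[OF Y1, of "Suc k" t] by simp
qed (rule summable_K)

lemma norm_divide_power_le:
  fixes x :: real
  assumes "\<bar>x\<bar> \<le> b"
  shows "norm (x / 2 ^ (k + 2)) \<le> b / 2 ^ k"
proof -
  have "\<bar>x\<bar> / 2 ^ (k + 2) \<le> b / 2 ^ k"
    using assms by (intro frac_le) auto
  then show ?thesis by simp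
qed

text \<open>The bound on the derivatives is uniform in t, and the geometric weights make it
  summable, so the Weierstrass test applies on the whole line. It is used once for \<open>P\<close>
  and once more for \<open>P'\<close>.\<close>

lemma DERIV_layer_series:
  fixes g g' :: "nat \<Rightarrow> real \<Rightarrow> real"
  assumes d: "\<And>k t. (g k has_real_derivative g' k t) (at t)"
    and b: "\<And>k t. \<bar>g' k t\<bar> \<le> c * (K * real (Suc k)) ^ p"
    and s: "summable (\<lambda>k. g k 0 / 2 ^ (k + 2))"
  shows "((\<lambda>t. \<Sum>k. g k t / 2 ^ (k + 2)) has_real_derivative (\<Sum>k. g' k t / 2 ^ (k + 2))) (at t)"
proof -
  have d': "((\<lambda>t. g k t / 2 ^ (k + 2)) has_real_derivative g' k x / 2 ^ (k + 2)) (at x within UNIV)" for k x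
    using d by (rule DERIV_cdivide)
  have u: "uniformly_convergent_on UNIV (\<lambda>n x. \<Sum>k<n. g' k x / 2 ^ (k + 2))"
    by (rule Weierstrass_m_test'[OF norm_divide_power_le[OF b] summable_K])
  have i: "t \<in> interior UNIV" by simp
  show ?thesis
    using has_field_derivative_series'(2)[OF convex_UNIV d' u UNIV_I s i] .
qed

lemma DERIV_P: "(P has_real_derivative P' t) (at t)"
  unfolding P_def[abs_def] P'_def
proof (rule DERIV_layer_series)
  show "\<bar>\<phi>' (Suc k) t\<bar> \<le> 1 * (K * real (Suc k)) ^ 1" for k t
    using bounded_variable.abs_tilted_mean_le[OF Y1, of "Suc k" t] by simp
  show "summable (\<lambda>k. \<phi> (Suc k) 0 / 2 ^ (k + 2))"
    by (simp add: bounded_variable.cgf_0[OF Y1] del: One_nat_def)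
qed (rule bounded_variable.DERIV_cgf[OF Y1])

lemma DERIV_P': "(P' has_real_derivative P'' t) (at t)"
  unfolding P'_def[abs_def] P''_def
proof (rule DERIV_layer_series)
  show "\<bar>\<phi>'' (Suc k) t\<bar> \<le> 2 * (K * real (Suc k)) ^ 2" for k t
    by (rule bounded_variable.abs_tilted_variance_le[OF Y1])
  have "\<bar>\<phi>' (Suc k) 0\<bar> \<le> 1 * (K * real (Suc k)) ^ 1" for k
    using bounded_variable.abs_tilted_mean_le[OF Y1, of "Suc k" 0] by simp
  then show "summable (\<lambda>k. \<phi>' (Suc k) 0 / 2 ^ (k + 2))"
    by (intro summable_comparison_test'[OF summable_K norm_divide_power_le])
qed (rule bounded_variable.DERIV_tilted_mean[OF Y1])

lemma P''_0_nonneg: "P'' 0 \<ge> 0"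
  unfolding P''_def
proof (rule suminf_nonneg)
  have "norm (\<phi>'' (Suc k) 0 / 2 ^ (k + 2)) \<le> 2 * (K * real (Suc k)) ^ 2 / 2 ^ k" for k
    using bounded_variable.abs_tilted_variance_le[OF Y1, of "Suc k" 0] by (intro norm_divide_power_le)
  then show "summable (\<lambda>k. \<phi>'' (Suc k) 0 / 2 ^ (k + 2))"
    by (intro summable_comparison_test'[OF summable_K])
  show "0 \<le> \<phi>'' (Suc k) 0 / 2 ^ (k + 2)" for k
    by (simp add: bounded_variable.tilted_variance_0[OF Y1] del: One_nat_def)
qed

text \<open>Additivity of the variance comes from differentiating the additive cumulant
  generating function twice.\<close>

lemma variance_total:
  "variance (total N) = (\<Sum>r | odd r \<and> r \<le> N. variance (Y 1 (layer_length N r)))"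
proof -
  note T = bounded_variable_total[of N]
  have "bounded_variable.tilted_mean M (total N) t = (\<Sum>r | odd r \<and> r \<le> N. \<phi>' (layer_length N r) t)" for t
  proof (rule DERIV_unique)
    show "(bounded_variable.cgf M (total N) has_real_derivative bounded_variable.tilted_mean M (total N) t) (at t)"
      by (rule bounded_variable.DERIV_cgf[OF T])
    show "(bounded_variable.cgf M (total N) has_real_derivative (\<Sum>r | odd r \<and> r \<le> N. \<phi>' (layer_length N r) t)) (at t)"
      unfolding cgf_total[abs_def] by (intro DERIV_sum bounded_variable.DERIV_cgf[OF Y1])
  qed
  then have eq: "bounded_variable.tilted_mean M (total N) = (\<lambda>t. \<Sum>r | odd r \<and> r \<le> N. \<phi>' (layer_length N r) t)"
    by blast
  have "bounded_variable.tilted_variance M (total N) 0 = (\<Sum>r | odd r \<and> r \<le> N. \<phi>'' (layer_length N r) 0)"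
  proof (rule DERIV_unique)
    show "(bounded_variable.tilted_mean M (total N) has_real_derivative bounded_variable.tilted_variance M (total N) 0) (at 0)"
      by (rule bounded_variable.DERIV_tilted_mean[OF T])
    show "(bounded_variable.tilted_mean M (total N) has_real_derivative (\<Sum>r | odd r \<and> r \<le> N. \<phi>'' (layer_length N r) 0)) (at 0)"
      unfolding eq by (intro DERIV_sum bounded_variable.DERIV_tilted_mean[OF Y1])
  qed
  then show ?thesis
    by (simp add: bounded_variable.tilted_variance_0[OF T] bounded_variable.tilted_variance_0[OF Y1]
        del: One_nat_def)
qed

text \<open>The limit of finite variances is matched with the second derivative of the limiting
  pressure through the common series over layer lengths, instead of interchanging a limit with
  derivatives.\<close>

lemma variance_tendsto: "(\<lambda>N. variance (total N) / real N) \<longlonglongrightarrow> P'' 0"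
proof -
  have "(\<lambda>N. (\<Sum>r | odd r \<and> r \<le> N. \<phi>'' (layer_length N r) 0) / real N) \<longlonglongrightarrow> P'' 0"
    unfolding P''_def
  proof (rule layer_average_tendsto)
    show "\<bar>\<phi>'' (Suc k) 0\<bar> \<le> 2 * (K * real (Suc k)) ^ 2" for k
      by (rule bounded_variable.abs_tilted_variance_le[OF Y1])
  qed (rule summable_K)
  then show ?thesis
    by (simp add: variance_total bounded_variable.tilted_variance_0[OF Y1] del: One_nat_def)
qed

text \<open>A sum over layers of p-th powers is of order N. Scaling the summands by
  \<open>1 / sqrt (real N)\<close> leaves a spare factor \<open>1 / sqrt (real N)\<close> for p = 3
  and its square for p = 4.\<close>

lemma char_error_tendsto:
  assumes "q > 0" "c \<ge> 0"
  shows "(\<lambda>N. (\<Sum>r | odd r \<and> r \<le> N. c * (K * real (layer_length N r)) ^ p) / real N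
    * (1 / sqrt (real N)) ^ q) \<longlonglongrightarrow> 0"
proof -
  have "(\<lambda>N. (\<Sum>r | odd r \<and> r \<le> N. c * (K * real (layer_length N r)) ^ p) / real N)
      \<longlonglongrightarrow> (\<Sum>k. c * (K * real (Suc k)) ^ p / 2 ^ (k + 2))"
    by (rule layer_average_tendsto[OF _ summable_K]) (use K_nonneg assms in auto)
  moreover have "(\<lambda>N. (1 / sqrt (real N)) ^ q) \<longlonglongrightarrow> 0 ^ q"
    by (intro tendsto_power tendsto_divide_0[OF tendsto_const]
        filterlim_at_top_imp_at_infinity filterlim_compose[OF sqrt_at_top filterlim_real_sequentially])
  ultimately have "(\<lambda>N. (\<Sum>r | odd r \<and> r \<le> N. c * (K * real (layer_length N r)) ^ p) / real N
      * (1 / sqrt (real N)) ^ q) \<longlonglongrightarrow> (\<Sum>k. c * (K * real (Suc k)) ^ p / 2 ^ (k + 2)) * 0 ^ q"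
    by (rule tendsto_mult)
  then show ?thesis using assms(1) by (simp only: zero_power mult_zero_right)
qed

theorem total_clt:
  "weak_conv_m (\<lambda>N. distr M borel (\<lambda>\<omega>. (total N \<omega> - expectation (total N)) / sqrt (real N)))
    (centered_normal (P'' 0))"
proof (rule levy_continuity)
  show "real_distribution (distr M borel (\<lambda>\<omega>. (total N \<omega> - expectation (total N)) / sqrt (real N)))" for N
    by simp
  show "real_distribution (centered_normal (P'' 0))"
    by (rule char_centered_normal[OF P''_0_nonneg])
  fix s :: real
  \<comment> \<open>Centring doubles the bound on a layer; 8 and 16 are the third and fourth powers
    of that 2.\<close>
  define E where "E N = (\<Sum>r | odd r \<and> r \<le> N. 8 * \<bar>s\<bar> ^ 3 * (K * real (layer_length N r)) ^ 3) / real N * (1 / sqrt (real N)) ^ 1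
    + (\<Sum>r | odd r \<and> r \<le> N. 16 * s ^ 4 * (K * real (layer_length N r)) ^ 4) / real N * (1 / sqrt (real N)) ^ 2" for N
  have "E \<longlonglongrightarrow> 0 + 0"
    unfolding E_def by (intro tendsto_add char_error_tendsto) auto
  then have E0: "E \<longlonglongrightarrow> 0" by simp
  \<comment> \<open>The comparison is with the Gaussian of the exact variance at N;
    \<open>variance_tendsto\<close> replaces this variance by its limit only afterwards.\<close>
  have main: "cmod (char (distr M borel (\<lambda>\<omega>. (total N \<omega> - expectation (total N)) / sqrt (real N))) s
      - complex_of_real (exp (- (s\<^sup>2 * (variance (total N) / real N) / 2)))) \<le> E N" if N: "N > 0" for N
  proof -
    define m where "m r = expectation (Y r (layer_length N r))" for r
    define X where "X r \<omega> = (Y r (layer_length N r) \<omega> - m r) / sqrt (real N)" for r \<omega>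
    define B where "B r = 2 * (K * real (layer_length N r)) / sqrt (real N)" for r
    have int [simp]: "integrable M (Y r n)" if "odd r" for r n
      by (rule bounded_variable.integrable_S[OF bounded_variable_Y[OF that]])
    have mb: "\<bar>m r\<bar> \<le> K * real (layer_length N r)" if "odd r" for r
      using bounded_variable.abs_tilted_mean_le[OF bounded_variable_Y[OF that], of _ 0]
      by (simp add: m_def bounded_variable.tilted_mean_0[OF bounded_variable_Y[OF that]])
    have sumX: "(\<Sum>r | odd r \<and> r \<le> N. X r \<omega>) = (total N \<omega> - expectation (total N)) / sqrt (real N)" for \<omega>
    proof -
      have "expectation (total N) = (\<Sum>r | odd r \<and> r \<le> N. m r)"
        unfolding total_def m_def by (intro Bochner_Integration.integral_sum) auto
      then show ?thesis
        by (simp add: X_def total_def sum_divide_distrib[symmetric] sum_subtractf)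
    qed
    have var: "variance (X r) = variance (Y 1 (layer_length N r)) / real N" if "odd r" for r
    proof -
      have mX: "expectation (X r) = 0"
        using that unfolding X_def by (simp add: m_def prob_space)
      have "variance (X r) = expectation (\<lambda>\<omega>. (Y r (layer_length N r) \<omega> - m r)\<^sup>2 / real N)"
        unfolding mX by (simp add: X_def power_divide)
      also have "\<dots> = expectation (\<lambda>\<omega>. (Y r (layer_length N r) \<omega> - m r)\<^sup>2) / real N" by simp
      also have "expectation (\<lambda>\<omega>. (Y r (layer_length N r) \<omega> - m r)\<^sup>2) =
          expectation (\<lambda>\<omega>. (Y 1 (layer_length N r) \<omega> - m r)\<^sup>2)"
        using expectation_Y_eq[OF that, of "\<lambda>x. (x - m r)\<^sup>2"] by simp
      also have "m r = expectation (Y 1 (layer_length N r))"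
        unfolding m_def using expectation_Y_eq[OF that, of "\<lambda>x. x"] by simp
      finally show ?thesis .
    qed
    have "cmod (char (distr M borel (\<lambda>\<omega>. \<Sum>r | odd r \<and> r \<le> N. X r \<omega>)) s
        - complex_of_real (exp (- (s\<^sup>2 * (\<Sum>r | odd r \<and> r \<le> N. variance (X r)) / 2))))
      \<le> (\<Sum>r | odd r \<and> r \<le> N. \<bar>s\<bar> ^ 3 * B r ^ 3 + s ^ 4 * B r ^ 4)"
    proof (rule indep_vars_char_product_approx)
      show "indep_vars (\<lambda>_. borel) X {r. odd r \<and> r \<le> N}"
        using indep_vars_compose2[OF indep, of N "\<lambda>r x. (x - m r) / sqrt (real N)" "\<lambda>_. borel"]
        by (simp add: X_def[abs_def])
      fix r assume "r \<in> {r. odd r \<and> r \<le> N}"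
      then have r: "odd r" by simp
      show "expectation (X r) = 0"
        using r unfolding X_def by (simp add: m_def prob_space)
      fix \<omega> assume w: "\<omega> \<in> space M"
      have "\<bar>Y r (layer_length N r) \<omega> - m r\<bar> \<le> 2 * (K * real (layer_length N r))"
        using bounded[OF r w, of "layer_length N r"] mb[OF r] by linarith
      then show "\<bar>X r \<omega>\<bar> \<le> B r"
        by (simp add: X_def B_def divide_right_mono)
    qed (rule finite_layers)
    also have "(\<Sum>r | odd r \<and> r \<le> N. \<bar>s\<bar> ^ 3 * B r ^ 3 + s ^ 4 * B r ^ 4) = E N"
    proof -
      have "sqrt (real N) ^ 2 = real N" by simp
      then have *: "sqrt (real N) ^ 3 = real N * sqrt (real N)" "sqrt (real N) ^ 4 = real N * real N"
        by (simp_all add: power3_eq_cube power4_eq_xxxx power2_eq_square)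
      show ?thesis
        unfolding E_def B_def
        by (simp add: sum.distrib power_divide power_mult_distrib * sum_divide_distrib sum_distrib_right
            power2_eq_square mult_ac)
    qed
    also have "(\<Sum>r | odd r \<and> r \<le> N. variance (X r)) = variance (total N) / real N"
      unfolding variance_total sum_divide_distrib by (intro sum.cong refl var) simp
    finally show ?thesis unfolding sumX .
  qed
  have "(\<lambda>N. complex_of_real (exp (- (s\<^sup>2 * (variance (total N) / real N) / 2))))
      \<longlonglongrightarrow> complex_of_real (exp (- (s\<^sup>2 * P'' 0 / 2)))"
    by (intro tendsto_intros variance_tendsto) auto
  moreover have "(\<lambda>N. char (distr M borel (\<lambda>\<omega>. (total N \<omega> - expectation (total N)) / sqrt (real N))) s
      - complex_of_real (exp (- (s\<^sup>2 * (variance (total N) / real N) / 2)))) \<longlonglongrightarrow> 0"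
    by (rule Lim_null_comparison[OF eventually_mono[OF eventually_gt_at_top[of 0] main] E0])
  ultimately show "(\<lambda>N. char (distr M borel (\<lambda>\<omega>. (total N \<omega> - expectation (total N)) / sqrt (real N))) s)
      \<longlonglongrightarrow> char (centered_normal (P'' 0)) s"
    unfolding char_centered_normal(1)[OF P''_0_nonneg] by (rule Lim_transform)
qed

end

section \<open>Transfer matrices\<close>

definition layer_segment :: "nat \<Rightarrow> nat \<Rightarrow> nat set" where
  "layer_segment r n = (\<lambda>k. r * 2 ^ k) ` {..<n}"

lemma layer_segment_Suc: "layer_segment r (Suc n) = insert (r * 2 ^ n) (layer_segment r n)"
  by (auto simp: layer_segment_def lessThan_Suc)

lemma finite_layer_segment [simp]: "finite (layer_segment r n)"
  by (simp add: layer_segment_def)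

lemma layer_segment_subset: "r > 0 \<Longrightarrow> layer_segment r n \<subseteq> {1..}"
  by (auto simp: layer_segment_def Suc_le_eq)

lemma mult_ising_potential_singleton:
  "i \<ge> 1 \<Longrightarrow> mult_ising_potential \<beta> J h {i} \<sigma> = - \<beta> * h * \<sigma> i"
  by (auto simp: mult_ising_potential_def)

lemma mult_ising_potential_pair:
  assumes "i \<ge> 1"
  shows "mult_ising_potential \<beta> J h {i, 2 * i} \<sigma> = - \<beta> * J * \<sigma> i * \<sigma> (2 * i)"
proof -
  have "\<not> (\<exists>j\<ge>1. {i, 2 * i} = {j})" using assms by auto
  moreover have "\<exists>j\<ge>1. {i, 2 * i} = {j, 2 * j}" using assms by blast
  moreover have "Min {i, 2 * i} = i" using assms by simp
  ultimately show ?thesis by (simp only: mult_ising_potential_def if_True if_False)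
qed

text \<open>Among the bonds that meet the segment just one leaves it, the bond from the top site to
  the site \<open>r * 2 ^ n\<close>; it is the term k = n - 1. Below \<open>r\<close> there is
  nothing to interact with, because \<open>r\<close> is odd.\<close>

lemma hamiltonian_layer_segment:
  assumes r: "odd r"
  shows "hamiltonian (mult_ising_potential \<beta> J h) (layer_segment r n) \<sigma> =
    (\<Sum>k<n. - \<beta> * (h * layer r \<sigma> k + J * layer r \<sigma> k * layer r \<sigma> (Suc k)))"
proof -
  let ?U = "mult_ising_potential \<beta> J h" and ?L = "layer_segment r n"
  have r0: "r > 0" using r by (rule odd_pos)
  have L1: "i \<ge> 1" if "i \<in> ?L" for i using that layer_segment_subset[OF r0] by auto
  define S where "S = (\<lambda>i. {i}) ` ?L"
  define D where "D = (\<lambda>i. {i, 2 * i}) ` ?L"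
  have "hamiltonian ?U ?L \<sigma> = infsum (\<lambda>A. ?U A \<sigma>) (S \<union> D)"
    unfolding hamiltonian_def
  proof (rule infsum_cong_neutral)
    fix A assume "A \<in> S \<union> D - {A. finite A \<and> A \<subseteq> {1..} \<and> A \<inter> ?L \<noteq> {}}"
    then show "?U A \<sigma> = 0" using L1 by (fastforce simp: S_def D_def)
  next
    fix A assume A: "A \<in> {A. finite A \<and> A \<subseteq> {1..} \<and> A \<inter> ?L \<noteq> {}} - (S \<union> D)"
    have "\<not> (\<exists>i\<ge>1. A = {i})" using A by (auto simp: S_def)
    moreover have "\<not> (\<exists>i\<ge>1. A = {i, 2 * i})"
    proof
      assume "\<exists>i\<ge>1. A = {i, 2 * i}"
      then obtain i where i: "A = {i, 2 * i}" by blast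
      \<comment> \<open>Such a bond would enter the segment from below: its upper end is in the
        segment and its lower end is not. Halving the upper end either stays in the segment or makes
        r even.\<close>
      with A have "2 * i \<in> ?L" "i \<notin> ?L" by (auto simp: D_def)
      then obtain k where k: "k < n" "2 * i = r * 2 ^ k" by (auto simp: layer_segment_def)
      show False
      proof (cases k)
        case 0
        then have "r = 2 * i" using k by simp
        then show False using r by simp
      next
        case (Suc l)
        then have "i = r * 2 ^ l" using k by simp
        then show False using \<open>i \<notin> ?L\<close> k Suc by (auto simp: layer_segment_def)
      qed
    qed
    ultimately show "?U A \<sigma> = 0" by (simp only: mult_ising_potential_def if_False)
  qed simp
  also have "\<dots> = (\<Sum>A\<in>S \<union> D. ?U A \<sigma>)"
    by (rule infsum_finite) (simp add: S_def D_def)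
  also have "\<dots> = (\<Sum>A\<in>S. ?U A \<sigma>) + (\<Sum>A\<in>D. ?U A \<sigma>)"
    \<comment> \<open>A pair degenerates to a singleton only at \<open>i = 0\<close>, which is not a
      site.\<close>
    by (rule sum.union_disjoint) (use L1[of 0] in \<open>auto simp: S_def D_def doubleton_eq_iff\<close>)
  also have "(\<Sum>A\<in>S. ?U A \<sigma>) = (\<Sum>i\<in>?L. ?U {i} \<sigma>)"
    unfolding S_def by (subst sum.reindex) (auto simp: inj_on_def)
  also have "(\<Sum>A\<in>D. ?U A \<sigma>) = (\<Sum>i\<in>?L. ?U {i, 2 * i} \<sigma>)"
    unfolding D_def by (subst sum.reindex) (use L1 in \<open>auto simp: inj_on_def doubleton_eq_iff\<close>)
  also have "(\<Sum>i\<in>?L. ?U {i} \<sigma>) + (\<Sum>i\<in>?L. ?U {i, 2 * i} \<sigma>) =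
      (\<Sum>i\<in>?L. - \<beta> * h * \<sigma> i + - \<beta> * J * \<sigma> i * \<sigma> (2 * i))"
    unfolding sum.distrib[symmetric]
    by (intro sum.cong refl) (simp only: mult_ising_potential_singleton mult_ising_potential_pair L1)
  also have "\<dots> = (\<Sum>k<n. - \<beta> * h * \<sigma> (r * 2 ^ k) + - \<beta> * J * \<sigma> (r * 2 ^ k) * \<sigma> (2 * (r * 2 ^ k)))"
    unfolding layer_segment_def by (subst sum.reindex) (use r0 in \<open>auto simp: inj_on_def\<close>)
  also have "\<dots> = (\<Sum>k<n. - \<beta> * (h * layer r \<sigma> k + J * layer r \<sigma> k * layer r \<sigma> (Suc k)))"
    by (intro sum.cong refl) (simp add: layer_def algebra_simps)
  finally show ?thesis .
qed

text \<open>\<open>transfer n g \<tau>\<close> is the unnormalised expectation of \<open>g\<close> in the chain on the sites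
  below \<open>n\<close>, with boundary condition \<open>\<tau>\<close>.\<close>

fun transfer :: "real \<Rightarrow> real \<Rightarrow> real \<Rightarrow> nat \<Rightarrow> ((nat \<Rightarrow> real) \<Rightarrow> real) \<Rightarrow> (nat \<Rightarrow> real) \<Rightarrow> real" where
  "transfer \<beta> J h 0 g \<tau> = g \<tau>"
| "transfer \<beta> J h (Suc n) g \<tau> =
    (\<Sum>s\<in>{-1, 1}. exp (\<beta> * (h * s + J * s * \<tau> (Suc n))) * transfer \<beta> J h n g (\<tau>(n := s)))"

lemma layer_fun_upd: "r > 0 \<Longrightarrow> layer r (\<eta>(r * 2 ^ n := s)) = (layer r \<eta>)(n := s)"
  by (auto simp: layer_def fun_eq_iff)

text \<open>Induction from the top: the spin at \<open>r * 2 ^ n\<close> is fixed first and becomes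
  part of the boundary condition of the shorter segment. Its weight contains its field term and its
  bond to the next site, as in the recursion of \<open>transfer\<close>.\<close>

lemma sum_configs_layer_segment:
  assumes r: "odd r"
  shows "(\<Sum>\<omega>\<in>configs (layer_segment r n).
      exp (- hamiltonian (mult_ising_potential \<beta> J h) (layer_segment r n)
        (override_on \<eta> \<omega> (layer_segment r n))) *
      g (layer r (override_on \<eta> \<omega> (layer_segment r n)))) =
    transfer \<beta> J h n g (layer r \<eta>)"
proof (induction n arbitrary: \<eta>)
  case 0
  show ?case
    by (simp add: hamiltonian_layer_segment[OF r]) (simp add: layer_segment_def configs_def)
next
  case (Suc n)
  define x where "x = r * 2 ^ n"
  define L where "L = layer_segment r n"
  have r0: "r > 0" using r by (rule odd_pos)
  have x: "x \<notin> L" using r0 by (auto simp: x_def L_def layer_segment_def)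
  have Suc_eq: "layer_segment r (Suc n) = insert x L" by (simp add: layer_segment_Suc x_def L_def)
  define w where "w m \<sigma> = exp (\<Sum>k<m. \<beta> * (h * layer r \<sigma> k + J * layer r \<sigma> k * layer r \<sigma> (Suc k))) * g (layer r \<sigma>)" for m \<sigma>
  have w: "exp (- hamiltonian (mult_ising_potential \<beta> J h) (layer_segment r m) \<sigma>) * g (layer r \<sigma>) = w m \<sigma>" for m \<sigma>
    by (simp add: hamiltonian_layer_segment[OF r] w_def sum_negf)
  have IH: "(\<Sum>\<omega>\<in>configs L. w n (override_on \<eta> \<omega> L)) = transfer \<beta> J h n g (layer r \<eta>)" for \<eta>
    using Suc.IH[of \<eta>] unfolding w L_def .
  have over: "override_on \<eta> (fun_upd \<omega> x s) (insert x L) = override_on (fun_upd \<eta> x s) \<omega> L" for \<omega> s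
    using x by (auto simp: override_on_def fun_eq_iff)
  have split: "w (Suc n) (override_on (\<eta>(x := s)) \<omega> L) =
      exp (\<beta> * (h * s + J * s * layer r \<eta> (Suc n))) * w n (override_on (\<eta>(x := s)) \<omega> L)" for s \<omega>
  proof -
    let ?\<sigma> = "override_on (\<eta>(x := s)) \<omega> L"
    have "layer r ?\<sigma> n = s" using x by (simp add: layer_def x_def override_on_def)
    moreover have "r * 2 ^ Suc n \<notin> insert x L"
      using r0 by (auto simp: x_def L_def layer_segment_def simp del: power_Suc)
    then have "layer r ?\<sigma> (Suc n) = layer r \<eta> (Suc n)"
      by (simp add: layer_def override_on_def del: power_Suc)
    ultimately show ?thesis
      by (simp add: w_def exp_add mult_ac)
  qed
  have "(\<Sum>\<omega>\<in>configs (insert x L). w (Suc n) (override_on \<eta> \<omega> (insert x L))) =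
      (\<Sum>(s, \<omega>)\<in>{-1, 1} \<times> configs L. w (Suc n) (override_on \<eta> (fun_upd \<omega> x s) (insert x L)))"
    unfolding configs_def PiE_insert_eq
    by (subst sum.reindex[OF inj_combinator[OF x]]) (simp add: split_def)
  also have "\<dots> = (\<Sum>s\<in>{-1, 1}. \<Sum>\<omega>\<in>configs L. w (Suc n) (override_on \<eta> (fun_upd \<omega> x s) (insert x L)))"
    by (rule sum.cartesian_product[symmetric])
  also have "\<dots> = (\<Sum>s\<in>{-1, 1}. exp (\<beta> * (h * s + J * s * layer r \<eta> (Suc n))) *
      (\<Sum>\<omega>\<in>configs L. w n (override_on (\<eta>(x := s)) \<omega> L)))"
    by (simp only: over split sum_distrib_left)
  also have "\<dots> = (\<Sum>s\<in>{-1, 1}. exp (\<beta> * (h * s + J * s * layer r \<eta> (Suc n))) *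
      transfer \<beta> J h n g (layer r (\<eta>(x := s))))"
    by (simp only: IH)
  also have "\<dots> = transfer \<beta> J h (Suc n) g (layer r \<eta>)"
    by (simp only: transfer.simps x_def layer_fun_upd[OF r0])
  finally show ?case by (simp only: Suc_eq[symmetric] w)
qed

section \<open>Dependence of the finite chain on its boundary spin\<close>

lemma transfer_const_pos: "transfer \<beta> J h n (\<lambda>_. 1) \<tau> > 0"
proof (induction n arbitrary: \<tau>)
  case (Suc n)
  show ?case
    unfolding transfer.simps by (intro sum_pos mult_pos_pos Suc.IH) auto
qed simp

text \<open>The sites below \<open>n\<close> are summed out. What remains visible is the boundary
  spin at \<open>n\<close> and any coordinate beyond it that \<open>g\<close> reads
  directly.\<close>

lemma transfer_local:
  assumes g: "\<And>\<tau> \<tau>'. (\<And>k. k < m \<Longrightarrow> \<tau> k = \<tau>' k) \<Longrightarrow> g \<tau> = g \<tau>'"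
    and "\<And>k. k \<ge> n \<Longrightarrow> k = n \<or> k < m \<Longrightarrow> \<tau> k = \<tau>' k"
  shows "transfer \<beta> J h n g \<tau> = transfer \<beta> J h n g \<tau>'"
  using assms(2)
proof (induction n arbitrary: \<tau> \<tau>')
  case 0
  show ?case unfolding transfer.simps by (rule g) (use 0 in simp)
next
  case (Suc n)
  have "transfer \<beta> J h n g (\<tau>(n := s)) = transfer \<beta> J h n g (\<tau>'(n := s))" for s
    by (rule Suc.IH) (use Suc.prems in auto)
  moreover have "\<tau> (Suc n) = \<tau>' (Suc n)" by (rule Suc.prems) auto
  ultimately show ?case by simp
qed

lemma transfer_const_local:
  assumes g: "\<And>\<tau> \<tau>'. (\<And>k. k < m \<Longrightarrow> \<tau> k = \<tau>' k) \<Longrightarrow> g \<tau> = g \<tau>'" and "m \<le> n"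
  shows "transfer \<beta> J h n g \<tau> = transfer \<beta> J h n g (\<lambda>_. \<tau> n)"
proof (rule transfer_local[where m = m])
  show "g \<tau> = g \<tau>'" if "\<And>k. k < m \<Longrightarrow> \<tau> k = \<tau>' k" for \<tau> \<tau>'
    by (rule g) (rule that)
  show "\<tau> k = \<tau> n" if "n \<le> k" "k = n \<or> k < m" for k
    using that \<open>m \<le> n\<close> by auto
qed

text \<open>Once the coordinates read by \<open>g\<close> lie below \<open>n\<close>, the pair of
  values at boundary spins 1 and -1 evolves by multiplication with the transfer matrix.\<close>

lemma transfer_Suc_const:
  assumes g: "\<And>\<tau> \<tau>'. (\<And>k. k < m \<Longrightarrow> \<tau> k = \<tau>' k) \<Longrightarrow> g \<tau> = g \<tau>'" and "m \<le> n"
  shows "transfer \<beta> J h (Suc n) g (\<lambda>_. b) =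
    exp (\<beta> * (h + J * b)) * transfer \<beta> J h n g (\<lambda>_. 1) +
    exp (- \<beta> * (h + J * b)) * transfer \<beta> J h n g (\<lambda>_. -1)"
proof -
  have "transfer \<beta> J h n g ((\<lambda>_. b)(n := s)) = transfer \<beta> J h n g (\<lambda>_. s)" for s
    using transfer_const_local[of m g n \<beta> J h "(\<lambda>_. b)(n := s)", OF g assms(2)] by simp
  then show ?thesis by (simp add: algebra_simps)
qed

definition chain_expectation :: "real \<Rightarrow> real \<Rightarrow> real \<Rightarrow> nat \<Rightarrow> ((nat \<Rightarrow> real) \<Rightarrow> real) \<Rightarrow> (nat \<Rightarrow> real) \<Rightarrow> real" where
  "chain_expectation \<beta> J h n g \<tau> = transfer \<beta> J h n g \<tau> / transfer \<beta> J h n (\<lambda>_. 1) \<tau>"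

text \<open>The determinant \<open>F\<^sub>n(1) Z\<^sub>n(-1) - F\<^sub>n(-1) Z\<^sub>n(1)\<close> is multiplied by that of the transfer matrix
  in each step, whereas \<open>Z\<^sub>n(1) Z\<^sub>n(-1)\<close> grows at least by the permanent.\<close>

lemma chain_expectation_boundary_decay:
  assumes g: "\<And>\<tau> \<tau>'. (\<And>k. k < m \<Longrightarrow> \<tau> k = \<tau>' k) \<Longrightarrow> g \<tau> = g \<tau>'"
  shows "(\<lambda>n. chain_expectation \<beta> J h n g (\<lambda>_. 1) - chain_expectation \<beta> J h n g (\<lambda>_. -1)) \<longlonglongrightarrow> 0"
proof -
  \<comment> \<open>The diagonal and antidiagonal products of the transfer matrix, from which
    \<open>h\<close> cancels. Thus \<open>p - q\<close> is its determinant and \<open>p + q\<close>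
    its permanent.\<close>
  define p q where "p = exp (2 * \<beta> * J)" and "q = exp (- 2 * \<beta> * J)"
  have pq: "p > 0" "q > 0" by (auto simp: p_def q_def)
  define F where "F n b = transfer \<beta> J h n g (\<lambda>_. b)" for n b
  define Z where "Z n b = transfer \<beta> J h n (\<lambda>_. 1) (\<lambda>_. b)" for n b
  define a where "a s b = exp (s * \<beta> * (h + J * b))" for s b :: real
  have F: "F (Suc n) b = a 1 b * F n 1 + a (-1) b * F n (-1)" if "m \<le> n" for n b
    using transfer_Suc_const[of m g n, OF g that] by (simp add: F_def a_def)
  have Z: "Z (Suc n) b = a 1 b * Z n 1 + a (-1) b * Z n (-1)" for n b
    using transfer_Suc_const[of 0 "\<lambda>_. 1" n] by (simp add: Z_def a_def)
  have Zpos: "Z n b > 0" for n b unfolding Z_def by (rule transfer_const_pos)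
  have apos: "a s b > 0" for s b by (simp add: a_def)
  have aa: "a 1 1 * a (-1) (-1) = p" "a (-1) 1 * a 1 (-1) = q"
    by (simp_all add: a_def p_def q_def exp_add[symmetric] algebra_simps)
  define D where "D n = F n 1 * Z n (-1) - F n (-1) * Z n 1" for n
  define W where "W n = Z n 1 * Z n (-1)" for n
  have D: "D (Suc n) = (p - q) * D n" if "m \<le> n" for n
    unfolding D_def F[OF that] Z aa[symmetric] by (simp add: algebra_simps)
  have W: "W (Suc n) \<ge> (p + q) * W n" for n
  proof -
    have "W (Suc n) = (p + q) * W n + (a 1 1 * a 1 (-1) * (Z n 1 * Z n 1) +
        a (-1) 1 * a (-1) (-1) * (Z n (-1) * Z n (-1)))"
      unfolding W_def Z aa[symmetric] by (simp add: algebra_simps)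
    moreover have "0 \<le> a 1 1 * a 1 (-1) * (Z n 1 * Z n 1) + a (-1) 1 * a (-1) (-1) * (Z n (-1) * Z n (-1))"
      using Zpos apos by (intro add_nonneg_nonneg mult_nonneg_nonneg) (auto intro: less_imp_le)
    ultimately show ?thesis by linarith
  qed
  have Wpos: "W n > 0" for n unfolding W_def using Zpos by simp
  \<comment> \<open>This is the absolute value of tanh (2 \<beta> J), hence below 1 for every finite
    coupling.\<close>
  define \<rho> where "\<rho> = \<bar>p - q\<bar> / (p + q)"
  have \<rho>: "0 \<le> \<rho>" "\<rho> < 1" using pq by (auto simp: \<rho>_def)
  \<comment> \<open>The recursion for \<open>F\<close> starts at \<open>m\<close>, when all
    coordinates read by \<open>g\<close> have been summed out; hence the offset.\<close>
  have decay: "\<bar>D (k + m)\<bar> / W (k + m) \<le> \<bar>D m\<bar> / W m * \<rho> ^ k" for k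
  proof (induction k)
    case (Suc k)
    have "\<bar>D (Suc k + m)\<bar> / W (Suc k + m) \<le> (\<bar>p - q\<bar> * \<bar>D (k + m)\<bar>) / ((p + q) * W (k + m))"
      using D[of "k + m"] W[of "k + m"] pq Wpos by (intro frac_le) (auto simp: abs_mult)
    also have "\<dots> = \<rho> * (\<bar>D (k + m)\<bar> / W (k + m))" by (simp add: \<rho>_def)
    also have "\<dots> \<le> \<rho> * (\<bar>D m\<bar> / W m * \<rho> ^ k)" by (intro mult_left_mono Suc.IH \<rho>)
    finally show ?case by (simp add: mult_ac)
  qed simp
  have ce: "chain_expectation \<beta> J h n g (\<lambda>_. 1) - chain_expectation \<beta> J h n g (\<lambda>_. -1) = D n / W n" for n
    using Zpos[of n 1] Zpos[of n "-1"]
    by (simp add: chain_expectation_def F_def[symmetric] Z_def[symmetric] D_def W_def field_simps)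
  have "(\<lambda>k. \<bar>D m\<bar> / W m * \<rho> ^ k) \<longlonglongrightarrow> \<bar>D m\<bar> / W m * 0"
    by (intro tendsto_mult tendsto_const LIMSEQ_realpow_zero \<rho>)
  then have lim: "(\<lambda>k. \<bar>D m\<bar> / W m * \<rho> ^ k) \<longlonglongrightarrow> 0" by simp
  have "norm (D (k + m) / W (k + m)) \<le> \<bar>D m\<bar> / W m * \<rho> ^ k" for k
    using decay[of k] Wpos[of "k + m"] by simp
  then have "(\<lambda>k. D (k + m) / W (k + m)) \<longlonglongrightarrow> 0"
    by (intro Lim_null_comparison[OF always_eventually lim]) auto
  then show ?thesis unfolding ce by (rule LIMSEQ_offset)
qed

text \<open>Without field, summing the bottom spin gives
  \<open>exp (\<beta> * J * s) + exp (- \<beta> * J * s)\<close> with s the next spin, which is the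
  same for s = 1 and s = -1. So the bottom site contributes only a constant, which cancels in
  \<open>chain_expectation\<close>. The induction step merely carries the top spin along.\<close>

lemma transfer_shift:
  assumes "\<And>k. \<tau> k \<in> {-1, 1}"
  shows "transfer \<beta> J 0 (Suc n) (\<lambda>\<tau>. g (\<lambda>k. \<tau> (Suc k))) \<tau> =
    (exp (\<beta> * J) + exp (- \<beta> * J)) * transfer \<beta> J 0 n g (\<lambda>k. \<tau> (Suc k))"
  using assms
proof (induction n arbitrary: \<tau>)
  case 0
  have "(\<lambda>k. (\<tau>(0 := s)) (Suc k)) = (\<lambda>k. \<tau> (Suc k))" for s by simp
  moreover have "\<tau> (Suc 0) = 1 \<or> \<tau> (Suc 0) = -1" using 0[of "Suc 0"] by auto
  ultimately show ?case by (auto simp: algebra_simps)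
next
  case (Suc n)
  have upd: "(\<lambda>k. (\<tau>(Suc n := s)) (Suc k)) = (\<lambda>k. \<tau> (Suc k))(n := s)" for s
    by (auto simp: fun_eq_iff)
  have IH: "transfer \<beta> J 0 (Suc n) (\<lambda>\<tau>. g (\<lambda>k. \<tau> (Suc k))) (\<tau>(Suc n := s)) =
      (exp (\<beta> * J) + exp (- \<beta> * J)) * transfer \<beta> J 0 n g ((\<lambda>k. \<tau> (Suc k))(n := s))"
    if s: "s \<in> {-1, 1}" for s
  proof -
    have "(\<tau>(Suc n := s)) k \<in> {-1, 1}" for k using s Suc.prems[of k] by (simp only: fun_upd_apply split: if_split) simp
    from Suc.IH[where \<tau> = "\<tau>(Suc n := s)", OF this] show ?thesis unfolding upd .
  qed
  have "transfer \<beta> J 0 (Suc (Suc n)) (\<lambda>\<tau>. g (\<lambda>k. \<tau> (Suc k))) \<tau> =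
      (\<Sum>s\<in>{-1, 1}. exp (\<beta> * (0 * s + J * s * \<tau> (Suc (Suc n)))) *
        ((exp (\<beta> * J) + exp (- \<beta> * J)) * transfer \<beta> J 0 n g ((\<lambda>k. \<tau> (Suc k))(n := s))))"
    unfolding transfer.simps(2)[of \<beta> J 0 "Suc n"] by (intro sum.cong refl) (simp only: IH)
  also have "\<dots> = (exp (\<beta> * J) + exp (- \<beta> * J)) * transfer \<beta> J 0 (Suc n) g (\<lambda>k. \<tau> (Suc k))"
    unfolding transfer.simps(2)[of \<beta> J 0 n] sum_distrib_left
    by (intro sum.cong refl) (simp only: mult_ac)
  finally show ?case .
qed

lemma chain_expectation_shift:
  assumes "\<And>k. \<tau> k \<in> {-1, 1}"
  shows "chain_expectation \<beta> J 0 (Suc n) (\<lambda>\<tau>. g (\<lambda>k. \<tau> (Suc k))) \<tau> = chain_expectation \<beta> J 0 n g (\<lambda>k. \<tau> (Suc k))"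
proof -
  define c where "c = exp (\<beta> * J) + exp (- \<beta> * J)"
  have "c \<noteq> 0"
    using add_pos_pos[OF exp_gt_zero[of "\<beta> * J"] exp_gt_zero[of "- \<beta> * J"]] by (simp add: c_def)
  then show ?thesis
    unfolding chain_expectation_def
    using transfer_shift[where \<tau> = \<tau>, OF assms, of \<beta> J n g]
      transfer_shift[where \<tau> = \<tau>, OF assms, of \<beta> J n "\<lambda>_. 1"]
    unfolding c_def[symmetric] by (simp del: transfer.simps)
qed

section \<open>Independence of the layers under the Gibbs measure\<close>

text \<open>Membership is determined by the spins off layer \<open>r\<close>. The pointwise form
  applies directly to the overridden configurations in a Gibbs kernel.\<close>

definition layer_invariant :: "nat \<Rightarrow> (nat \<Rightarrow> real) set \<Rightarrow> bool" where
  "layer_invariant r C \<longleftrightarrow> (\<forall>\<sigma>\<in>configs {1..}. \<forall>\<sigma>'\<in>configs {1..}.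
     (\<forall>i. i \<notin> range (\<lambda>k. r * 2 ^ k) \<longrightarrow> \<sigma> i = \<sigma>' i) \<longrightarrow> (\<sigma> \<in> C \<longleftrightarrow> \<sigma>' \<in> C))"

text \<open>Quantified over all real sequences, because \<open>transfer\<close> is also evaluated at
  boundary conditions that are not known to be configurations.\<close>

definition cylinder :: "nat \<Rightarrow> (nat \<Rightarrow> real) set \<Rightarrow> bool" where
  "cylinder m A \<longleftrightarrow> (\<forall>\<tau> \<tau>'. (\<forall>k<m. \<tau> k = \<tau>' k) \<longrightarrow> (\<tau> \<in> A \<longleftrightarrow> \<tau>' \<in> A))"

lemma override_in_configs:
  assumes "\<eta> \<in> configs {1..}" "\<omega> \<in> configs L" "L \<subseteq> {1..}"
  shows "override_on \<eta> \<omega> L \<in> configs {1..}"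
  using assms unfolding configs_def PiE_def Pi_def extensional_def override_on_def by auto

text \<open>Resampling a segment of layer \<open>r\<close> cannot change membership in
  \<open>C\<close>, so the indicator of \<open>C\<close> leaves the sum and a one-dimensional Ising
  chain remains.\<close>

lemma gibbs_kernel_layer_segment:
  assumes r: "odd r" and \<eta>: "\<eta> \<in> configs {1..}" and C: "layer_invariant r C"
  shows "gibbs_kernel (mult_ising_potential \<beta> J h) (layer_segment r n) {\<sigma>\<in>C. layer r \<sigma> \<in> A} \<eta> =
    chain_expectation \<beta> J h n (indicator A) (layer r \<eta>) * indicator C \<eta>"
proof -
  let ?L = "layer_segment r n"
  define E where "E \<omega> = exp (- hamiltonian (mult_ising_potential \<beta> J h) ?L (override_on \<eta> \<omega> ?L))" for \<omega>
  have ind: "indicator {\<sigma>\<in>C. layer r \<sigma> \<in> A} (override_on \<eta> \<omega> ?L) =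
      (indicator A (layer r (override_on \<eta> \<omega> ?L)) * indicator C \<eta> :: real)" if "\<omega> \<in> configs ?L" for \<omega>
  proof -
    have "override_on \<eta> \<omega> ?L \<in> configs {1..}"
      by (rule override_in_configs[OF \<eta> that layer_segment_subset[OF odd_pos[OF r]]])
    moreover have "\<forall>i. i \<notin> range (\<lambda>k. r * 2 ^ k) \<longrightarrow> override_on \<eta> \<omega> ?L i = \<eta> i"
      by (auto simp: override_on_def layer_segment_def)
    ultimately have "override_on \<eta> \<omega> ?L \<in> C \<longleftrightarrow> \<eta> \<in> C"
      using C \<eta> unfolding layer_invariant_def by blast
    then show ?thesis by (auto simp: indicator_def)
  qed
  have "(\<Sum>\<omega>\<in>configs ?L. E \<omega> * indicator {\<sigma>\<in>C. layer r \<sigma> \<in> A} (override_on \<eta> \<omega> ?L)) =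
      (\<Sum>\<omega>\<in>configs ?L. E \<omega> * indicator A (layer r (override_on \<eta> \<omega> ?L))) * indicator C \<eta>"
    unfolding sum_distrib_right by (intro sum.cong refl) (simp only: ind mult.assoc)
  also have "(\<Sum>\<omega>\<in>configs ?L. E \<omega> * indicator A (layer r (override_on \<eta> \<omega> ?L))) =
      transfer \<beta> J h n (indicator A) (layer r \<eta>)"
    unfolding E_def by (rule sum_configs_layer_segment[OF r])
  finally have num: "(\<Sum>\<omega>\<in>configs ?L. E \<omega> * indicator {\<sigma>\<in>C. layer r \<sigma> \<in> A} (override_on \<eta> \<omega> ?L)) =
      transfer \<beta> J h n (indicator A) (layer r \<eta>) * indicator C \<eta>" .
  have den: "(\<Sum>\<omega>\<in>configs ?L. E \<omega>) = transfer \<beta> J h n (\<lambda>_. 1) (layer r \<eta>)"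
    using sum_configs_layer_segment[OF r, where g = "\<lambda>_. 1"] by (simp add: E_def)
  show ?thesis
    unfolding gibbs_kernel_def partition_function_def E_def[symmetric] num den chain_expectation_def by simp
qed

section \<open>Identification of the layer laws from the DLR equations\<close>

locale mult_ising =
  fixes \<beta> J h :: real and \<mu> :: "(nat \<Rightarrow> real) measure"
  assumes ising: "mult_ising_measure \<beta> J h \<mu>"

sublocale mult_ising \<subseteq> prob_space \<mu>
  using ising by (simp add: mult_ising_measure_def gibbs_measure_def)

context mult_ising
begin

lemma sets_\<mu>: "sets \<mu> = sets (config_algebra {1..})"
  using ising by (simp add: mult_ising_measure_def gibbs_measure_def)

lemma space_\<mu>: "space \<mu> = configs {1..}"
  using sets_eq_imp_space_eq[OF sets_\<mu>] by (simp add: config_algebra_def configs_def space_PiM)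

lemma space_config_algebra: "space (config_algebra I) = configs I"
  by (simp add: config_algebra_def configs_def space_PiM)

lemma DLR:
  assumes "finite L" "L \<subseteq> {1..}" "B \<in> events"
  shows "prob B = (LINT \<eta>|\<mu>. gibbs_kernel (mult_ising_potential \<beta> J h) L B \<eta>)"
  using ising assms by (simp add: mult_ising_measure_def gibbs_measure_def)

lemma measurable_spin: "i \<ge> 1 \<Longrightarrow> (\<lambda>\<sigma>. \<sigma> i) \<in> measurable \<mu> (count_space {-1, 1})"
  unfolding measurable_cong_sets[OF sets_\<mu> refl] config_algebra_def
  by (rule measurable_component_singleton) simp

lemma spin_values: "\<sigma> \<in> space \<mu> \<Longrightarrow> i \<ge> 1 \<Longrightarrow> \<sigma> i = -1 \<or> \<sigma> i = 1"
  using PiE_mem[of \<sigma> "{1..}" "\<lambda>_. {-1, 1}" i] by (simp add: space_\<mu> configs_def)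

lemma measurable_layer: "r > 0 \<Longrightarrow> layer r \<in> measurable \<mu> (config_algebra UNIV)"
  unfolding config_algebra_def layer_def
proof (rule measurable_PiM_single')
  assume r: "r > 0"
  then have ge: "r * 2 ^ i \<ge> 1" for i by (simp add: Suc_le_eq)
  show "(\<lambda>\<sigma>. \<sigma> (r * 2 ^ i)) \<in> measurable \<mu> (count_space {-1, 1})" for i
    by (rule measurable_spin[OF ge])
  show "(\<lambda>\<sigma> i. \<sigma> (r * 2 ^ i)) \<in> space \<mu> \<rightarrow> (\<Pi>\<^sub>E i\<in>UNIV. space (count_space {-1, 1}))"
    using spin_values[OF _ ge] by fastforce
qed

text \<open>For large n the DLR equation writes the fixed probability on the right as a mixture of
  the chain values for boundary spin 1 and -1. The law of that spin, jointly with \<open>C\<close>,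
  is unknown, but the two values merge, so either one converges to the same limit after
  multiplication by \<open>prob C\<close>.\<close>

lemma chain_expectation_tendsto:
  assumes r: "odd r" and C: "layer_invariant r C" "C \<in> events"
    and B: "{\<sigma>\<in>C. layer r \<sigma> \<in> A} \<in> events"
    and A: "cylinder m A"
  shows "(\<lambda>n. chain_expectation \<beta> J h n (indicator A) (\<lambda>_. 1) * prob C)
    \<longlonglongrightarrow> prob {\<sigma>\<in>C. layer r \<sigma> \<in> A}"
proof -
  define c where "c n b = chain_expectation \<beta> J h n (indicator A) (\<lambda>_. b)" for n and b :: real
  define E where "E n = {\<sigma>\<in>space \<mu>. \<sigma> (r * 2 ^ n) = -1}" for n
  have r0: "r > 0" using r by (rule odd_pos)
  have ge: "r * 2 ^ i \<ge> 1" for i using r0 by (simp add: Suc_le_eq)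
  have E: "E n \<in> events" for n
  proof -
    have "(\<lambda>\<sigma>. \<sigma> (r * 2 ^ n)) -` {-1} \<inter> space \<mu> \<in> events"
      by (rule measurable_sets[OF measurable_spin[OF ge]]) simp
    also have "(\<lambda>\<sigma>. \<sigma> (r * 2 ^ n)) -` {-1} \<inter> space \<mu> = E n" by (auto simp: E_def)
    finally show ?thesis .
  qed
  have g: "(indicator A \<tau> :: real) = indicator A \<tau>'" if "\<And>k. k < m \<Longrightarrow> \<tau> k = \<tau>' k" for \<tau> \<tau>'
  proof -
    have "\<tau> \<in> A \<longleftrightarrow> \<tau>' \<in> A"
      using A[unfolded cylinder_def, rule_format, of \<tau> \<tau>'] that by blast
    then show ?thesis by (simp add: indicator_def)
  qed
  have exact: "prob {\<sigma>\<in>C. layer r \<sigma> \<in> A} = c n 1 * prob C + (c n (-1) - c n 1) * prob (C \<inter> E n)"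
    if n: "m \<le> n" for n
  proof -
    have loc: "chain_expectation \<beta> J h n (indicator A) \<tau> = c n (\<tau> n)" for \<tau>
      unfolding chain_expectation_def c_def
      by (rule arg_cong2[where f = "(/)", OF transfer_const_local[OF g n] transfer_const_local[OF refl le0]])
    have "prob {\<sigma>\<in>C. layer r \<sigma> \<in> A} = (LINT \<eta>|\<mu>. gibbs_kernel (mult_ising_potential \<beta> J h) (layer_segment r n)
        {\<sigma>\<in>C. layer r \<sigma> \<in> A} \<eta>)"
      by (rule DLR[OF _ layer_segment_subset[OF r0] B]) simp
    also have "\<dots> = (LINT \<eta>|\<mu>. c n 1 * indicator C \<eta> + (c n (-1) - c n 1) * indicator (C \<inter> E n) \<eta>)"
    proof (rule Bochner_Integration.integral_cong[OF refl])
      fix \<eta> assume \<eta>: "\<eta> \<in> space \<mu>"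
      have "gibbs_kernel (mult_ising_potential \<beta> J h) (layer_segment r n) {\<sigma>\<in>C. layer r \<sigma> \<in> A} \<eta> =
          c n (\<eta> (r * 2 ^ n)) * indicator C \<eta>"
        using gibbs_kernel_layer_segment[OF r _ C(1), of \<eta> \<beta> J h n A] \<eta>
        by (simp add: loc space_\<mu> layer_def)
      then show "gibbs_kernel (mult_ising_potential \<beta> J h) (layer_segment r n) {\<sigma>\<in>C. layer r \<sigma> \<in> A} \<eta> =
          c n 1 * indicator C \<eta> + (c n (-1) - c n 1) * indicator (C \<inter> E n) \<eta>"
        using spin_values[OF \<eta> ge[of n]] \<eta> by (auto simp: E_def indicator_def)
    qed
    also have "\<dots> = c n 1 * prob C + (c n (-1) - c n 1) * prob (C \<inter> E n)"
      using C(2) E[of n]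
      by (subst Bochner_Integration.integral_add) (auto simp: less_top[symmetric] sets.Int)
    finally show ?thesis .
  qed
  have "(\<lambda>n. c n 1 - c n (-1)) \<longlonglongrightarrow> 0"
    unfolding c_def by (rule chain_expectation_boundary_decay[where m = m]) (rule g)
  then have dec: "(\<lambda>n. \<bar>c n 1 - c n (-1)\<bar>) \<longlonglongrightarrow> 0"
    by (rule tendsto_rabs_zero)
  have "(\<lambda>n. c n 1 * prob C - prob {\<sigma>\<in>C. layer r \<sigma> \<in> A}) \<longlonglongrightarrow> 0"
  proof (rule Lim_null_comparison[OF _ dec])
    show "\<forall>\<^sub>F n in sequentially. norm (c n 1 * prob C - prob {\<sigma>\<in>C. layer r \<sigma> \<in> A}) \<le> \<bar>c n 1 - c n (-1)\<bar>"
      using eventually_ge_at_top[of m]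
    proof eventually_elim
      case (elim n)
      have "c n 1 * prob C - prob {\<sigma>\<in>C. layer r \<sigma> \<in> A} = (c n 1 - c n (-1)) * prob (C \<inter> E n)"
        by (simp only: exact[OF elim]) (simp add: algebra_simps)
      then show ?case
        by (simp add: abs_mult mult_left_le)
    qed
  qed
  then show ?thesis unfolding c_def by (simp add: LIM_zero_iff)
qed

lemma layer_invariant_space: "layer_invariant r (space \<mu>)"
  by (simp add: layer_invariant_def space_\<mu>)

text \<open>The chain expectation contains neither \<open>r\<close> nor \<open>C\<close>. Comparing
  the limit for \<open>(r, C)\<close> with that for layer 1 and the whole space gives equality of
  laws and factorisation together.\<close>

lemma layer_cylinder_prob:
  assumes r: "odd r" and C: "layer_invariant r C" "C \<in> events"
    and B: "\<And>r C. odd r \<Longrightarrow> C \<in> events \<Longrightarrow> {\<sigma>\<in>C. layer r \<sigma> \<in> A} \<in> events"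
    and A: "cylinder m A"
  shows "prob {\<sigma>\<in>C. layer r \<sigma> \<in> A} = prob {\<sigma>\<in>space \<mu>. layer 1 \<sigma> \<in> A} * prob C"
proof -
  from chain_expectation_tendsto[OF odd_one layer_invariant_space sets.top B[OF odd_one sets.top] A]
  have "(\<lambda>n. chain_expectation \<beta> J h n (indicator A) (\<lambda>_. 1)) \<longlonglongrightarrow> prob {\<sigma>\<in>space \<mu>. layer 1 \<sigma> \<in> A}"
    by (simp add: prob_space)
  then have "(\<lambda>n. chain_expectation \<beta> J h n (indicator A) (\<lambda>_. 1) * prob C)
      \<longlonglongrightarrow> prob {\<sigma>\<in>space \<mu>. layer 1 \<sigma> \<in> A} * prob C"
    by (intro tendsto_mult tendsto_const)
  with chain_expectation_tendsto[OF r C B[OF r C(2)] A] show ?thesis by (rule LIMSEQ_unique)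
qed

text \<open>Finite-dimensional boxes are cylinders and generate the product sigma-algebra. The
  intersections with \<open>configs UNIV\<close> are there because a cylinder is a set of arbitrary
  real sequences.\<close>

lemma measure_eq_on_cylinders:
  fixes P Q :: "(nat \<Rightarrow> real) measure"
  assumes "sets P = sets (config_algebra UNIV)" "sets Q = sets (config_algebra UNIV)" "finite_measure P"
    and eq: "\<And>m A. cylinder m A \<Longrightarrow>
      A \<inter> configs UNIV \<in> sets (config_algebra UNIV) \<Longrightarrow>
      emeasure P (A \<inter> configs UNIV) = emeasure Q (A \<inter> configs UNIV)"
  shows "P = Q"
proof (rule measure_eqI_PiM_infinite[OF _ _ _ assms(3)])
  show "sets P = sets (PiM UNIV (\<lambda>_. count_space {-1, 1}))" "sets Q = sets (PiM UNIV (\<lambda>_. count_space {-1, 1}))"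
    using assms by (simp_all add: config_algebra_def)
  fix X and I :: "nat set"
  assume I: "finite I" "\<And>i. i \<in> I \<Longrightarrow> X i \<in> sets (count_space {-1, 1::real})"
  define A where "A = {\<tau>. \<forall>i\<in>I. \<tau> i \<in> X i}"
  have emb: "prod_emb UNIV (\<lambda>_. count_space {-1, 1}) I (Pi\<^sub>E I X) = A \<inter> configs UNIV"
    by (auto simp: prod_emb_def A_def configs_def PiE_iff)
  obtain m where m: "\<And>i. i \<in> I \<Longrightarrow> i < m"
    using I(1) by (meson finite_nat_bounded lessThan_iff subsetD)
  have "A \<inter> configs UNIV \<in> sets (config_algebra UNIV)"
    unfolding emb[symmetric] config_algebra_def using I by (intro sets_PiM_I) auto
  moreover have "cylinder m A"
    using m by (simp add: cylinder_def A_def)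
  ultimately show "emeasure P (prod_emb UNIV (\<lambda>_. count_space {-1, 1}) I (Pi\<^sub>E I X)) =
      emeasure Q (prod_emb UNIV (\<lambda>_. count_space {-1, 1}) I (Pi\<^sub>E I X))"
    unfolding emb by (intro eq)
qed

lemma layer_in_configs: "r > 0 \<Longrightarrow> \<sigma> \<in> space \<mu> \<Longrightarrow> layer r \<sigma> \<in> configs UNIV"
  using measurable_space[OF measurable_layer] by (simp add: space_config_algebra)

lemma layer_event:
  assumes "odd r" "C \<in> events" "A \<inter> configs UNIV \<in> sets (config_algebra UNIV)"
  shows "{\<sigma>\<in>C. layer r \<sigma> \<in> A} \<in> events"
proof -
  have r: "r > 0" using assms(1) by (rule odd_pos)
  have "{\<sigma>\<in>C. layer r \<sigma> \<in> A} = C \<inter> (layer r -` (A \<inter> configs UNIV) \<inter> space \<mu>)"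
    using sets.sets_into_space[OF assms(2)] layer_in_configs[OF r] by auto
  moreover have "layer r -` (A \<inter> configs UNIV) \<inter> space \<mu> \<in> events"
    by (rule measurable_sets[OF measurable_layer[OF r] assms(3)])
  ultimately show ?thesis using assms(2) by (simp only: sets.Int)
qed

text \<open>For fixed \<open>C\<close> both sides are finite measures in \<open>A\<close>: the law
  of layer \<open>r\<close> restricted to \<open>C\<close>, and the law of layer 1 scaled by
  \<open>prob C\<close>. They agree on cylinders.\<close>

lemma layer_prob_times:
  assumes r: "odd r" and C: "layer_invariant r C" "C \<in> events" and A: "A \<in> sets (config_algebra UNIV)"
  shows "prob {\<sigma>\<in>C. layer r \<sigma> \<in> A} = prob {\<sigma>\<in>space \<mu>. layer 1 \<sigma> \<in> A} * prob C"
proof -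
  have r0: "r > 0" using r by (rule odd_pos)
  define P where "P = distr (density \<mu> (indicator C)) (config_algebra UNIV) (layer r)"
  define Q where "Q = scale_measure (prob C) (distr \<mu> (config_algebra UNIV) (layer 1))"
  have mr: "layer r \<in> measurable (density \<mu> (indicator C)) (config_algebra UNIV)"
    using measurable_layer[OF r0] by (simp only: measurable_cong_sets[OF sets_density refl])
  have P: "emeasure P A = ennreal (prob {\<sigma>\<in>C. layer r \<sigma> \<in> A})" if A: "A \<in> sets (config_algebra UNIV)" for A
  proof -
    have ev: "layer r -` A \<inter> space \<mu> \<in> events"
      by (rule measurable_sets[OF measurable_layer[OF r0] A])
    have "emeasure P A = emeasure (density \<mu> (indicator C)) (layer r -` A \<inter> space \<mu>)"
      unfolding P_def by (subst emeasure_distr[OF mr A]) simp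
    also have "\<dots> = emeasure \<mu> (C \<inter> (layer r -` A \<inter> space \<mu>))"
      using C(2) ev by (subst emeasure_density) (auto simp: indicator_inter_arith[symmetric] sets.Int)
    also have "C \<inter> (layer r -` A \<inter> space \<mu>) = {\<sigma>\<in>C. layer r \<sigma> \<in> A}"
      using sets.sets_into_space[OF C(2)] by auto
    finally show ?thesis by (simp add: emeasure_eq_measure)
  qed
  have Q: "emeasure Q A = ennreal (prob {\<sigma>\<in>space \<mu>. layer 1 \<sigma> \<in> A} * prob C)" if A: "A \<in> sets (config_algebra UNIV)" for A
  proof -
    have "emeasure Q A = ennreal (prob C) * emeasure \<mu> (layer 1 -` A \<inter> space \<mu>)"
      unfolding Q_def by (simp add: emeasure_distr[OF measurable_layer A])
    also have "layer 1 -` A \<inter> space \<mu> = {\<sigma>\<in>space \<mu>. layer 1 \<sigma> \<in> A}" by auto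
    finally show ?thesis by (simp add: emeasure_eq_measure ennreal_mult mult.commute)
  qed
  have "P = Q"
  proof (rule measure_eq_on_cylinders)
    show "sets P = sets (config_algebra UNIV)" "sets Q = sets (config_algebra UNIV)"
      by (simp_all add: P_def Q_def)
    show "finite_measure P"
    proof
      have "space P = space (config_algebra UNIV)" by (simp add: P_def)
      then show "emeasure P (space P) \<noteq> \<infinity>" using P[OF sets.top] by simp
    qed
    fix m A
    assume A: "cylinder m A"
      and ev: "A \<inter> configs UNIV \<in> sets (config_algebra UNIV)"
    have "prob {\<sigma>\<in>C. layer r \<sigma> \<in> A} = prob {\<sigma>\<in>space \<mu>. layer 1 \<sigma> \<in> A} * prob C"
      by (rule layer_cylinder_prob[OF r C layer_event[OF _ _ ev] A])
    moreover have "{\<sigma>\<in>C. layer r \<sigma> \<in> A \<inter> configs UNIV} = {\<sigma>\<in>C. layer r \<sigma> \<in> A}"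
      using sets.sets_into_space[OF C(2)] layer_in_configs[OF r0] by auto
    moreover have "{\<sigma>\<in>space \<mu>. layer 1 \<sigma> \<in> A \<inter> configs UNIV} = {\<sigma>\<in>space \<mu>. layer 1 \<sigma> \<in> A}"
      using layer_in_configs[of 1] by auto
    ultimately show "emeasure P (A \<inter> configs UNIV) = emeasure Q (A \<inter> configs UNIV)"
      by (simp only: P[OF ev] Q[OF ev])
  qed
  then have "ennreal (prob {\<sigma>\<in>C. layer r \<sigma> \<in> A}) = ennreal (prob {\<sigma>\<in>space \<mu>. layer 1 \<sigma> \<in> A} * prob C)"
    using P[OF A] Q[OF A] by simp
  then show ?thesis by (simp add: ennreal_inj)
qed

lemma layer_prob:
  assumes "odd r" "A \<in> sets (config_algebra UNIV)"
  shows "prob {\<sigma>\<in>space \<mu>. layer r \<sigma> \<in> A} = prob {\<sigma>\<in>space \<mu>. layer 1 \<sigma> \<in> A}"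
  using layer_prob_times[OF assms(1) layer_invariant_space sets.top assms(2)]
  by (simp add: prob_space)

lemma distr_layer:
  assumes r: "odd r"
  shows "distr \<mu> (config_algebra UNIV) (layer r) = distr \<mu> (config_algebra UNIV) (layer 1)"
proof (rule measure_eqI)
  fix A assume "A \<in> sets (distr \<mu> (config_algebra UNIV) (layer r))"
  then have A: "A \<in> sets (config_algebra UNIV)" by simp
  have *: "emeasure (distr \<mu> (config_algebra UNIV) (layer s)) A = ennreal (prob {\<sigma>\<in>space \<mu>. layer s \<sigma> \<in> A})"
    if "odd s" for s
    by (subst emeasure_distr[OF measurable_layer[OF odd_pos[OF that]] A])
       (simp add: emeasure_eq_measure vimage_def Int_def conj_commute)
  show "emeasure (distr \<mu> (config_algebra UNIV) (layer r)) A = emeasure (distr \<mu> (config_algebra UNIV) (layer 1)) A"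
    by (simp only: *[OF r] *[OF odd_one] layer_prob[OF r A])
qed simp

lemma indep_layers: "indep_vars (\<lambda>_. config_algebra UNIV) layer {r. odd r}"
  unfolding indep_vars_def2
proof (intro conjI ballI)
  show "layer r \<in> measurable \<mu> (config_algebra UNIV)" if "r \<in> {r. odd r}" for r
    using that by (intro measurable_layer odd_pos) simp
  show "indep_sets (\<lambda>r. {layer r -` A \<inter> space \<mu> |A. A \<in> sets (config_algebra UNIV)}) {r. odd r}"
  proof (rule indep_setsI)
    show "{layer r -` A \<inter> space \<mu> |A. A \<in> sets (config_algebra UNIV)} \<subseteq> events" if "r \<in> {r. odd r}" for r
      using measurable_sets[OF measurable_layer[OF odd_pos]] that by auto
    fix B R assume R: "R \<noteq> {}" "R \<subseteq> {r. odd r}" "finite R"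
      and "\<forall>r\<in>R. B r \<in> {layer r -` A \<inter> space \<mu> |A. A \<in> sets (config_algebra UNIV)}"
    then have "\<forall>r\<in>R. \<exists>A. A \<in> sets (config_algebra UNIV) \<and> B r = {\<sigma>\<in>space \<mu>. layer r \<sigma> \<in> A}"
      by (auto simp: vimage_def Int_def conj_commute)
    then obtain A where A: "\<And>r. r \<in> R \<Longrightarrow> A r \<in> sets (config_algebra UNIV)"
      and B: "\<And>r. r \<in> R \<Longrightarrow> B r = {\<sigma>\<in>space \<mu>. layer r \<sigma> \<in> A r}" by metis
    \<comment> \<open>Layers are added one at a time. The event about the earlier layers is
      insensitive to the new layer, as distinct odd numbers have disjoint layers, so
      \<open>layer_prob_times\<close> splits off one factor. Measurability is carried along for use
      as its hypothesis.\<close>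
    have "prob {\<sigma>\<in>space \<mu>. \<forall>r\<in>R'. layer r \<sigma> \<in> A r} = (\<Prod>r\<in>R'. prob (B r)) \<and>
        {\<sigma>\<in>space \<mu>. \<forall>r\<in>R'. layer r \<sigma> \<in> A r} \<in> events" if "R' \<subseteq> R" for R'
      using finite_subset[OF that R(3)] that
    proof (induction R' rule: finite_induct)
      case (insert s R')
      define C where "C = {\<sigma>\<in>space \<mu>. \<forall>r\<in>R'. layer r \<sigma> \<in> A r}"
      have C: "prob C = (\<Prod>r\<in>R'. prob (B r))" "C \<in> events"
        using insert by (auto simp: C_def)
      have s: "odd s" "s \<in> R" using insert R by auto
      have inv: "layer_invariant s C"
        unfolding layer_invariant_def
      proof (intro ballI impI)
        fix \<sigma> \<sigma>' assume \<sigma>: "\<sigma> \<in> configs {1..}" "\<sigma>' \<in> configs {1..}"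
          and eq: "\<forall>i. i \<notin> range (\<lambda>k. s * 2 ^ k) \<longrightarrow> \<sigma> i = \<sigma>' i"
        have "layer r \<sigma> = layer r \<sigma>'" if "r \<in> R'" for r
        proof
          fix k
          have "odd r" "r \<noteq> s" using that insert R by auto
          then have "r * 2 ^ k \<notin> range (\<lambda>k. s * 2 ^ k)"
            using odd_times_power_of_2_inj[of r s k] s by auto
          then show "layer r \<sigma> k = layer r \<sigma>' k" using eq by (simp add: layer_def)
        qed
        then show "\<sigma> \<in> C \<longleftrightarrow> \<sigma>' \<in> C" using \<sigma> by (simp add: C_def space_\<mu>)
      qed
      have set_eq: "{\<sigma>\<in>space \<mu>. \<forall>r\<in>insert s R'. layer r \<sigma> \<in> A r} = {\<sigma>\<in>C. layer s \<sigma> \<in> A s}"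
        by (auto simp: C_def)
      have "prob {\<sigma>\<in>C. layer s \<sigma> \<in> A s} = prob (B s) * prob C"
        unfolding B[OF s(2)] layer_prob[OF s(1) A[OF s(2)]] by (rule layer_prob_times[OF s(1) inv C(2) A[OF s(2)]])
      moreover have "{\<sigma>\<in>C. layer s \<sigma> \<in> A s} \<in> events"
        using A[OF s(2)] by (intro layer_event[OF s(1) C(2)] sets.Int)
          (auto simp: space_config_algebra[symmetric])
      ultimately show ?case
        unfolding set_eq using insert.hyps C(1) by simp
    qed (simp add: prob_space)
    from conjunct1[OF this[OF subset_refl]]
    have "prob {\<sigma>\<in>space \<mu>. \<forall>r\<in>R. layer r \<sigma> \<in> A r} = (\<Prod>r\<in>R. prob (B r))" .
    moreover have "{\<sigma>\<in>space \<mu>. \<forall>r\<in>R. layer r \<sigma> \<in> A r} = (\<Inter>r\<in>R. B r)"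
      using R(1) B by auto
    ultimately show "prob (\<Inter>r\<in>R. B r) = (\<Prod>r\<in>R. prob (B r))" by simp
  qed
qed

end

section \<open>Stationarity of a layer in the absence of a field\<close>

lemma measurable_tail: "(\<lambda>\<tau> j. \<tau> (k + j)) \<in> measurable (config_algebra UNIV) (config_algebra UNIV)"
  unfolding config_algebra_def
proof (rule measurable_PiM_single')
  show "(\<lambda>\<tau>. \<tau> (k + i)) \<in> measurable (PiM UNIV (\<lambda>_. count_space {-1, 1})) (count_space {-1, 1::real})" for i
    by (rule measurable_component_singleton) simp
  show "(\<lambda>\<tau> i. \<tau> (k + i)) \<in> space (PiM UNIV (\<lambda>_. count_space {-1, 1})) \<rightarrow> (\<Pi>\<^sub>E i\<in>UNIV. space (count_space {-1, 1::real}))"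
    by (auto simp: space_PiM PiE_def)
qed

text \<open>The case of one step passes \<open>chain_expectation_shift\<close> to the limit on
  cylinders; longer shifts follow by iterating the image measure.\<close>

lemma (in mult_ising) distr_tail:
  assumes "h = 0"
  shows "distr \<mu> (config_algebra UNIV) (\<lambda>\<sigma> j. layer 1 \<sigma> (k + j)) = distr \<mu> (config_algebra UNIV) (layer 1)"
proof (induction k)
  case (Suc k)
  note m1 = measurable_layer[of 1, OF zero_less_one]
  have comp: "(\<lambda>\<sigma> j. layer 1 \<sigma> (i + j)) = (\<lambda>\<tau> j. \<tau> (i + j)) \<circ> layer 1" for i by (simp add: comp_def)
  have m: "(\<lambda>\<sigma> j. layer 1 \<sigma> (i + j)) \<in> measurable \<mu> (config_algebra UNIV)" for i
    unfolding comp by (rule measurable_comp[OF m1 measurable_tail])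
  have one: "distr \<mu> (config_algebra UNIV) (\<lambda>\<sigma> j. layer 1 \<sigma> (1 + j)) = distr \<mu> (config_algebra UNIV) (layer 1)"
  proof (rule measure_eq_on_cylinders)
    show "finite_measure (distr \<mu> (config_algebra UNIV) (\<lambda>\<sigma> j. layer 1 \<sigma> (1 + j)))"
      by (rule finite_measure_distr[OF m])
    fix n A
    assume A: "cylinder n A"
      and ev: "A \<inter> configs UNIV \<in> sets (config_algebra UNIV)"
    define A' where "A' = {\<tau> :: nat \<Rightarrow> real. (\<lambda>j. \<tau> (Suc j)) \<in> A}"
    have A': "cylinder (Suc n) A'"
      using A by (simp add: cylinder_def A'_def)
    have ev1: "{\<sigma>\<in>space \<mu>. layer 1 \<sigma> \<in> A} \<in> events" by (rule layer_event[OF odd_one sets.top ev])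
    have inA': "{\<sigma>\<in>space \<mu>. layer 1 \<sigma> \<in> A'} = (\<lambda>\<sigma> j. layer 1 \<sigma> (1 + j)) -` (A \<inter> configs UNIV) \<inter> space \<mu>"
      using measurable_space[OF m[of 1]] by (auto simp: A'_def space_config_algebra)
    have ev2: "{\<sigma>\<in>space \<mu>. layer 1 \<sigma> \<in> A'} \<in> events"
      unfolding inA' by (rule measurable_sets[OF m ev])
    have "(\<lambda>n. chain_expectation \<beta> J h n (indicator A') (\<lambda>_. 1) * prob (space \<mu>)) \<longlonglongrightarrow> prob {\<sigma>\<in>space \<mu>. layer 1 \<sigma> \<in> A'}"
      by (rule chain_expectation_tendsto[OF odd_one layer_invariant_space sets.top ev2 A'])
    \<comment> \<open>The shifted event reads one site further, so length \<open>Suc n\<close> for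
      \<open>A'\<close> matches length n for \<open>A\<close>; the limit does not see the
      difference.\<close>
    then have "(\<lambda>n. chain_expectation \<beta> J 0 (Suc n) (indicator A') (\<lambda>_. 1)) \<longlonglongrightarrow> prob {\<sigma>\<in>space \<mu>. layer 1 \<sigma> \<in> A'}"
      using assms by (intro LIMSEQ_Suc) (simp add: prob_space)
    moreover have "indicator A' = (\<lambda>\<tau>. indicator A (\<lambda>k. \<tau> (Suc k)) :: real)"
      by (auto simp: A'_def indicator_def fun_eq_iff)
    ultimately have "(\<lambda>n. chain_expectation \<beta> J 0 n (indicator A) (\<lambda>_. 1)) \<longlonglongrightarrow> prob {\<sigma>\<in>space \<mu>. layer 1 \<sigma> \<in> A'}"
      using chain_expectation_shift[of "\<lambda>_. 1" \<beta> J _ "indicator A"] by simp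
    moreover have "(\<lambda>n. chain_expectation \<beta> J h n (indicator A) (\<lambda>_. 1) * prob (space \<mu>)) \<longlonglongrightarrow> prob {\<sigma>\<in>space \<mu>. layer 1 \<sigma> \<in> A}"
      by (rule chain_expectation_tendsto[OF odd_one layer_invariant_space sets.top ev1 A])
    then have "(\<lambda>n. chain_expectation \<beta> J 0 n (indicator A) (\<lambda>_. 1)) \<longlonglongrightarrow> prob {\<sigma>\<in>space \<mu>. layer 1 \<sigma> \<in> A}"
      using assms by (simp add: prob_space)
    ultimately have eq: "prob {\<sigma>\<in>space \<mu>. layer 1 \<sigma> \<in> A'} = prob {\<sigma>\<in>space \<mu>. layer 1 \<sigma> \<in> A}"
      by (rule LIMSEQ_unique)
    have inA: "{\<sigma>\<in>space \<mu>. layer 1 \<sigma> \<in> A} = layer 1 -` (A \<inter> configs UNIV) \<inter> space \<mu>"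
      using layer_in_configs[of 1] by auto
    show "emeasure (distr \<mu> (config_algebra UNIV) (\<lambda>\<sigma> j. layer 1 \<sigma> (1 + j))) (A \<inter> configs UNIV) =
        emeasure (distr \<mu> (config_algebra UNIV) (layer 1)) (A \<inter> configs UNIV)"
      unfolding emeasure_distr[OF m ev] emeasure_distr[OF m1 ev] inA[symmetric] inA'[symmetric]
      by (simp only: emeasure_eq_measure eq)
  qed simp_all
  have "distr \<mu> (config_algebra UNIV) (\<lambda>\<sigma> j. layer 1 \<sigma> (Suc k + j)) =
      distr (distr \<mu> (config_algebra UNIV) (\<lambda>\<sigma> j. layer 1 \<sigma> (k + j))) (config_algebra UNIV) (\<lambda>\<tau> j. \<tau> (1 + j))"
    by (subst distr_distr[OF measurable_tail m]) (simp add: comp_def)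
  also have "\<dots> = distr (distr \<mu> (config_algebra UNIV) (layer 1)) (config_algebra UNIV) (\<lambda>\<tau> j. \<tau> (1 + j))"
    by (simp only: Suc.IH)
  also have "\<dots> = distr \<mu> (config_algebra UNIV) (\<lambda>\<sigma> j. layer 1 \<sigma> (1 + j))"
    by (subst distr_distr[OF measurable_tail m1]) (simp add: comp_def)
  finally show ?case unfolding one .
qed simp

section \<open>First-layer functions\<close>

lemma truncation_tendsto:
  fixes f :: "(nat \<Rightarrow> real) \<Rightarrow> real"
  assumes f: "continuous_map (config_topology UNIV) euclideanreal f" and \<tau>: "\<tau> \<in> configs UNIV"
  shows "(\<lambda>n. f (\<lambda>k. if k < n then \<tau> k else 1)) \<longlonglongrightarrow> f \<tau>"
proof -
  have "limitin (config_topology UNIV) (\<lambda>n k. if k < n then \<tau> k else 1) \<tau> sequentially"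
    unfolding config_topology_def limitin_componentwise
  proof (intro conjI ballI)
    show "\<tau> \<in> extensional UNIV" by simp
    show "\<forall>\<^sub>F n in sequentially. (\<lambda>k. if k < n then \<tau> k else 1) \<in> topspace (product_topology (\<lambda>_. discrete_topology {-1, 1}) UNIV)"
      using \<tau> by (intro always_eventually) (auto simp: configs_def PiE_def Pi_def)
    fix i :: nat
    have "\<tau> i \<in> {-1, 1}" using \<tau> by (auto simp: configs_def PiE_def Pi_def)
    moreover have "\<forall>\<^sub>F n in sequentially. (if i < n then \<tau> i else 1) = \<tau> i"
      using eventually_gt_at_top[of i] by eventually_elim simp
    ultimately show "limitin (discrete_topology {-1, 1}) (\<lambda>n. if i < n then \<tau> i else 1) (\<tau> i) sequentially"
      by (intro limitin_eventually) auto
  qed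
  from continuous_map_limit[OF f this] show ?thesis by (simp add: comp_def)
qed

text \<open>Replacing all spins from n on by 1 stays within the configurations and converges in the
  product topology. So f is a pointwise limit of functions that factor through a map with finitely
  many values.\<close>

lemma borel_measurable_continuous_map_config:
  fixes f :: "(nat \<Rightarrow> real) \<Rightarrow> real"
  assumes f: "continuous_map (config_topology UNIV) euclideanreal f"
  shows "f \<in> borel_measurable (config_algebra UNIV)"
proof (rule borel_measurable_LIMSEQ_real)
  define T where "T n \<tau> = (\<lambda>k. if k < n then \<tau> k else 1)" for n and \<tau> :: "nat \<Rightarrow> real"
  have sp: "space (config_algebra UNIV) = configs UNIV"
    by (simp add: config_algebra_def configs_def space_PiM)
  show "(\<lambda>n. f (T n \<tau>)) \<longlonglongrightarrow> f \<tau>" if "\<tau> \<in> space (config_algebra UNIV)" for \<tau>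
    using truncation_tendsto[OF f] that by (simp add: T_def sp)
  fix n
  have fin: "finite (T n ` configs UNIV)"
  proof (rule finite_subset)
    show "T n ` configs UNIV \<subseteq> (\<lambda>\<omega> k. if k < n then \<omega> k else 1) ` configs {..<n}"
    proof
      fix \<tau>' assume "\<tau>' \<in> T n ` configs UNIV"
      then obtain \<tau> where \<tau>: "\<tau> \<in> configs UNIV" "\<tau>' = T n \<tau>" by blast
      have "restrict \<tau> {..<n} \<in> configs {..<n}" using \<tau>(1) by (auto simp: configs_def PiE_def Pi_def)
      moreover have "\<tau>' = (\<lambda>k. if k < n then restrict \<tau> {..<n} k else 1)"
        by (auto simp: \<tau>(2) T_def)
      ultimately show "\<tau>' \<in> (\<lambda>\<omega> k. if k < n then \<omega> k else 1) ` configs {..<n}" by blast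
    qed
    show "finite ((\<lambda>\<omega> k. if k < n then \<omega> k else 1 :: real) ` configs {..<n})"
      by (intro finite_imageI) (auto simp: configs_def intro!: finite_PiE)
  qed
  have "T n \<in> measurable (config_algebra UNIV) (count_space (T n ` configs UNIV))"
    unfolding measurable_count_space_eq2[OF fin]
  proof (intro conjI ballI)
    show "T n \<in> space (config_algebra UNIV) \<rightarrow> T n ` configs UNIV" by (auto simp: sp)
    fix a assume "a \<in> T n ` configs UNIV"
    then have a: "a k = 1" if "\<not> k < n" for k using that by (auto simp: T_def)
    have "T n -` {a} \<inter> space (config_algebra UNIV) =
        {\<tau> \<in> space (config_algebra UNIV). \<forall>k\<in>{..<n}. \<tau> k \<in> {a k}}"
      using a by (auto simp: T_def fun_eq_iff)
    also have "\<dots> \<in> sets (config_algebra UNIV)"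
    proof (rule sets.sets_Collect_finite_All)
      fix k
      have "(\<lambda>\<tau>. \<tau> k) -` ({a k} \<inter> {-1, 1}) \<inter> space (config_algebra UNIV) \<in> sets (config_algebra UNIV)"
        unfolding config_algebra_def
        by (rule measurable_sets[OF measurable_component_singleton[of k UNIV "\<lambda>_. count_space {-1, 1}"]]) auto
      also have "(\<lambda>\<tau>. \<tau> k) -` ({a k} \<inter> {-1, 1}) \<inter> space (config_algebra UNIV) =
          {\<tau> \<in> space (config_algebra UNIV). \<tau> k \<in> {a k}}"
        by (auto simp: sp configs_def PiE_def Pi_def)
      finally show "{\<tau> \<in> space (config_algebra UNIV). \<tau> k \<in> {a k}} \<in> sets (config_algebra UNIV)" .
    qed auto
    finally show "T n -` {a} \<inter> space (config_algebra UNIV) \<in> sets (config_algebra UNIV)" .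
  qed
  then show "(\<lambda>\<tau>. f (T n \<tau>)) \<in> borel_measurable (config_algebra UNIV)"
    by (rule measurable_compose) simp
qed

lemma continuous_map_config_bounded:
  fixes f :: "(nat \<Rightarrow> real) \<Rightarrow> real"
  assumes f: "continuous_map (config_topology UNIV) euclideanreal f"
  obtains K where "\<And>\<tau>. \<tau> \<in> configs UNIV \<Longrightarrow> \<bar>f \<tau>\<bar> \<le> K"
proof -
  have "compact_space (config_topology UNIV)"
    by (simp add: config_topology_def compact_space_product_topology compact_space_discrete_topology)
  then have "compactin euclideanreal (f ` topspace (config_topology UNIV))"
    using image_compactin[OF _ f] by (simp add: compact_space_def)
  then have "bounded (f ` topspace (config_topology UNIV))"
    by (simp add: compact_imp_bounded)
  moreover have "topspace (config_topology UNIV) = configs UNIV"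
    by (simp add: config_topology_def configs_def)
  ultimately obtain K where "\<forall>x\<in>f ` configs UNIV. norm x \<le> K"
    by (auto simp: bounded_iff)
  then show thesis using that by auto
qed

text \<open>Continuity enters through measurability and, by compactness of the configuration space,
  boundedness; these two consequences are what the locale records.\<close>

locale first_layer_observable = mult_ising +
  fixes f f0 :: "(nat \<Rightarrow> real) \<Rightarrow> real" and K :: real
  assumes f_eq: "\<And>\<sigma>. \<sigma> \<in> configs {1..} \<Longrightarrow> f \<sigma> = f0 (layer 1 \<sigma>)"
    and f0_measurable: "f0 \<in> borel_measurable (config_algebra UNIV)"
    and f0_bounded: "\<And>\<tau>. \<tau> \<in> configs UNIV \<Longrightarrow> \<bar>f0 \<tau>\<bar> \<le> K"
begin

definition tail_sum :: "nat \<Rightarrow> (nat \<Rightarrow> real) \<Rightarrow> real" where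
  "tail_sum n \<tau> = (\<Sum>k<n. f0 (\<lambda>j. \<tau> (k + j)))"

lemma measurable_f0_tail: "(\<lambda>\<tau>. f0 (\<lambda>j. \<tau> (k + j))) \<in> borel_measurable (config_algebra UNIV)"
  by (rule measurable_compose[OF measurable_tail f0_measurable])

lemma measurable_tail_sum: "tail_sum n \<in> borel_measurable (config_algebra UNIV)"
  unfolding tail_sum_def[abs_def] by (intro borel_measurable_sum measurable_f0_tail)

sublocale L: iid_layers \<mu> "\<lambda>r n \<sigma>. tail_sum n (layer r \<sigma>)" K
proof
  note m = measurable_layer[OF odd_pos]
  show "(\<lambda>\<sigma>. tail_sum n (layer r \<sigma>)) \<in> borel_measurable \<mu>" if "odd r" for r n
    by (rule measurable_compose[OF m[OF that] measurable_tail_sum])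
  show "\<bar>tail_sum n (layer r \<sigma>)\<bar> \<le> K * real n" if "odd r" "\<sigma> \<in> space \<mu>" for r n \<sigma>
  proof -
    have "(\<lambda>j. layer r \<sigma> (k + j)) \<in> configs UNIV" for k
      using layer_in_configs[OF odd_pos[OF that(1)] that(2)] by (auto simp: configs_def PiE_def Pi_def)
    then have "(\<Sum>k<n. \<bar>f0 (\<lambda>j. layer r \<sigma> (k + j))\<bar>) \<le> (\<Sum>k<n. K)"
      by (intro sum_mono f0_bounded)
    moreover have "\<bar>tail_sum n (layer r \<sigma>)\<bar> \<le> (\<Sum>k<n. \<bar>f0 (\<lambda>j. layer r \<sigma> (k + j))\<bar>)"
      unfolding tail_sum_def by (rule sum_abs)
    ultimately show ?thesis by (simp add: mult.commute)
  qed
  show "indep_vars (\<lambda>_. borel) (\<lambda>r \<sigma>. tail_sum (layer_length N r) (layer r \<sigma>)) {r. odd r \<and> r \<le> N}" for N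
    by (rule indep_vars_compose2[OF indep_vars_subset[OF indep_layers] measurable_tail_sum]) auto
  show "distr \<mu> borel (\<lambda>\<sigma>. tail_sum n (layer r \<sigma>)) = distr \<mu> borel (\<lambda>\<sigma>. tail_sum n (layer 1 \<sigma>))" if "odd r" for r n
    using distr_distr[OF measurable_tail_sum m[OF that], of n] distr_distr[OF measurable_tail_sum m[OF odd_one], of n]
      distr_layer[OF that] by (simp add: comp_def)
qed

text \<open>Multiplication by \<open>r * 2 ^ k\<close> carries layer 1 to layer \<open>r\<close>
  with its first k sites removed, since
  \<open>(r * 2 ^ k) * 2 ^ j = r * 2 ^ (k + j)\<close>.\<close>

lemma f_mult_shift:
  assumes \<sigma>: "\<sigma> \<in> space \<mu>" and r: "odd r"
  shows "f (mult_shift (r * 2 ^ k) \<sigma>) = f0 (\<lambda>j. layer r \<sigma> (k + j))"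
proof -
  have ge: "r * 2 ^ i \<ge> 1" for i using odd_pos[OF r] by (simp add: Suc_le_eq)
  have "\<sigma> (r * 2 ^ k * j) \<in> {-1, 1}" if "j \<ge> 1" for j
    using spin_values[OF \<sigma>, of "r * 2 ^ k * j"] mult_le_mono[OF ge[of k] that] by auto
  then have "mult_shift (r * 2 ^ k) \<sigma> \<in> configs {1..}"
    by (auto simp: mult_shift_def configs_def)
  then have "f (mult_shift (r * 2 ^ k) \<sigma>) = f0 (layer 1 (mult_shift (r * 2 ^ k) \<sigma>))" by (rule f_eq)
  also have "layer 1 (mult_shift (r * 2 ^ k) \<sigma>) = (\<lambda>j. layer r \<sigma> (k + j))"
    by (auto simp: layer_def mult_shift_def fun_eq_iff power_add mult.assoc Suc_le_eq)
  finally show ?thesis .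
qed

lemma sum_mult_shift:
  assumes \<sigma>: "\<sigma> \<in> space \<mu>"
  shows "(\<Sum>i=1..N. f (mult_shift i \<sigma>)) = L.total N \<sigma>"
  unfolding sum_layers L.total_def
  by (intro sum.cong refl) (simp add: tail_sum_def f_mult_shift[OF \<sigma>])

lemma measurable_f_mult_shift:
  assumes "i \<ge> 1"
  shows "(\<lambda>\<sigma>. f (mult_shift i \<sigma>)) \<in> borel_measurable \<mu>"
proof -
  obtain r k where rk: "odd r" "i = r * 2 ^ k" using odd_times_power_of_2_exists[of i] assms by auto
  have "(\<lambda>\<sigma>. f0 (\<lambda>j. layer r \<sigma> (k + j))) \<in> borel_measurable \<mu>"
    by (rule measurable_compose[OF measurable_layer[OF odd_pos[OF rk(1)]] measurable_f0_tail])
  then show ?thesis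
    by (rule measurable_cong[THEN iffD2, rotated]) (simp add: rk f_mult_shift)
qed

lemma f_mult_shift_bounded:
  assumes "\<sigma> \<in> space \<mu>" "i \<ge> 1"
  shows "\<bar>f (mult_shift i \<sigma>)\<bar> \<le> K"
proof -
  obtain r k where rk: "odd r" "i = r * 2 ^ k" using odd_times_power_of_2_exists[of i] assms by auto
  have "(\<lambda>j. layer r \<sigma> (k + j)) \<in> configs UNIV"
    using layer_in_configs[OF odd_pos[OF rk(1)] assms(1)] by (auto simp: configs_def PiE_def Pi_def)
  then show ?thesis by (simp add: rk f_mult_shift[OF assms(1)] f0_bounded)
qed

lemma finite_pressure_eq:
  "finite_pressure \<mu> (\<lambda>\<sigma>. t * f \<sigma>) N = bounded_variable.cgf \<mu> (L.total N) t / real N"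
proof -
  have "(LINT \<sigma>|\<mu>. exp (\<Sum>i=1..N. t * f (mult_shift i \<sigma>))) = (LINT \<sigma>|\<mu>. exp (t * L.total N \<sigma>))"
    by (intro Bochner_Integration.integral_cong refl)
       (simp only: sum_distrib_left[symmetric] sum_mult_shift)
  then show ?thesis
    by (simp add: finite_pressure_def bounded_variable.cgf_def[OF L.bounded_variable_total]
        bounded_variable.mgf_def[OF L.bounded_variable_total])
qed

lemma finite_pressure_tendsto: "finite_pressure \<mu> (\<lambda>\<sigma>. t * f \<sigma>) \<longlonglongrightarrow> L.P t"
  using L.pressure_tendsto[of t] by (simp add: finite_pressure_eq[abs_def])

lemma pressure_eq: "pressure \<mu> (\<lambda>\<sigma>. t * f \<sigma>) = L.P t"
  unfolding pressure_def by (rule limI[OF finite_pressure_tendsto])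

lemma mult_average_eq: "\<sigma> \<in> space \<mu> \<Longrightarrow> mult_average f N \<sigma> = L.total N \<sigma> / real N"
  by (simp add: mult_average_def sum_mult_shift del: One_nat_def)

lemma ldp:
  "large_deviation_principle (\<lambda>N. distr \<mu> borel (mult_average f N)) real
    (\<lambda>x. SUP t. ereal (t * x - pressure \<mu> (\<lambda>\<sigma>. t * f \<sigma>)))"
proof -
  interpret G: bounded_gaertner_ellis \<mu> "\<lambda>N. mult_average f N" L.P K
  proof
    show "mult_average f N \<in> borel_measurable \<mu>" for N
      unfolding mult_average_def[abs_def]
      by (intro borel_measurable_divide borel_measurable_sum measurable_f_mult_shift) auto
    fix N \<sigma> assume \<sigma>: "\<sigma> \<in> space \<mu>"
    have "\<bar>\<Sum>i=1..N. f (mult_shift i \<sigma>)\<bar> \<le> (\<Sum>i=1..N. K)"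
      by (intro order_trans[OF sum_abs] sum_mono f_mult_shift_bounded[OF \<sigma>]) simp
    then show "\<bar>mult_average f N \<sigma>\<bar> \<le> K"
      using L.K_nonneg by (cases "N = 0") (simp_all add: mult_average_def field_simps)
  next
    fix t
    \<comment> \<open>At N = 0 the average is 0 by division by zero and the total is an empty sum,
      so N times the average equals the total there as well.\<close>
    have "{r::nat. odd r \<and> r \<le> 0} = {}" by (auto dest: odd_pos)
    then have "L.total 0 \<sigma> = 0" for \<sigma> unfolding L.total_def by (simp only: sum.empty)
    then have "real N * mult_average f N \<sigma> = L.total N \<sigma>" if "\<sigma> \<in> space \<mu>" for N \<sigma>
      using that by (cases "N = 0") (simp_all add: mult_average_eq)
    then have "expectation (\<lambda>\<sigma>. exp (t * (real N * mult_average f N \<sigma>))) = bounded_variable.mgf \<mu> (L.total N) t" for N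
      unfolding bounded_variable.mgf_def[OF L.bounded_variable_total]
      by (intro Bochner_Integration.integral_cong refl) simp
    then show "(\<lambda>N. ln (expectation (\<lambda>\<sigma>. exp (t * (real N * mult_average f N \<sigma>)))) / real N) \<longlonglongrightarrow> L.P t"
      using L.pressure_tendsto[of t] by (simp add: bounded_variable.cgf_def[OF L.bounded_variable_total])
  qed
  show ?thesis
    unfolding pressure_eq
    by (rule G.gaertner_ellis) (use L.DERIV_P real_differentiable_def in blast)
qed

lemma clt:
  "weak_conv_m (\<lambda>N. distr \<mu> borel
      (\<lambda>\<sigma>. sqrt (real N) * (mult_average f N \<sigma> - (LINT \<omega>|\<mu>. mult_average f N \<omega>))))
    (centered_normal (L.P'' 0))"
proof -
  have "distr \<mu> borel (\<lambda>\<sigma>. sqrt (real N) * (mult_average f N \<sigma> - expectation (mult_average f N))) =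
      distr \<mu> borel (\<lambda>\<sigma>. (L.total N \<sigma> - expectation (L.total N)) / sqrt (real N))" for N
  proof (rule distr_cong[OF refl refl])
    fix \<sigma> assume \<sigma>: "\<sigma> \<in> space \<mu>"
    have "expectation (mult_average f N) = expectation (\<lambda>\<sigma>. L.total N \<sigma> / real N)"
      by (intro Bochner_Integration.integral_cong refl mult_average_eq)
    also have "\<dots> = expectation (L.total N) / real N" by simp
    finally have "mult_average f N \<sigma> - expectation (mult_average f N) =
        (L.total N \<sigma> - expectation (L.total N)) / real N"
      by (simp add: mult_average_eq[OF \<sigma>] diff_divide_distrib)
    moreover have "sqrt (real N) * (y / real N) = y / sqrt (real N)" for y
    proof -
      \<comment> \<open>The case s = 0 covers N = 0, where both sides are 0 by convention.\<close>
      have *: "s * (y / s / s) = y / s" for s :: real by (cases "s = 0") simp_all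
      have "y / real N = y / sqrt (real N) / sqrt (real N)" by simp
      then show ?thesis by (simp only: *)
    qed
    ultimately show "sqrt (real N) * (mult_average f N \<sigma> - expectation (mult_average f N)) =
        (L.total N \<sigma> - expectation (L.total N)) / sqrt (real N)"
      by (simp only:)
  qed
  then show ?thesis using L.total_clt by simp
qed

lemma integrable_f_mult_shift: "i \<ge> 1 \<Longrightarrow> integrable \<mu> (\<lambda>\<sigma>. f (mult_shift i \<sigma>))"
  by (rule integrable_const_bound[where B = K]) (auto simp: f_mult_shift_bounded measurable_f_mult_shift)

text \<open>Write \<open>i = r * 2 ^ k\<close>: equality of the layer laws removes r, and
  stationarity within a layer removes k.\<close>

lemma expectation_f_mult_shift:
  assumes "h = 0" "i \<ge> 1"
  shows "expectation (\<lambda>\<sigma>. f (mult_shift i \<sigma>)) = expectation f"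
proof -
  obtain r k where rk: "odd r" "i = r * 2 ^ k" using odd_times_power_of_2_exists[of i] assms by auto
  note m = measurable_layer[OF odd_pos]
  have "expectation (\<lambda>\<sigma>. f (mult_shift i \<sigma>)) = expectation (\<lambda>\<sigma>. f0 (\<lambda>j. layer r \<sigma> (k + j)))"
    by (intro Bochner_Integration.integral_cong refl) (simp add: rk f_mult_shift)
  also have "\<dots> = (\<integral>\<tau>. f0 (\<lambda>j. \<tau> (k + j)) \<partial>distr \<mu> (config_algebra UNIV) (layer r))"
    by (rule integral_distr[OF m[OF rk(1)] measurable_f0_tail, symmetric])
  also have "\<dots> = (\<integral>\<tau>. f0 (\<lambda>j. \<tau> (k + j)) \<partial>distr \<mu> (config_algebra UNIV) (layer 1))"
    by (simp only: distr_layer[OF rk(1)])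
  also have "\<dots> = expectation (\<lambda>\<sigma>. f0 (\<lambda>j. layer 1 \<sigma> (k + j)))"
    by (rule integral_distr[OF m[OF odd_one] measurable_f0_tail])
  also have "\<dots> = (\<integral>\<tau>. f0 \<tau> \<partial>distr \<mu> (config_algebra UNIV) (\<lambda>\<sigma> j. layer 1 \<sigma> (k + j)))"
    by (rule integral_distr[OF measurable_compose[OF m[OF odd_one] measurable_tail] f0_measurable, symmetric])
  also have "\<dots> = (\<integral>\<tau>. f0 \<tau> \<partial>distr \<mu> (config_algebra UNIV) (layer 1))"
    by (simp only: distr_tail[OF assms(1)])
  also have "\<dots> = expectation (\<lambda>\<sigma>. f0 (layer 1 \<sigma>))"
    by (rule integral_distr[OF m[OF odd_one] f0_measurable])
  also have "\<dots> = expectation f"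
    by (intro Bochner_Integration.integral_cong refl) (simp add: f_eq space_\<mu>)
  finally show ?thesis .
qed

text \<open>With equal means the subtracted squares add up to the square of
  \<open>expectation (L.total N)\<close>, exactly for each N, so \<open>variance_tendsto\<close>
  gives the limit.\<close>

lemma covariance_sum_tendsto:
  assumes "h = 0"
  shows "(\<lambda>N. (1 / real N) * (\<Sum>i=1..N. \<Sum>j=1..N.
      (expectation (\<lambda>\<sigma>. f (mult_shift i \<sigma>) * f (mult_shift j \<sigma>)) - (expectation f)\<^sup>2)))
    \<longlonglongrightarrow> L.P'' 0"
proof -
  have "(\<Sum>i=1..N. \<Sum>j=1..N. (expectation (\<lambda>\<sigma>. f (mult_shift i \<sigma>) * f (mult_shift j \<sigma>)) - (expectation f)\<^sup>2))
      = variance (L.total N)" for N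
  proof -
    note B = L.bounded_variable_total[of N]
    have int2: "integrable \<mu> (\<lambda>\<sigma>. f (mult_shift i \<sigma>) * f (mult_shift j \<sigma>))" if "i \<ge> 1" "j \<ge> 1" for i j
    proof (rule integrable_const_bound[where B = "K * K"])
      show "AE \<sigma> in \<mu>. norm (f (mult_shift i \<sigma>) * f (mult_shift j \<sigma>)) \<le> K * K"
        using that f_mult_shift_bounded L.K_nonneg
        by (intro AE_I2) (auto simp: abs_mult intro!: mult_mono)
    qed (use that measurable_f_mult_shift in auto)
    have "expectation (L.total N) = expectation (\<lambda>\<sigma>. \<Sum>i=1..N. f (mult_shift i \<sigma>))"
      by (intro Bochner_Integration.integral_cong refl) (simp add: sum_mult_shift del: One_nat_def)
    also have "\<dots> = (\<Sum>i=1..N. expectation (\<lambda>\<sigma>. f (mult_shift i \<sigma>)))"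
      by (intro Bochner_Integration.integral_sum integrable_f_mult_shift) simp
    also have "\<dots> = real N * expectation f"
      using expectation_f_mult_shift[OF assms] by simp
    finally have 1: "expectation (L.total N) = real N * expectation f" .
    have "expectation (\<lambda>\<sigma>. (L.total N \<sigma>)\<^sup>2) =
        expectation (\<lambda>\<sigma>. \<Sum>i=1..N. \<Sum>j=1..N. f (mult_shift i \<sigma>) * f (mult_shift j \<sigma>))"
      by (intro Bochner_Integration.integral_cong refl)
         (simp only: sum_mult_shift[symmetric] power2_eq_square sum_product)
    also have "\<dots> = (\<Sum>i=1..N. expectation (\<lambda>\<sigma>. \<Sum>j=1..N. f (mult_shift i \<sigma>) * f (mult_shift j \<sigma>)))"
      by (intro Bochner_Integration.integral_sum Bochner_Integration.integrable_sum int2) auto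
    also have "\<dots> = (\<Sum>i=1..N. \<Sum>j=1..N. expectation (\<lambda>\<sigma>. f (mult_shift i \<sigma>) * f (mult_shift j \<sigma>)))"
      by (intro sum.cong refl Bochner_Integration.integral_sum int2) auto
    finally have 2: "expectation (\<lambda>\<sigma>. (L.total N \<sigma>)\<^sup>2) =
        (\<Sum>i=1..N. \<Sum>j=1..N. expectation (\<lambda>\<sigma>. f (mult_shift i \<sigma>) * f (mult_shift j \<sigma>)))" .
    have "variance (L.total N) =
        (\<Sum>i=1..N. \<Sum>j=1..N. expectation (\<lambda>\<sigma>. f (mult_shift i \<sigma>) * f (mult_shift j \<sigma>))) -
        (real N * expectation f)\<^sup>2"
      using variance_eq[OF bounded_variable.integrable_S[OF B] bounded_variable.integrable_S2[OF B]]
      by (simp only: 1 2)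
    then show ?thesis
      by (simp add: sum_subtractf power_mult_distrib) (simp add: power2_eq_square)
  qed
  then show ?thesis using L.variance_tendsto by simp
qed

end

theorem theorem4p1:
  fixes \<beta> J h :: real and \<mu> :: "(nat \<Rightarrow> real) measure" and f :: "(nat \<Rightarrow> real) \<Rightarrow> real"
  assumes "\<beta> > 0"
    and "mult_ising_measure \<beta> J h \<mu>"
    and "first_layer_function f"
  shows "(\<forall>t. convergent (finite_pressure \<mu> (\<lambda>\<sigma>. t * f \<sigma>))) \<and>
    large_deviation_principle (\<lambda>N. distr \<mu> borel (mult_average f N)) real
      (\<lambda>x. SUP t. ereal (t * x - pressure \<mu> (\<lambda>\<sigma>. t * f \<sigma>))) \<and>
    (\<exists>v\<ge>0.
       (\<forall>\<^sub>F t in nhds 0. (\<lambda>t. pressure \<mu> (\<lambda>\<sigma>. t * f \<sigma>)) differentiable (at t)) \<and>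
       (deriv (\<lambda>t. pressure \<mu> (\<lambda>\<sigma>. t * f \<sigma>)) has_real_derivative v) (at 0) \<and>
       weak_conv_m
         (\<lambda>N. distr \<mu> borel
            (\<lambda>\<sigma>. sqrt (real N) * (mult_average f N \<sigma> - (LINT \<omega>|\<mu>. mult_average f N \<omega>))))
         (centered_normal v) \<and>
       (h = 0 \<longrightarrow>
         (\<lambda>N. (1 / real N) * (\<Sum>i=1..N. \<Sum>j=1..N.
                ((LINT \<sigma>|\<mu>. f (mult_shift i \<sigma>) * f (mult_shift j \<sigma>)) - (LINT \<sigma>|\<mu>. f \<sigma>)\<^sup>2)))
         \<longlonglongrightarrow> v))"
proof -
  obtain f0 where f0: "continuous_map (config_topology UNIV) euclideanreal f0"
    "\<And>\<sigma>. \<sigma> \<in> configs {1..} \<Longrightarrow> f \<sigma> = f0 (layer 1 \<sigma>)"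
    using assms(3) by (auto simp: first_layer_function_def)
  obtain K where K: "\<And>\<tau>. \<tau> \<in> configs UNIV \<Longrightarrow> \<bar>f0 \<tau>\<bar> \<le> K"
    using continuous_map_config_bounded[OF f0(1)] by blast
  interpret first_layer_observable \<beta> J h \<mu> f f0 K
    by unfold_locales
       (use assms(2) f0(2) K borel_measurable_continuous_map_config[OF f0(1)] in auto)
  have P: "(\<lambda>t. pressure \<mu> (\<lambda>\<sigma>. t * f \<sigma>)) = L.P"
    by (simp add: pressure_eq fun_eq_iff)
  have "deriv L.P = L.P'"
    by (intro ext DERIV_imp_deriv L.DERIV_P)
  then have "(deriv L.P has_real_derivative L.P'' 0) (at 0)"
    by (simp add: L.DERIV_P')
  moreover have "L.P differentiable (at t)" for t
    using L.DERIV_P real_differentiable_def by blast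
  ultimately show ?thesis
    unfolding P
    using finite_pressure_tendsto ldp clt covariance_sum_tendsto L.P''_0_nonneg
    by (intro conjI allI exI[of _ "L.P'' 0"] impI always_eventually convergentI) (simp_all add: P)
qed

end
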